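(* Let $n\ge 0$, let $Q$ be a Dynkin quiver of type $\mathbb{A}_{n+2}$ and let $\pi\in S_{n+1}$. Then $\eta_Q^{\mathrm{rep}}(\pi)=F(\eta_Q(\pi))$ is the maximal almost rigid representation of $Q$ whose indecomposable direct summands are exactly those appearing in the list of representations $\lambda_0^{\mathrm{rep}}(\pi),\dots,\lambda_{n+1}^{\mathrm{rep}}(\pi)$.
   Context: $\Bbbk$ is an algebraically closed field. A Dynkin quiver $Q$ of type $\mathbb{A}_{n+2}$ has vertices $1,\dots,n+2$ and, for each $1\le i\le n+1$, exactly one arrow $\alpha_i$ between $i$ and $i+1$, in either direction. For $1\le i\le j\le n+2$, $M(i,j)$ is the indecomposable representation with $\Bbbk$ at the vertices $i,\dots,j$ and $0$ elsewhere, with identity maps between the nonzero spaces. Put $\overline{[n+1]}=\{i\in[n+1] : i\to (i+1)\text{ in }Q\}$ and $\underline{[n+1]}=\{i\in[n+1]: i\leftarrow (i+1)\text{ in }Q\}$, where $[n+1]=\{1,\dots,n+1\}$. $P(Q)$ is a convex $(n+3)$-gon with vertices labeled $0,1,\dots,n+2$ placed from left to right in this order, with $0$ and $n+2$ on a common horizontal line $L$, the vertices in $\overline{[n+1]}$ above $L$ and those in $\underline{[n+1]}$ below $L$. For $0\le i<j\le n+2$, $\gamma(i,j)$ is the line segment between vertices $i$ and $j$. A triangulation is a maximal set of pairwise noncrossing such segments (including boundary edges). Map $\eta_Q$: write $\pi=\pi_1\pi_2\cdots\pi_{n+1}$ in one-line notation. $\lambda_0(\pi)$ is the piecewise linear path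 from $0$ to $n+2$ through all vertices in $\underline{[n+1]}$ in numerical order. For $\ell\ge1$, $\lambda_\ell(\pi)$ is the piecewise linear path from $0$ to $n+2$, visiting vertices in numerical order, whose set of intermediate vertices is obtained from that of $\lambda_{\ell-1}(\pi)$ by adding $\pi_\ell$ if $\pi_\ell\in\overline{[n+1]}$ and removing $\pi_\ell$ if $\pi_\ell\in\underline{[n+1]}$. $\eta_Q(\pi)$ is the triangulation of $P(Q)$ given by the union of the line segments of $\lambda_0(\pi),\dots,\lambda_{n+1}(\pi)$. Map $F$: $F(\mathcal{T})=\bigoplus_{\gamma(i,j)\in\mathcal{T}}M(i+1,j)$ is a bijection from triangulations of $P(Q)$ to (isomorphism classes of) maximal almost rigid representations of $Q$. Here $T$ is almost rigid if it has no repeated indecomposable summands and for each pair $A,B$ of indecomposable summands, either $\mathrm{Ext}^1(A,B)=0$, or $\mathrm{Ext}^1(A,B)\cong\Bbbk$ is generated by a short exact sequence $0\to B\to E\to A\to 0$ with $E$ indecomposable; $T$ is maximal almost rigid if it is almost rigid and $T\oplus M$ is not almost rigid for every nonzero $M$. Representations $\lambda^{\mathrm{rep}}_\ell(\pi)$: all have $\Bbbk$ at every vertex (dimension vector $(1,\dots,1)$). $\lambda_0^{\mathrm{rep}}(\pi)$ has the zero map on $\alpha_i$ for every $i\in\underline{[n+1]}$ and the identity on all other arrows. For $\ell\ge1$, $\lambda_\ell^{\mathrm{rep}}(\pi)$ is obtained from $\lambda_{\ell-1}^{\mathrm{rep}}(\pi)$ by replacing the identity map on $\alpha_{\pi_\ell}$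 with the zero map if $\pi_\ell\in\overline{[n+1]}$ (a degeneration), and by replacing the zero map on $\alpha_{\pi_\ell}$ with the identity map if $\pi_\ell\in\underline{[n+1]}$ (an extension). *)

theory Defs
  imports
    "HOL-Computational_Algebra.Polynomial"
    "HOL-Combinatorics.Permutations"
    "HOL-Analysis.Starlike"
    "Graph_Theory.Digraph"
    "Jordan_Normal_Form.Matrix_Kernel"
begin

section \<open>Representations of a quiver\<close>

text \<open>
  A quiver is a directed multigraph. Finite-dimensional representations are given in coordinates:
  the space at a vertex \<open>v\<close> is \<open>k^(rdim V v)\<close> and the map on an arrow \<open>a\<close> is left multiplication
  by the matrix \<open>rmap V a\<close>. Up to isomorphism every finite-dimensional representation is of this
  form. Values outside the vertices and arrows of the quiver are irrelevant; therefore
  representations are only ever compared up to isomorphism.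
\<close>

record ('v, 'a, 'k) quiver_rep =
  rdim :: "'v \<Rightarrow> nat"
  rmap :: "'a \<Rightarrow> 'k mat"

definition is_rep ::
  "('v, 'a) pre_digraph \<Rightarrow> ('v, 'a, 'k::field) quiver_rep \<Rightarrow> bool" where
  "is_rep Q V \<longleftrightarrow>
     (\<forall>a\<in>arcs Q. rmap V a \<in> carrier_mat (rdim V (head Q a)) (rdim V (tail Q a)))"

definition is_hom ::
  "('v, 'a) pre_digraph \<Rightarrow> ('v, 'a, 'k::field) quiver_rep \<Rightarrow> ('v, 'a, 'k) quiver_rep \<Rightarrow>
     ('v \<Rightarrow> 'k mat) \<Rightarrow> bool" where
  "is_hom Q V W f \<longleftrightarrow>
     (\<forall>v\<in>verts Q. f v \<in> carrier_mat (rdim W v) (rdim V v)) \<and>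
     (\<forall>a\<in>arcs Q. f (head Q a) * rmap V a = rmap W a * f (tail Q a))"

definition rep_iso ::
  "('v, 'a) pre_digraph \<Rightarrow> ('v, 'a, 'k::field) quiver_rep \<Rightarrow> ('v, 'a, 'k) quiver_rep \<Rightarrow> bool" where
  "rep_iso Q V W \<longleftrightarrow>
     (\<exists>f g. is_hom Q V W f \<and> is_hom Q W V g \<and>
       (\<forall>v\<in>verts Q. g v * f v = 1\<^sub>m (rdim V v) \<and> f v * g v = 1\<^sub>m (rdim W v)))"

definition rep_is_zero :: "('v, 'a) pre_digraph \<Rightarrow> ('v, 'a, 'k::field) quiver_rep \<Rightarrow> bool" where
  "rep_is_zero Q V \<longleftrightarrow> (\<forall>v\<in>verts Q. rdim V v = 0)"

definition zero_rep :: "('v, 'a, 'k::field) quiver_rep" where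
  "zero_rep = \<lparr> rdim = (\<lambda>_. 0), rmap = (\<lambda>_. 0\<^sub>m 0 0) \<rparr>"

definition rep_plus ::
  "('v, 'a, 'k::field) quiver_rep \<Rightarrow> ('v, 'a, 'k) quiver_rep \<Rightarrow> ('v, 'a, 'k) quiver_rep" where
  "rep_plus V W =
     \<lparr> rdim = (\<lambda>v. rdim V v + rdim W v),
       rmap = (\<lambda>a. four_block_mat
                 (rmap V a) (0\<^sub>m (dim_row (rmap V a)) (dim_col (rmap W a)))
                 (0\<^sub>m (dim_row (rmap W a)) (dim_col (rmap V a))) (rmap W a)) \<rparr>"

definition rep_sum :: "('v, 'a, 'k::field) quiver_rep list \<Rightarrow> ('v, 'a, 'k) quiver_rep" where
  "rep_sum Vs = foldr rep_plus Vs zero_rep"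

definition indecomposable ::
  "('v, 'a) pre_digraph \<Rightarrow> ('v, 'a, 'k::field) quiver_rep \<Rightarrow> bool" where
  "indecomposable Q V \<longleftrightarrow> is_rep Q V \<and> \<not> rep_is_zero Q V \<and>
     (\<forall>A B. is_rep Q A \<and> is_rep Q B \<and> rep_iso Q V (rep_plus A B) \<longrightarrow>
        rep_is_zero Q A \<or> rep_is_zero Q B)"

definition indec_summand ::
  "('v, 'a) pre_digraph \<Rightarrow> ('v, 'a, 'k::field) quiver_rep \<Rightarrow> ('v, 'a, 'k) quiver_rep \<Rightarrow> bool" where
  "indec_summand Q A V \<longleftrightarrow> indecomposable Q A \<and>
     (\<exists>B. is_rep Q B \<and> rep_iso Q V (rep_plus A B))"


section \<open>Extensions and almost rigid representations\<close>

text \<open>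
  \<open>short_exact Q B A (E, f, g)\<close>: the sequence \<open>0 \<rightarrow> B \<rightarrow> E \<rightarrow> A \<rightarrow> 0\<close> with maps \<open>f\<close> and \<open>g\<close> is exact.
\<close>

fun short_exact ::
  "('v, 'a) pre_digraph \<Rightarrow> ('v, 'a, 'k::field) quiver_rep \<Rightarrow> ('v, 'a, 'k) quiver_rep \<Rightarrow>
     ('v, 'a, 'k) quiver_rep \<times> ('v \<Rightarrow> 'k mat) \<times> ('v \<Rightarrow> 'k mat) \<Rightarrow> bool" where
  "short_exact Q B A (E, f, g) \<longleftrightarrow>
     is_rep Q E \<and> is_hom Q B E f \<and> is_hom Q E A g \<and>
     (\<forall>v\<in>verts Q.
        mat_kernel (f v) = {0\<^sub>v (rdim B v)} \<and>
        (\<lambda>x. f v *\<^sub>v x) ` carrier_vec (rdim B v) = mat_kernel (g v) \<and>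
        (\<lambda>x. g v *\<^sub>v x) ` carrier_vec (rdim E v) = carrier_vec (rdim A v))"

fun split_ses ::
  "('v, 'a) pre_digraph \<Rightarrow> ('v, 'a, 'k::field) quiver_rep \<Rightarrow>
     ('v, 'a, 'k) quiver_rep \<times> ('v \<Rightarrow> 'k mat) \<times> ('v \<Rightarrow> 'k mat) \<Rightarrow> bool" where
  "split_ses Q A (E, f, g) \<longleftrightarrow>
     (\<exists>s. is_hom Q A E s \<and> (\<forall>v\<in>verts Q. g v * s v = 1\<^sub>m (rdim A v)))"

text \<open>
  \<open>Ext\<^sup>1(A,B)\<close> is the space of equivalence classes of short exact sequences
  \<open>0 \<rightarrow> B \<rightarrow> E \<rightarrow> A \<rightarrow> 0\<close>; its zero element is the class of the split sequences, and the scalar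
  multiple \<open>c \<cdot> \<xi>\<close> is the class of the pushout of \<open>\<xi>\<close> along \<open>c \<cdot> id\<^sub>B\<close>. A sequence \<open>\<zeta>\<close> represents
  \<open>c \<cdot> \<xi>\<close> iff there is a morphism of short exact sequences from \<open>\<xi>\<close> to \<open>\<zeta>\<close> that is \<open>c \<cdot> id\<^sub>B\<close> on the
  left and \<open>id\<^sub>A\<close> on the right.
\<close>

fun represents_multiple ::
  "('v, 'a) pre_digraph \<Rightarrow> 'k \<Rightarrow>
     ('v, 'a, 'k::field) quiver_rep \<times> ('v \<Rightarrow> 'k mat) \<times> ('v \<Rightarrow> 'k mat) \<Rightarrow>
     ('v, 'a, 'k) quiver_rep \<times> ('v \<Rightarrow> 'k mat) \<times> ('v \<Rightarrow> 'k mat) \<Rightarrow> bool" where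
  "represents_multiple Q c (E, f, g) (E', f', g') \<longleftrightarrow>
     (\<exists>h. is_hom Q E E' h \<and>
       (\<forall>v\<in>verts Q. h v * f v = c \<cdot>\<^sub>m f' v \<and> g' v * h v = g v))"

definition Ext1_zero ::
  "('v, 'a) pre_digraph \<Rightarrow> ('v, 'a, 'k::field) quiver_rep \<Rightarrow> ('v, 'a, 'k) quiver_rep \<Rightarrow> bool" where
  "Ext1_zero Q A B \<longleftrightarrow> (\<forall>\<xi>. short_exact Q B A \<xi> \<longrightarrow> split_ses Q A \<xi>)"

text \<open>
  \<open>Ext\<^sup>1(A,B)\<close> is one-dimensional with generator \<open>\<xi>\<close>: the class of \<open>\<xi>\<close> is nonzero and every class
  is a scalar multiple of it.
\<close>

definition Ext1_line_generated_by ::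
  "('v, 'a) pre_digraph \<Rightarrow> ('v, 'a, 'k::field) quiver_rep \<Rightarrow> ('v, 'a, 'k) quiver_rep \<Rightarrow>
     ('v, 'a, 'k) quiver_rep \<times> ('v \<Rightarrow> 'k mat) \<times> ('v \<Rightarrow> 'k mat) \<Rightarrow> bool" where
  "Ext1_line_generated_by Q A B \<xi> \<longleftrightarrow>
     short_exact Q B A \<xi> \<and> \<not> split_ses Q A \<xi> \<and>
     (\<forall>\<zeta>. short_exact Q B A \<zeta> \<longrightarrow> (\<exists>c. represents_multiple Q c \<xi> \<zeta>))"

definition almost_rigid ::
  "('v, 'a) pre_digraph \<Rightarrow> ('v, 'a, 'k::field) quiver_rep \<Rightarrow> bool" where
  "almost_rigid Q T \<longleftrightarrow> is_rep Q T \<and>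
     \<comment> \<open>no repeated indecomposable summands\<close>
     (\<forall>A B. indecomposable Q A \<and> is_rep Q B \<longrightarrow>
        \<not> rep_iso Q T (rep_plus A (rep_plus A B))) \<and>
     (\<forall>A B. indec_summand Q A T \<and> indec_summand Q B T \<longrightarrow>
        Ext1_zero Q A B \<or>
        (\<exists>E f g. indecomposable Q E \<and> Ext1_line_generated_by Q A B (E, f, g)))"

definition maximal_almost_rigid ::
  "('v, 'a) pre_digraph \<Rightarrow> ('v, 'a, 'k::field) quiver_rep \<Rightarrow> bool" where
  "maximal_almost_rigid Q T \<longleftrightarrow> almost_rigid Q T \<and>
     (\<forall>M. is_rep Q M \<and> \<not> rep_is_zero Q M \<longrightarrow> \<not> almost_rigid Q (rep_plus T M))"


section \<open>Dynkin quivers of type A\<close>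

text \<open>The arrow \<open>\<alpha>\<^sub>i\<close> between \<open>i\<close> and \<open>i + 1\<close> is named \<open>i\<close>.\<close>

definition dynkin_A :: "nat \<Rightarrow> (nat, nat) pre_digraph \<Rightarrow> bool" where
  "dynkin_A m Q \<longleftrightarrow> verts Q = {1..m} \<and> arcs Q = {1..<m} \<and>
     (\<forall>i\<in>{1..<m}. (tail Q i = i \<and> head Q i = i + 1) \<or> (tail Q i = i + 1 \<and> head Q i = i))"

definition over :: "nat \<Rightarrow> (nat, nat) pre_digraph \<Rightarrow> nat set" where
  "over n Q = {i \<in> {1..n+1}. tail Q i = i \<and> head Q i = i + 1}"

definition under :: "nat \<Rightarrow> (nat, nat) pre_digraph \<Rightarrow> nat set" where
  "under n Q = {i \<in> {1..n+1}. tail Q i = i + 1 \<and> head Q i = i}"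

definition interval_rep ::
  "(nat, nat) pre_digraph \<Rightarrow> nat \<Rightarrow> nat \<Rightarrow> (nat, nat, 'k::field) quiver_rep" where
  "interval_rep Q i j =
     (let d = (\<lambda>v. if v \<in> {i..j} then 1 else 0) in
      \<lparr> rdim = d,
        rmap = (\<lambda>a. if tail Q a \<in> {i..j} \<and> head Q a \<in> {i..j} then 1\<^sub>m 1
                    else 0\<^sub>m (d (head Q a)) (d (tail Q a))) \<rparr>)"


section \<open>The polygon and its triangulations\<close>

text \<open>
  \<open>p i\<close> is the point of the plane labelled \<open>i\<close>, for \<open>i \<le> n + 2\<close>. The last condition says that each
  of the \<open>n + 3\<close> points is a genuine corner of their convex hull.
\<close>

definition polygon_P :: "nat \<Rightarrow> (nat, nat) pre_digraph \<Rightarrow> (nat \<Rightarrow> real \<times> real) \<Rightarrow> bool" where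
  "polygon_P n Q p \<longleftrightarrow>
     (\<forall>i j. i < j \<and> j \<le> n + 2 \<longrightarrow> fst (p i) < fst (p j)) \<and>
     snd (p (n + 2)) = snd (p 0) \<and>
     (\<forall>i\<in>over n Q. snd (p i) > snd (p 0)) \<and>
     (\<forall>i\<in>under n Q. snd (p i) < snd (p 0)) \<and>
     (\<forall>i\<le>n + 2. p i \<notin> convex hull (p ` ({..n + 2} - {i})))"

definition seg :: "(nat \<Rightarrow> real \<times> real) \<Rightarrow> nat \<Rightarrow> nat \<Rightarrow> (real \<times> real) set" where
  "seg p i j = closed_segment (p i) (p j)"

definition segments :: "nat \<Rightarrow> (nat \<Rightarrow> real \<times> real) \<Rightarrow> (real \<times> real) set set" where
  "segments n p = {seg p i j | i j. i < j \<and> j \<le> n + 2}"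

text \<open>
  The relative interior of a segment is the segment without its endpoints, so segments that only
  share an endpoint do not cross.
\<close>

definition crossing :: "(real \<times> real) set \<Rightarrow> (real \<times> real) set \<Rightarrow> bool" where
  "crossing s t \<longleftrightarrow> s \<noteq> t \<and> rel_interior s \<inter> rel_interior t \<noteq> {}"

definition noncrossing_family ::
  "nat \<Rightarrow> (nat \<Rightarrow> real \<times> real) \<Rightarrow> (real \<times> real) set set \<Rightarrow> bool" where
  "noncrossing_family n p T \<longleftrightarrow> T \<subseteq> segments n p \<and> (\<forall>s\<in>T. \<forall>t\<in>T. \<not> crossing s t)"

definition triangulation ::
  "nat \<Rightarrow> (nat \<Rightarrow> real \<times> real) \<Rightarrow> (real \<times> real) set set \<Rightarrow> bool" where
  "triangulation n p T \<longleftrightarrow> noncrossing_family n p T \<and>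
     (\<forall>T'. noncrossing_family n p T' \<and> T \<subseteq> T' \<longrightarrow> T' = T)"


section \<open>The maps on permutations and triangulations\<close>

text \<open>\<open>lam_inner n Q \<pi> l\<close> is the set of intermediate vertices of the path \<open>\<lambda>\<^sub>l(\<pi>)\<close>.\<close>

fun lam_inner :: "nat \<Rightarrow> (nat, nat) pre_digraph \<Rightarrow> (nat \<Rightarrow> nat) \<Rightarrow> nat \<Rightarrow> nat set" where
  "lam_inner n Q \<pi> 0 = under n Q"
| "lam_inner n Q \<pi> (Suc l) =
     (if \<pi> (Suc l) \<in> over n Q then insert (\<pi> (Suc l)) (lam_inner n Q \<pi> l)
      else lam_inner n Q \<pi> l - {\<pi> (Suc l)})"

definition lam_path :: "nat \<Rightarrow> (nat, nat) pre_digraph \<Rightarrow> (nat \<Rightarrow> nat) \<Rightarrow> nat \<Rightarrow> nat list" where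
  "lam_path n Q \<pi> l = sorted_list_of_set ({0, n + 2} \<union> lam_inner n Q \<pi> l)"

definition path_segments ::
  "(nat \<Rightarrow> real \<times> real) \<Rightarrow> nat list \<Rightarrow> (real \<times> real) set set" where
  "path_segments p xs = {seg p (xs ! k) (xs ! Suc k) | k. Suc k < length xs}"

definition eta ::
  "nat \<Rightarrow> (nat, nat) pre_digraph \<Rightarrow> (nat \<Rightarrow> real \<times> real) \<Rightarrow> (nat \<Rightarrow> nat) \<Rightarrow>
     (real \<times> real) set set" where
  "eta n Q p \<pi> = (\<Union>l\<le>n + 1. path_segments p (lam_path n Q \<pi> l))"

text \<open>
  The map \<open>F\<close> takes values in isomorphism classes; \<open>tri_to_rep\<close> is the representative in which the
  summands are ordered lexicographically by \<open>(i, j)\<close>.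
\<close>

definition tri_to_rep ::
  "nat \<Rightarrow> (nat, nat) pre_digraph \<Rightarrow> (nat \<Rightarrow> real \<times> real) \<Rightarrow> (real \<times> real) set set \<Rightarrow>
     (nat, nat, 'k::field) quiver_rep" where
  "tri_to_rep n Q p T =
     rep_sum [interval_rep Q (i + 1) j. i \<leftarrow> [0..<n + 3], j \<leftarrow> [i + 1..<n + 3], seg p i j \<in> T]"

definition eta_rep ::
  "nat \<Rightarrow> (nat, nat) pre_digraph \<Rightarrow> (nat \<Rightarrow> real \<times> real) \<Rightarrow> (nat \<Rightarrow> nat) \<Rightarrow>
     (nat, nat, 'k::field) quiver_rep" where
  "eta_rep n Q p \<pi> = tri_to_rep n Q p (eta n Q p \<pi>)"

fun lam_rep ::
  "nat \<Rightarrow> (nat, nat) pre_digraph \<Rightarrow> (nat \<Rightarrow> nat) \<Rightarrow> nat \<Rightarrow> (nat, nat, 'k::field) quiver_rep" where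
  "lam_rep n Q \<pi> 0 =
     \<lparr> rdim = (\<lambda>_. 1), rmap = (\<lambda>a. if a \<in> under n Q then 0\<^sub>m 1 1 else 1\<^sub>m 1) \<rparr>"
| "lam_rep n Q \<pi> (Suc l) =
     (lam_rep n Q \<pi> l)
       \<lparr> rmap := (rmap (lam_rep n Q \<pi> l))
           (\<pi> (Suc l) := (if \<pi> (Suc l) \<in> over n Q then 0\<^sub>m 1 1 else 1\<^sub>m 1)) \<rparr>"

end

theory Submission
  imports Defs
begin

text \<open>
  The segment \<open>\<gamma>(i,j)\<close> corresponds to the interval representation \<open>M(i+1,j)\<close>. One relation governs
  both sides: \<open>\<gamma>(k,l)\<close> starts above \<open>\<gamma>(i,j)\<close> and ends below it. Strict convexity places a vertex \<open>k\<close>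
  between \<open>i\<close> and \<open>j\<close> above \<open>\<gamma>(i,j)\<close> iff \<open>k\<close> is an upper vertex, so two segments cross iff they are in
  this relation in one of the two orders. On the other side, an extension of \<open>M(i+1,j)\<close> by \<open>M(k+1,l)\<close> is
  given by one scalar for each arrow from the first interval to the second, and it splits iff these
  scalars are successive differences of scalars on the overlap, with a boundary condition at each end
  of the overlap that has such an arrow; this fails exactly when both ends impose a condition, that is, for
  crossing segments, and then the middle term has dimension \<open>2\<close> at some vertex and is decomposable.

  The paths \<open>\<lambda>\<^sub>l\<close> only move upwards, so their segments do not cross. A segment outside the family must, at
  some time, have a path below it at one vertex and above it at another; an edge of that path crosses it.

  Gabriel's theorem enters only in the form that every nonzero representation has an interval summand.
  At the first vertex \<open>a\<close> of the support, pull back \<open>0\<close> and the full space at \<open>b\<close> along the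
  maps between \<open>a\<close> and \<open>b\<close>. As \<open>b\<close> moves to the right, the first place where the gap between the two
  pull-backs shrinks yields a compatible family of vectors and a dual compatible family of functionals, and
  these split off an interval. As endomorphisms of intervals are scalars, decompositions
  are unique.
\<close>

section \<open>Matrices\<close>

text \<open>The definitions speak of isomorphisms with iterated direct sums, which are awkward to
  rearrange. The proof replaces them by retracts: \<open>A\<close> is a retract of \<open>V\<close>
  if the identity of \<open>A\<close> factors through \<open>V\<close>, and a double retract if it
  does so in two orthogonal ways. Retracts compose and pass through isomorphisms freely. The price
  is the way back to a sum, which needs an explicit complement in coordinates; it is built vertex by
  vertex, for \<open>A\<close> of dimension at most 1 at each vertex, and this covers intervals. A
  composite from an interval through \<open>V\<close> back to the interval is a single scalar, so
  being a retract means that some such scalar is nonzero. The scalar is additive over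
  \<open>V = X + Y\<close>; this gives the exchange property for which the Krull-Schmidt theorem
  uses local endomorphism rings. Almost rigidity quantifies over all indecomposable summands. Since
  each of them is isomorphic to an interval, every clause becomes a statement about pairs
  \<open>(a, b)\<close>, that is, about segments, and isomorphism becomes equality of pairs.
  Extensions are treated in the same spirit, through a vertexwise section and its defect along the
  arrows.\<close>

lemma mat_assoc:
  fixes A :: "'k::semiring_0 mat"
  shows "dim_col A = dim_row B \<Longrightarrow> dim_col B = dim_row C \<Longrightarrow> (A * B) * C = A * (B * C)"
  by (rule assoc_mult_mat[of A "dim_row A" "dim_col A" B "dim_col B" C "dim_col C"]) auto

lemma mat_distrib_left:
  fixes A :: "'k::semiring_0 mat"
  shows "dim_col A = dim_row B \<Longrightarrow> dim_row B = dim_row C \<Longrightarrow> dim_col B = dim_col C \<Longrightarrow>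
    A * (B + C) = A * B + A * C"
  by (rule mult_add_distrib_mat[of A "dim_row A" "dim_col A" B "dim_col B" C]) auto

lemma mat_distrib_right:
  fixes A :: "'k::semiring_0 mat"
  shows "dim_col A = dim_row C \<Longrightarrow> dim_row A = dim_row B \<Longrightarrow> dim_col A = dim_col B \<Longrightarrow>
    (A + B) * C = A * C + B * C"
  by (rule add_mult_distrib_mat[of A "dim_row A" "dim_col A" B C "dim_col C"]) auto

lemma mat_one_left: "dim_row A = n \<Longrightarrow> 1\<^sub>m n * A = (A :: 'k::semiring_1 mat)"
  by (rule left_mult_one_mat) auto

lemma mat_one_right: "dim_col A = n \<Longrightarrow> A * 1\<^sub>m n = (A :: 'k::semiring_1 mat)"
  by (rule right_mult_one_mat) auto

lemma mat_zero_left: "dim_row A = n \<Longrightarrow> 0\<^sub>m m n * A = 0\<^sub>m m (dim_col (A :: 'k::semiring_0 mat))"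
  by (rule left_mult_zero_mat) auto

lemma mat_zero_right: "dim_col A = n \<Longrightarrow> A * 0\<^sub>m n m = 0\<^sub>m (dim_row (A :: 'k::semiring_0 mat)) m"
  by (rule right_mult_zero_mat) auto

lemma mat_add_zero_left: "dim_row A = n \<Longrightarrow> dim_col A = m \<Longrightarrow> 0\<^sub>m n m + A = (A :: 'k::monoid_add mat)"
  by (rule left_add_zero_mat) auto

lemma mat_add_zero_right: "dim_row A = n \<Longrightarrow> dim_col A = m \<Longrightarrow> A + 0\<^sub>m n m = (A :: 'k::monoid_add mat)"
  by (rule right_add_zero_mat) auto

lemma mat_smult_left:
  "dim_col A = dim_row B \<Longrightarrow> (c \<cdot>\<^sub>m A) * B = c \<cdot>\<^sub>m (A * (B :: 'k::comm_semiring_0 mat))"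
  by (rule mult_smult_assoc_mat[of A "dim_row A" "dim_col A" B "dim_col B"]) auto

lemma mat_smult_right:
  "dim_col A = dim_row B \<Longrightarrow> A * (c \<cdot>\<^sub>m B) = c \<cdot>\<^sub>m (A * (B :: 'k::comm_semiring_0 mat))"
  by (rule mult_smult_distrib[of A "dim_row A" "dim_col A" B "dim_col B"]) auto

text \<open>The side conditions are equations between dimensions instead of carrier memberships, so
  the simplifier discharges them once the dimensions are known.\<close>

lemmas mat_simps = mat_assoc mat_distrib_left mat_distrib_right mat_one_left mat_one_right
  mat_zero_left mat_zero_right mat_add_zero_left mat_add_zero_right mat_smult_left mat_smult_right

lemma mat_one_by_one_eq_iff:
  assumes "A \<in> carrier_mat 1 1" "B \<in> carrier_mat 1 1"
  shows "A = B \<longleftrightarrow> A $$ (0,0) = B $$ (0,0)"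
  using assms by (auto intro!: eq_matI)

lemma mat_mult_one_by_one:
  fixes A :: "'k::semiring_0 mat"
  assumes "A \<in> carrier_mat 1 1" "B \<in> carrier_mat 1 1"
  shows "(A * B) $$ (0,0) = A $$ (0,0) * B $$ (0,0)"
  using assms by (auto simp: times_mat_def scalar_prod_def)

text \<open>With these four matrices, identities about direct sums become products governed by
  \<open>prj_inc\<close> and \<open>inc_prj_sum\<close>, and block matrices need not be opened
  again.\<close>

definition inc1 :: "nat \<Rightarrow> nat \<Rightarrow> 'k::field mat" where
  "inc1 n m = mat (n + m) n (\<lambda>(i,j). if i = j then 1 else 0)"
definition inc2 :: "nat \<Rightarrow> nat \<Rightarrow> 'k::field mat" where
  "inc2 n m = mat (n + m) m (\<lambda>(i,j). if i = n + j then 1 else 0)"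
definition prj1 :: "nat \<Rightarrow> nat \<Rightarrow> 'k::field mat" where
  "prj1 n m = mat n (n + m) (\<lambda>(i,j). if i = j then 1 else 0)"
definition prj2 :: "nat \<Rightarrow> nat \<Rightarrow> 'k::field mat" where
  "prj2 n m = mat m (n + m) (\<lambda>(i,j). if n + i = j then 1 else 0)"

lemma inc_prj_dim [simp]:
  "dim_row (inc1 n m) = n + m" "dim_col (inc1 n m) = n"
  "dim_row (inc2 n m) = n + m" "dim_col (inc2 n m) = m"
  "dim_row (prj1 n m) = n" "dim_col (prj1 n m) = n + m"
  "dim_row (prj2 n m) = m" "dim_col (prj2 n m) = n + m"
  by (simp_all add: inc1_def inc2_def prj1_def prj2_def)

lemma sum_delta_one:
  fixes i n a :: nat
  shows "(\<Sum>k\<in>{0..<n}. (if k = i then c else 0) * (f k :: 'k::semiring_1)) = (if i < n then c * f i else 0)"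
  "(\<Sum>k\<in>{0..<n}. (if i = k then c else 0) * f k) = (if i < n then c * f i else 0)"
  "(\<Sum>k\<in>{0..<n}. (if k = a + i then c else 0) * f k) = (if a + i < n then c * f (a + i) else 0)"
  "(\<Sum>k\<in>{0..<n}. (if a + i = k then c else 0) * f k) = (if a + i < n then c * f (a + i) else 0)"
  by (auto simp: if_distrib[of "\<lambda>x. x * _"] sum.delta sum.delta' cong: if_cong)

lemma prj_inc [simp]:
  "prj1 n m * inc1 n m = (1\<^sub>m n :: 'k::field mat)" "prj2 n m * inc2 n m = (1\<^sub>m m :: 'k mat)"
  "prj1 n m * inc2 n m = (0\<^sub>m n m :: 'k mat)" "prj2 n m * inc1 n m = (0\<^sub>m m n :: 'k mat)"
  by (rule eq_matI; auto simp: inc1_def inc2_def prj1_def prj2_def scalar_prod_def sum_delta_one)+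

lemma inc_prj_sum: "inc1 n m * prj1 n m + inc2 n m * prj2 n m = (1\<^sub>m (n + m) :: 'k::field mat)"
proof (rule eq_matI)
  fix i j assume ij: "i < dim_row (1\<^sub>m (n+m) :: 'k mat)" "j < dim_col (1\<^sub>m (n+m) :: 'k mat)"
  \<comment> \<open>Solved for \<open>k\<close>, so that the delta sum rule applies; the guard
    \<open>n \<le> i\<close> protects against truncated subtraction.\<close>
  have s: "(\<Sum>k = 0..<m. (if i = n + k then 1 else 0) * (if n + k = j then 1 else (0::'k)))
      = (\<Sum>k = 0..<m. (if k = i - n \<and> n \<le> i then 1 else 0) * (if n + k = j then 1 else 0))"
    by (rule sum.cong) auto
  show "(inc1 n m * prj1 n m + inc2 n m * prj2 n m) $$ (i,j) = (1\<^sub>m (n + m) :: 'k mat) $$ (i,j)"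
  proof (cases "n \<le> i")
    case True
    then show ?thesis using ij
      by (auto simp: inc1_def inc2_def prj1_def prj2_def scalar_prod_def s sum_delta_one)
  next
    case False
    then show ?thesis using ij
      by (auto simp: inc1_def inc2_def prj1_def prj2_def scalar_prod_def s sum_delta_one)
  qed
qed auto

text \<open>All four identities follow from one: the block matrix is the sum of its blocks, each
  carried to its place by an inclusion and a projection.\<close>

lemma four_block_inc_prj:
  fixes A :: "'k::field mat"
  assumes "A \<in> carrier_mat r1 c1" "B \<in> carrier_mat r1 c2" "C \<in> carrier_mat r2 c1" "D \<in> carrier_mat r2 c2"
  shows "four_block_mat A B C D * inc1 c1 c2 = inc1 r1 r2 * A + inc2 r1 r2 * C" (is ?a)
    and "four_block_mat A B C D * inc2 c1 c2 = inc1 r1 r2 * B + inc2 r1 r2 * D" (is ?b)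
    and "prj1 r1 r2 * four_block_mat A B C D = A * prj1 c1 c2 + B * prj2 c1 c2" (is ?c)
    and "prj2 r1 r2 * four_block_mat A B C D = C * prj1 c1 c2 + D * prj2 c1 c2" (is ?d)
proof -
  let ?F = "four_block_mat A B C D"
  have [simp]: "dim_row A = r1" "dim_col A = c1" "dim_row B = r1" "dim_col B = c2"
    "dim_row C = r2" "dim_col C = c1" "dim_row D = r2" "dim_col D = c2"
    using assms by auto
  have F: "?F = inc1 r1 r2 * A * prj1 c1 c2 + inc1 r1 r2 * B * prj2 c1 c2
      + (inc2 r1 r2 * C * prj1 c1 c2 + inc2 r1 r2 * D * prj2 c1 c2)"
  proof (rule eq_matI)
    have e1: "M * prj1 c1 c2 = mat (dim_row M) (c1 + c2) (\<lambda>(i,j). if j < c1 then M $$ (i,j) else 0)"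
      if "dim_col M = c1" for M :: "'k mat"
      using that by (auto intro!: eq_matI simp: prj1_def scalar_prod_def if_distrib[of "\<lambda>x. _ * x"] sum.delta sum.delta' cong: if_cong)
    have e2: "M * prj2 c1 c2 = mat (dim_row M) (c1 + c2) (\<lambda>(i,j). if c1 \<le> j then M $$ (i,j-c1) else 0)"
      if "dim_col M = c2" for M :: "'k mat"
    proof (rule eq_matI)
      fix i j assume "i < dim_row (mat (dim_row M) (c1 + c2) (\<lambda>(i,j). if c1 \<le> j then M $$ (i,j-c1) else 0))"
        "j < dim_col (mat (dim_row M) (c1 + c2) (\<lambda>(i,j). if c1 \<le> j then M $$ (i,j-c1) else 0))"
      then have ij: "i < dim_row M" "j < c1 + c2" by auto
      have "(\<Sum>k = 0..<c2. M $$ (i,k) * (if c1 + k = j then 1 else 0))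
        = (\<Sum>k = 0..<c2. (if k = j - c1 then (if c1 \<le> j then M $$ (i,j-c1) else 0) else 0))"
        by (rule sum.cong) auto
      then show "(M * prj2 c1 c2) $$ (i,j) = mat (dim_row M) (c1 + c2) (\<lambda>(i,j). if c1 \<le> j then M $$ (i,j-c1) else 0) $$ (i,j)"
        using ij that by (auto simp: prj2_def scalar_prod_def sum.delta)
    qed (use that in auto)
    have e3: "inc1 r1 r2 * M = mat (r1 + r2) (dim_col M) (\<lambda>(i,j). if i < r1 then M $$ (i,j) else 0)"
      if "dim_row M = r1" for M :: "'k mat"
      using that by (auto intro!: eq_matI simp: inc1_def scalar_prod_def sum_delta_one)
    have e4: "inc2 r1 r2 * M = mat (r1 + r2) (dim_col M) (\<lambda>(i,j). if r1 \<le> i then M $$ (i-r1,j) else 0)"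
      if "dim_row M = r2" for M :: "'k mat"
    proof (rule eq_matI)
      fix i j assume "i < dim_row (mat (r1 + r2) (dim_col M) (\<lambda>(i,j). if r1 \<le> i then M $$ (i-r1,j) else 0))"
        "j < dim_col (mat (r1 + r2) (dim_col M) (\<lambda>(i,j). if r1 \<le> i then M $$ (i-r1,j) else 0))"
      then have ij: "j < dim_col M" "i < r1 + r2" by auto
      have "(\<Sum>k = 0..<r2. (if i = r1 + k then 1 else 0) * M $$ (k,j))
        = (\<Sum>k = 0..<r2. (if k = i - r1 then (if r1 \<le> i then M $$ (i-r1,j) else 0) else 0))"
        by (rule sum.cong) auto
      then show "(inc2 r1 r2 * M) $$ (i,j) = mat (r1 + r2) (dim_col M) (\<lambda>(i,j). if r1 \<le> i then M $$ (i-r1,j) else 0) $$ (i,j)"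
        using ij that by (auto simp: inc2_def scalar_prod_def sum.delta)
    qed (use that in auto)
    fix i j
    assume "i < dim_row (inc1 r1 r2 * A * prj1 c1 c2 + inc1 r1 r2 * B * prj2 c1 c2
      + (inc2 r1 r2 * C * prj1 c1 c2 + inc2 r1 r2 * D * prj2 c1 c2))"
      "j < dim_col (inc1 r1 r2 * A * prj1 c1 c2 + inc1 r1 r2 * B * prj2 c1 c2
      + (inc2 r1 r2 * C * prj1 c1 c2 + inc2 r1 r2 * D * prj2 c1 c2))"
    then have "i < r1 + r2" "j < c1 + c2" by auto
    then show "?F $$ (i,j) = (inc1 r1 r2 * A * prj1 c1 c2 + inc1 r1 r2 * B * prj2 c1 c2
      + (inc2 r1 r2 * C * prj1 c1 c2 + inc2 r1 r2 * D * prj2 c1 c2)) $$ (i,j)"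
      by (auto simp: e1 e2 e3 e4 four_block_mat_def simp del: index_mult_mat)
  qed auto
  have [simp]: "prj1 a b * (inc1 a b * (X :: 'k mat)) = X" "prj2 a b * (inc1 a b * X) = 0\<^sub>m b (dim_col X)"
    if "dim_row X = a" for X a b
    using that by (simp_all add: mat_simps flip: mat_assoc)
  have [simp]: "prj2 a b * (inc2 a b * (X :: 'k mat)) = X" "prj1 a b * (inc2 a b * X) = 0\<^sub>m a (dim_col X)"
    if "dim_row X = b" for X a b
    using that by (simp_all add: mat_simps flip: mat_assoc)
  show ?a ?b ?c ?d
    by (simp_all add: F mat_simps)
qed

section \<open>Biproducts and retracts of representations\<close>

lemma is_hom_dims:
  assumes "is_hom Q V W f" "v \<in> verts Q"
  shows "f v \<in> carrier_mat (rdim W v) (rdim V v)" "dim_row (f v) = rdim W v" "dim_col (f v) = rdim V v"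
  using assms by (auto simp: is_hom_def)

lemma is_hom_square:
  "is_hom Q V W f \<Longrightarrow> a \<in> arcs Q \<Longrightarrow> f (head Q a) * rmap V a = rmap W a * f (tail Q a)"
  by (simp add: is_hom_def)

lemma is_rep_dims:
  assumes "is_rep Q V" "a \<in> arcs Q"
  shows "rmap V a \<in> carrier_mat (rdim V (head Q a)) (rdim V (tail Q a))"
    "dim_row (rmap V a) = rdim V (head Q a)" "dim_col (rmap V a) = rdim V (tail Q a)"
  using assms by (auto simp: is_rep_def)

lemma rdim_rep_plus [simp]: "rdim (rep_plus V W) v = rdim V v + rdim W v"
  by (simp add: rep_plus_def)

lemma rmap_rep_plus:
  assumes "is_rep Q V" "is_rep Q W" "a \<in> arcs Q"
  shows "rmap (rep_plus V W) a = four_block_mat (rmap V a) (0\<^sub>m (rdim V (head Q a)) (rdim W (tail Q a)))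
     (0\<^sub>m (rdim W (head Q a)) (rdim V (tail Q a))) (rmap W a)"
  using assms by (simp add: rep_plus_def is_rep_dims)

lemma is_rep_plus: "is_rep Q V \<Longrightarrow> is_rep Q W \<Longrightarrow> is_rep Q (rep_plus V W)"
  unfolding is_rep_def[of Q "rep_plus V W"]
  by (auto simp: rmap_rep_plus is_rep_dims)

lemma is_rep_zero: "is_rep Q zero_rep"
  by (simp add: is_rep_def zero_rep_def)

lemma rep_sum_simps [simp]: "rep_sum [] = zero_rep" "rep_sum (V # Vs) = rep_plus V (rep_sum Vs)"
  by (simp_all add: rep_sum_def)

lemma is_rep_sum: "(\<And>V. V \<in> set Vs \<Longrightarrow> is_rep Q V) \<Longrightarrow> is_rep Q (rep_sum Vs)"
  by (induction Vs) (auto simp: is_rep_zero is_rep_plus)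

text \<open>If \<open>n\<close> exceeded \<open>k\<close>, padding \<open>A\<close> with zero
  columns and \<open>B\<close> with zero rows would give square matrices with product 1. The product
  in the other order would then be 1 too, although its last rows vanish.\<close>

lemma inverse_dim_le:
  fixes A B :: "'k::field mat"
  assumes "A \<in> carrier_mat n k" "B \<in> carrier_mat k n" "A * B = 1\<^sub>m n"
  shows "n \<le> k"
proof (rule ccontr)
  assume "\<not> n \<le> k"
  then obtain l where n: "n = k + Suc l" by (metis add_Suc_right less_iff_Suc_add not_le)
  have [simp]: "dim_row A = n" "dim_col A = k" "dim_row B = k" "dim_col B = n" using assms by auto
  have "(A * prj1 k (Suc l)) * (inc1 k (Suc l) * B) = A * ((prj1 k (Suc l) * inc1 k (Suc l)) * B)"
    by (simp add: mat_assoc del: prj_inc)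
  also have "\<dots> = 1\<^sub>m n"
    by (simp only: prj_inc) (subst mat_one_left, simp, rule assms(3))
  finally have e: "(A * prj1 k (Suc l)) * (inc1 k (Suc l) * B) = 1\<^sub>m n" .
  have "(inc1 k (Suc l) * B) * (A * prj1 k (Suc l)) = 1\<^sub>m n"
    by (rule mat_mult_left_right_inverse[OF _ _ e]) (rule carrier_matI; simp; simp add: n)+
  then have "prj2 k (Suc l) = prj2 k (Suc l) * ((inc1 k (Suc l) * B) * (A * prj1 k (Suc l)))"
    by (simp only:) (rule mat_one_right[symmetric], simp add: n)
  also have "\<dots> = (prj2 k (Suc l) * inc1 k (Suc l)) * (B * (A * prj1 k (Suc l)))"
    by (simp add: mat_assoc del: prj_inc)
  also have "\<dots> = 0\<^sub>m (Suc l) (k + Suc l)"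
    by (simp only: prj_inc) (subst mat_zero_left, simp_all)
  finally have "prj2 k (Suc l) $$ (0, k) = (0 :: 'k)" by simp
  then show False by (simp add: prj2_def)
qed

text \<open>By \<open>rep_iso_plus_iff\<close> the existence of such maps is the same as an
  isomorphism of \<open>V\<close> with \<open>rep_plus A B\<close>; the equations can be transported
  without touching blocks.\<close>

definition biproduct ::
  "('v, 'a) pre_digraph \<Rightarrow> ('v, 'a, 'k::field) quiver_rep \<Rightarrow> ('v, 'a, 'k) quiver_rep \<Rightarrow>
    ('v, 'a, 'k) quiver_rep \<Rightarrow> ('v \<Rightarrow> 'k mat) \<Rightarrow> ('v \<Rightarrow> 'k mat) \<Rightarrow> ('v \<Rightarrow> 'k mat) \<Rightarrow> ('v \<Rightarrow> 'k mat) \<Rightarrow> bool" where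
  "biproduct Q V A B i p j q \<longleftrightarrow>
     is_hom Q A V i \<and> is_hom Q V A p \<and> is_hom Q B V j \<and> is_hom Q V B q \<and>
     (\<forall>v\<in>verts Q. p v * i v = 1\<^sub>m (rdim A v) \<and> q v * j v = 1\<^sub>m (rdim B v) \<and>
        p v * j v = 0\<^sub>m (rdim A v) (rdim B v) \<and> q v * i v = 0\<^sub>m (rdim B v) (rdim A v) \<and>
        i v * p v + j v * q v = 1\<^sub>m (rdim V v))"

lemma biproduct_homs:
  assumes "biproduct Q V A B i p j q"
  shows "is_hom Q A V i" "is_hom Q V A p" "is_hom Q B V j" "is_hom Q V B q"
  using assms by (auto simp: biproduct_def)

definition retract ::
  "('v, 'a) pre_digraph \<Rightarrow> ('v, 'a, 'k::field) quiver_rep \<Rightarrow> ('v, 'a, 'k) quiver_rep \<Rightarrow> bool" where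
  "retract Q A V \<longleftrightarrow> (\<exists>f g. is_hom Q A V f \<and> is_hom Q V A g \<and>
     (\<forall>v\<in>verts Q. g v * f v = 1\<^sub>m (rdim A v)))"

text \<open>Expresses that the sum of two copies of \<open>A\<close> is a retract of
  \<open>V\<close>, without forming that sum.\<close>

definition double_retract ::
  "('v, 'a) pre_digraph \<Rightarrow> ('v, 'a, 'k::field) quiver_rep \<Rightarrow> ('v, 'a, 'k) quiver_rep \<Rightarrow> bool" where
  "double_retract Q A V \<longleftrightarrow> (\<exists>f f' g g'. is_hom Q A V f \<and> is_hom Q V A g \<and> is_hom Q A V f' \<and> is_hom Q V A g' \<and>
     (\<forall>v\<in>verts Q. g v * f v = 1\<^sub>m (rdim A v) \<and> g' v * f' v = 1\<^sub>m (rdim A v) \<and>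
        g v * f' v = 0\<^sub>m (rdim A v) (rdim A v) \<and> g' v * f v = 0\<^sub>m (rdim A v) (rdim A v)))"

context wf_digraph
begin

lemma is_hom_id: "is_rep G V \<Longrightarrow> is_hom G V V (\<lambda>v. 1\<^sub>m (rdim V v))"
  by (auto simp: is_hom_def mat_simps is_rep_dims)

lemma is_hom_comp:
  assumes "is_rep G U" "is_rep G V" "is_rep G W" "is_hom G U V f" "is_hom G V W g"
  shows "is_hom G U W (\<lambda>v. g v * f v)"
  unfolding is_hom_def
proof (intro conjI ballI)
  fix v assume "v \<in> verts G"
  then show "g v * f v \<in> carrier_mat (rdim W v) (rdim U v)"
    using is_hom_dims[OF assms(4)] is_hom_dims[OF assms(5)] by auto
next
  fix a assume a: "a \<in> arcs G"
  note [simp] = head_in_verts[OF a] tail_in_verts[OF a] is_rep_dims[OF assms(1) a] is_rep_dims[OF assms(2) a]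
    is_rep_dims[OF assms(3) a] is_hom_dims[OF assms(4)] is_hom_dims[OF assms(5)]
  have "g (head G a) * f (head G a) * rmap U a = g (head G a) * (rmap V a * f (tail G a))"
    by (simp add: mat_assoc is_hom_square[OF assms(4) a])
  also have "\<dots> = rmap W a * (g (tail G a) * f (tail G a))"
    by (simp add: is_hom_square[OF assms(5) a] flip: mat_assoc)
  finally show "g (head G a) * f (head G a) * rmap U a = rmap W a * (g (tail G a) * f (tail G a))" .
qed

lemma is_hom_add:
  assumes "is_rep G U" "is_rep G V" "is_hom G U V f" "is_hom G U V g"
  shows "is_hom G U V (\<lambda>v. f v + g v)"
  using assms unfolding is_hom_def[of G U V "\<lambda>v. f v + g v"]
  by (auto simp: mat_simps is_hom_dims is_hom_square is_rep_dims intro!: add_carrier_mat is_hom_dims(1))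

lemma is_hom_smult:
  assumes "is_rep G U" "is_rep G V" "is_hom G U V f"
  shows "is_hom G U V (\<lambda>v. c \<cdot>\<^sub>m f v)"
  using assms unfolding is_hom_def[of G U V "\<lambda>v. c \<cdot>\<^sub>m f v"]
  by (auto simp: mat_simps is_hom_dims is_hom_square is_rep_dims)

lemma rep_iso_refl: "is_rep G V \<Longrightarrow> rep_iso G V V"
  unfolding rep_iso_def by (intro exI[of _ "\<lambda>v. 1\<^sub>m (rdim V v)"]) (auto simp: is_hom_id)

lemma rep_iso_sym: "rep_iso G V W \<Longrightarrow> rep_iso G W V"
  unfolding rep_iso_def by blast

lemma rep_iso_trans:
  assumes "is_rep G U" "is_rep G V" "is_rep G W" "rep_iso G U V" "rep_iso G V W"
  shows "rep_iso G U W"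
proof -
  obtain f f' where f: "is_hom G U V f" "is_hom G V U f'"
      "\<And>v. v \<in> verts G \<Longrightarrow> f' v * f v = 1\<^sub>m (rdim U v) \<and> f v * f' v = 1\<^sub>m (rdim V v)"
    using assms unfolding rep_iso_def by auto
  obtain g g' where g: "is_hom G V W g" "is_hom G W V g'"
      "\<And>v. v \<in> verts G \<Longrightarrow> g' v * g v = 1\<^sub>m (rdim V v) \<and> g v * g' v = 1\<^sub>m (rdim W v)"
    using assms unfolding rep_iso_def by auto
  have "(f' v * g' v) * (g v * f v) = 1\<^sub>m (rdim U v) \<and> (g v * f v) * (f' v * g' v) = 1\<^sub>m (rdim W v)"
    if v: "v \<in> verts G" for v
  proof -
    note [simp] = is_hom_dims[OF f(1) v] is_hom_dims[OF f(2) v] is_hom_dims[OF g(1) v] is_hom_dims[OF g(2) v]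
    have "(f' v * g' v) * (g v * f v) = f' v * ((g' v * g v) * f v)"
      "(g v * f v) * (f' v * g' v) = g v * ((f v * f' v) * g' v)"
      by (simp_all add: mat_assoc del: f g)
    then show ?thesis using f(3)[OF v] g(3)[OF v] by (simp add: mat_simps)
  qed
  then show ?thesis
    unfolding rep_iso_def using is_hom_comp[OF assms(1-3) f(1) g(1)] is_hom_comp[OF assms(3,2,1) g(2) f(2)]
    by blast
qed

lemma rep_iso_rdim:
  assumes "rep_iso G V W" "v \<in> verts G"
  shows "rdim V v = rdim W v"
proof -
  obtain f g where fg: "is_hom G V W f" "is_hom G W V g"
    "g v * f v = 1\<^sub>m (rdim V v)" "f v * g v = 1\<^sub>m (rdim W v)"
    using assms unfolding rep_iso_def by auto
  have c: "f v \<in> carrier_mat (rdim W v) (rdim V v)" "g v \<in> carrier_mat (rdim V v) (rdim W v)"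
    using fg assms(2) by (auto simp: is_hom_def)
  show ?thesis
    using inverse_dim_le[OF c(2,1) fg(3)] inverse_dim_le[OF c fg(4)] by simp
qed

lemma rep_plus_biproduct:
  assumes "is_rep G V" "is_rep G W"
  shows "biproduct G (rep_plus V W) V W
    (\<lambda>v. inc1 (rdim V v) (rdim W v)) (\<lambda>v. prj1 (rdim V v) (rdim W v))
    (\<lambda>v. inc2 (rdim V v) (rdim W v)) (\<lambda>v. prj2 (rdim V v) (rdim W v))"
proof -
  have sq: "inc1 (rdim V (head G a)) (rdim W (head G a)) * rmap V a
      = rmap (rep_plus V W) a * inc1 (rdim V (tail G a)) (rdim W (tail G a))"
    "inc2 (rdim V (head G a)) (rdim W (head G a)) * rmap W a
      = rmap (rep_plus V W) a * inc2 (rdim V (tail G a)) (rdim W (tail G a))"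
    "prj1 (rdim V (head G a)) (rdim W (head G a)) * rmap (rep_plus V W) a
      = rmap V a * prj1 (rdim V (tail G a)) (rdim W (tail G a))"
    "prj2 (rdim V (head G a)) (rdim W (head G a)) * rmap (rep_plus V W) a
      = rmap W a * prj2 (rdim V (tail G a)) (rdim W (tail G a))"
    if a: "a \<in> arcs G" for a
  proof -
    note [simp] = is_rep_dims[OF assms(1) a] is_rep_dims[OF assms(2) a]
    note F = four_block_inc_prj[OF is_rep_dims(1)[OF assms(1) a] zero_carrier_mat zero_carrier_mat is_rep_dims(1)[OF assms(2) a]]
    show "inc1 (rdim V (head G a)) (rdim W (head G a)) * rmap V a
      = rmap (rep_plus V W) a * inc1 (rdim V (tail G a)) (rdim W (tail G a))"
    "inc2 (rdim V (head G a)) (rdim W (head G a)) * rmap W a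
      = rmap (rep_plus V W) a * inc2 (rdim V (tail G a)) (rdim W (tail G a))"
    "prj1 (rdim V (head G a)) (rdim W (head G a)) * rmap (rep_plus V W) a
      = rmap V a * prj1 (rdim V (tail G a)) (rdim W (tail G a))"
    "prj2 (rdim V (head G a)) (rdim W (head G a)) * rmap (rep_plus V W) a
      = rmap W a * prj2 (rdim V (tail G a)) (rdim W (tail G a))"
      unfolding rmap_rep_plus[OF assms a] F
      by (simp_all add: mat_zero_left mat_zero_right mat_add_zero_left mat_add_zero_right)
  qed
  have "is_hom G V (rep_plus V W) (\<lambda>v. inc1 (rdim V v) (rdim W v))"
    "is_hom G W (rep_plus V W) (\<lambda>v. inc2 (rdim V v) (rdim W v))"
    "is_hom G (rep_plus V W) V (\<lambda>v. prj1 (rdim V v) (rdim W v))"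
    "is_hom G (rep_plus V W) W (\<lambda>v. prj2 (rdim V v) (rdim W v))"
    unfolding is_hom_def by (auto simp: sq)
  then show ?thesis
    by (auto simp: biproduct_def inc_prj_sum)
qed

text \<open>The isomorphism leaves \<open>V\<close> by its two projections and enters
  \<open>W\<close> by the two inclusions; its inverse does the same with the roles
  exchanged.\<close>

lemma biproduct_iso:
  fixes V W A B :: "('a, 'b, 'k::field) quiver_rep"
  assumes "is_rep G V" "is_rep G W" "is_rep G A" "is_rep G B"
    "biproduct G V A B i p j q" "biproduct G W A B i' p' j' q'"
  shows "rep_iso G V W"
proof -
  note b = assms(5)[unfolded biproduct_def] assms(6)[unfolded biproduct_def]
  have h: "is_hom G V W (\<lambda>v. i' v * p v + j' v * q v)" "is_hom G W V (\<lambda>v. i v * p' v + j v * q' v)"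
    by (intro is_hom_add[OF assms(1,2)] is_hom_add[OF assms(2,1)] is_hom_comp[OF assms(1,3,2)]
        is_hom_comp[OF assms(1,4,2)] is_hom_comp[OF assms(2,3,1)] is_hom_comp[OF assms(2,4,1)]
        biproduct_homs[OF assms(5)] biproduct_homs[OF assms(6)])+
  \<comment> \<open>Stated for arbitrary \<open>V\<close> and \<open>W\<close>, so that both inverse
    laws are instances.\<close>
  have "(i v * p' v + j v * q' v) * (i' v * p v + j' v * q v) = 1\<^sub>m (rdim V v)"
    if v: "v \<in> verts G" and b: "biproduct G V A B i p j q" "biproduct G W A B i' p' j' q'"
    for V W :: "('a, 'b, 'k) quiver_rep" and i p j q i' p' j' q' v
  proof -
    have homs: "is_hom G A V i" "is_hom G V A p" "is_hom G B V j" "is_hom G V B q"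
      "is_hom G A W i'" "is_hom G W A p'" "is_hom G B W j'" "is_hom G W B q'"
      using b unfolding biproduct_def by auto
    note [simp] = homs[THEN is_hom_dims(2), OF v] homs[THEN is_hom_dims(3), OF v]
    have e: "p' v * i' v = 1\<^sub>m (rdim A v)" "q' v * j' v = 1\<^sub>m (rdim B v)"
      "p' v * j' v = 0\<^sub>m (rdim A v) (rdim B v)" "q' v * i' v = 0\<^sub>m (rdim B v) (rdim A v)"
      "i v * p v + j v * q v = 1\<^sub>m (rdim V v)"
      using b v unfolding biproduct_def by auto
    have "p' v * (i' v * p v) = p v" "q' v * (i' v * p v) = 0\<^sub>m (rdim B v) (rdim V v)"
      "p' v * (j' v * q v) = 0\<^sub>m (rdim A v) (rdim V v)" "q' v * (j' v * q v) = q v"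
      by (simp_all add: e mat_simps flip: mat_assoc)
    then show ?thesis
      by (simp add: mat_simps e(5))
  qed
  from this[OF _ assms(5,6)] this[OF _ assms(6,5)] h
  show ?thesis unfolding rep_iso_def by blast
qed

lemma biproduct_iso_rep_plus:
  assumes "is_rep G V" "is_rep G A" "is_rep G B" "biproduct G V A B i p j q"
  shows "rep_iso G V (rep_plus A B)"
  using biproduct_iso[OF assms(1) is_rep_plus[OF assms(2,3)] assms(2-4) rep_plus_biproduct[OF assms(2,3)]] .

lemma biproduct_transport:
  assumes "is_rep G V" "is_rep G W" "is_rep G A" "is_rep G B" "rep_iso G V W" "biproduct G W A B i p j q"
  shows "\<exists>i p j q. biproduct G V A B i p j q"
proof -
  obtain f g where fg: "is_hom G V W f" "is_hom G W V g"
    "\<And>v. v \<in> verts G \<Longrightarrow> g v * f v = 1\<^sub>m (rdim V v) \<and> f v * g v = 1\<^sub>m (rdim W v)"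
    using assms(5) unfolding rep_iso_def by blast
  note b = assms(6)[unfolded biproduct_def]
  have h: "is_hom G A V (\<lambda>v. g v * i v)" "is_hom G V A (\<lambda>v. p v * f v)"
     "is_hom G B V (\<lambda>v. g v * j v)" "is_hom G V B (\<lambda>v. q v * f v)"
    by (intro is_hom_comp[OF assms(3,2,1)] is_hom_comp[OF assms(1,2,3)] is_hom_comp[OF assms(4,2,1)]
        is_hom_comp[OF assms(1,2,4)] biproduct_homs[OF assms(6)] fg)+
  have "biproduct G V A B (\<lambda>v. g v * i v) (\<lambda>v. p v * f v) (\<lambda>v. g v * j v) (\<lambda>v. q v * f v)"
    unfolding biproduct_def
  proof (intro conjI ballI h)
    fix v assume v: "v \<in> verts G"
    have homs: "is_hom G A W i" "is_hom G W A p" "is_hom G B W j" "is_hom G W B q"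
      using b by auto
    note [simp] = homs[THEN is_hom_dims(2), OF v] homs[THEN is_hom_dims(3), OF v]
      is_hom_dims[OF fg(1) v] is_hom_dims[OF fg(2) v]
    have e: "p v * i v = 1\<^sub>m (rdim A v)" "q v * j v = 1\<^sub>m (rdim B v)"
      "p v * j v = 0\<^sub>m (rdim A v) (rdim B v)" "q v * i v = 0\<^sub>m (rdim B v) (rdim A v)"
      "i v * p v + j v * q v = 1\<^sub>m (rdim W v)" "f v * g v = 1\<^sub>m (rdim W v)" "g v * f v = 1\<^sub>m (rdim V v)"
      using b v fg(3)[OF v] by auto
    have fg': "f v * (g v * X) = X" if "dim_row X = rdim W v" for X
      using that by (simp add: e mat_simps flip: mat_assoc)
    show "p v * f v * (g v * i v) = 1\<^sub>m (rdim A v)" "q v * f v * (g v * j v) = 1\<^sub>m (rdim B v)"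
      "p v * f v * (g v * j v) = 0\<^sub>m (rdim A v) (rdim B v)" "q v * f v * (g v * i v) = 0\<^sub>m (rdim B v) (rdim A v)"
      by (simp_all add: mat_assoc fg' e)
    have "g v * i v * (p v * f v) + g v * j v * (q v * f v) = g v * ((i v * p v + j v * q v) * f v)"
      by (simp add: mat_assoc mat_distrib_left mat_distrib_right)
    then show "g v * i v * (p v * f v) + g v * j v * (q v * f v) = 1\<^sub>m (rdim V v)"
      by (simp add: e mat_one_left)
  qed
  then show ?thesis by blast
qed

lemma rep_iso_plus_iff:
  assumes "is_rep G V" "is_rep G A" "is_rep G B"
  shows "rep_iso G V (rep_plus A B) \<longleftrightarrow> (\<exists>i p j q. biproduct G V A B i p j q)"
  using biproduct_iso_rep_plus[OF assms]
    biproduct_transport[OF assms(1) is_rep_plus[OF assms(2,3)] assms(2,3) _ rep_plus_biproduct[OF assms(2,3)]]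
  by blast

lemma rep_iso_plus_cong:
  assumes "is_rep G A" "is_rep G B" "is_rep G A'" "is_rep G B'" "rep_iso G A A'" "rep_iso G B B'"
  shows "rep_iso G (rep_plus A B) (rep_plus A' B')"
proof -
  obtain f g where fg: "is_hom G A A' f" "is_hom G A' A g"
    "\<And>v. v \<in> verts G \<Longrightarrow> g v * f v = 1\<^sub>m (rdim A v) \<and> f v * g v = 1\<^sub>m (rdim A' v)"
    using assms(5) unfolding rep_iso_def by blast
  obtain f' g' where fg': "is_hom G B B' f'" "is_hom G B' B g'"
    "\<And>v. v \<in> verts G \<Longrightarrow> g' v * f' v = 1\<^sub>m (rdim B v) \<and> f' v * g' v = 1\<^sub>m (rdim B' v)"
    using assms(6) unfolding rep_iso_def by blast
  obtain i p j q where b: "biproduct G (rep_plus A B) A B i p j q"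
    using rep_plus_biproduct[OF assms(1,2)] by blast
  note b' = b[unfolded biproduct_def]
  have h: "is_hom G A' (rep_plus A B) (\<lambda>v. i v * g v)" "is_hom G (rep_plus A B) A' (\<lambda>v. f v * p v)"
     "is_hom G B' (rep_plus A B) (\<lambda>v. j v * g' v)" "is_hom G (rep_plus A B) B' (\<lambda>v. f' v * q v)"
    by (intro is_hom_comp[OF assms(3,1) is_rep_plus[OF assms(1,2)]] is_hom_comp[OF is_rep_plus[OF assms(1,2)] assms(1,3)]
        is_hom_comp[OF assms(4,2) is_rep_plus[OF assms(1,2)]] is_hom_comp[OF is_rep_plus[OF assms(1,2)] assms(2,4)]
        biproduct_homs[OF b] fg fg')+
  have "biproduct G (rep_plus A B) A' B' (\<lambda>v. i v * g v) (\<lambda>v. f v * p v) (\<lambda>v. j v * g' v) (\<lambda>v. f' v * q v)"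
    unfolding biproduct_def
  proof (intro conjI ballI h)
    fix v assume v: "v \<in> verts G"
    have homs: "is_hom G A (rep_plus A B) i" "is_hom G (rep_plus A B) A p"
      "is_hom G B (rep_plus A B) j" "is_hom G (rep_plus A B) B q"
      using b' by auto
    note [simp] = homs[THEN is_hom_dims(2), OF v] homs[THEN is_hom_dims(3), OF v]
      is_hom_dims[OF fg(1) v] is_hom_dims[OF fg(2) v] is_hom_dims[OF fg'(1) v] is_hom_dims[OF fg'(2) v]
    have e: "p v * i v = 1\<^sub>m (rdim A v)" "q v * j v = 1\<^sub>m (rdim B v)"
      "p v * j v = 0\<^sub>m (rdim A v) (rdim B v)" "q v * i v = 0\<^sub>m (rdim B v) (rdim A v)"
      "i v * p v + j v * q v = 1\<^sub>m (rdim (rep_plus A B) v)"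
      "f v * g v = 1\<^sub>m (rdim A' v)" "g v * f v = 1\<^sub>m (rdim A v)"
      "f' v * g' v = 1\<^sub>m (rdim B' v)" "g' v * f' v = 1\<^sub>m (rdim B v)"
      using b' v fg(3)[OF v] fg'(3)[OF v] by auto
    have r: "p v * (i v * X) = X" "q v * (i v * X) = 0\<^sub>m (rdim B v) (dim_col X)"
      "g v * (f v * X) = X" if "dim_row X = rdim A v" for X
      using that by (simp_all add: e mat_simps flip: mat_assoc)
    have r': "q v * (j v * X) = X" "p v * (j v * X) = 0\<^sub>m (rdim A v) (dim_col X)"
      "g' v * (f' v * X) = X" if "dim_row X = rdim B v" for X
      using that by (simp_all add: e mat_simps flip: mat_assoc)
    show "f v * p v * (i v * g v) = 1\<^sub>m (rdim A' v)" "f' v * q v * (j v * g' v) = 1\<^sub>m (rdim B' v)"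
      "f v * p v * (j v * g' v) = 0\<^sub>m (rdim A' v) (rdim B' v)"
      "f' v * q v * (i v * g v) = 0\<^sub>m (rdim B' v) (rdim A' v)"
      by (simp_all add: mat_simps r r' e)
    show "i v * g v * (f v * p v) + j v * g' v * (f' v * q v) = 1\<^sub>m (rdim (rep_plus A B) v)"
      using e(5) by (simp add: mat_assoc r r')
  qed
  then show ?thesis
    by (rule biproduct_iso_rep_plus[OF is_rep_plus[OF assms(1,2)] assms(3,4)])
qed

lemma retract_refl: "is_rep G V \<Longrightarrow> retract G V V"
  unfolding retract_def
  by (intro exI[of _ "\<lambda>v. 1\<^sub>m (rdim V v)"]) (auto simp: is_hom_id)

lemma retract_trans:
  assumes "is_rep G U" "is_rep G V" "is_rep G W" "retract G U V" "retract G V W"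
  shows "retract G U W"
proof -
  obtain f f' where f: "is_hom G U V f" "is_hom G V U f'"
      "\<And>v. v \<in> verts G \<Longrightarrow> f' v * f v = 1\<^sub>m (rdim U v)"
    using assms unfolding retract_def by auto
  obtain g g' where g: "is_hom G V W g" "is_hom G W V g'"
      "\<And>v. v \<in> verts G \<Longrightarrow> g' v * g v = 1\<^sub>m (rdim V v)"
    using assms unfolding retract_def by auto
  have "(f' v * g' v) * (g v * f v) = 1\<^sub>m (rdim U v)"
    if v: "v \<in> verts G" for v
  proof -
    note [simp] = is_hom_dims[OF f(1) v] is_hom_dims[OF f(2) v] is_hom_dims[OF g(1) v] is_hom_dims[OF g(2) v]
    have "(f' v * g' v) * (g v * f v) = f' v * ((g' v * g v) * f v)"
      by (simp_all add: mat_assoc del: f g)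
    then show ?thesis using f(3)[OF v] g(3)[OF v] by (simp add: mat_simps)
  qed
  then show ?thesis
    unfolding retract_def using is_hom_comp[OF assms(1-3) f(1) g(1)] is_hom_comp[OF assms(3,2,1) g(2) f(2)]
    by blast
qed

lemma rep_iso_retract: "rep_iso G V W \<Longrightarrow> retract G V W"
  unfolding rep_iso_def retract_def by blast

lemma retract_plus_left: "is_rep G V \<Longrightarrow> is_rep G W \<Longrightarrow> retract G V (rep_plus V W)"
  and retract_plus_right: "is_rep G V \<Longrightarrow> is_rep G W \<Longrightarrow> retract G W (rep_plus V W)"
  using rep_plus_biproduct[of V W] unfolding biproduct_def retract_def by blast+

lemma double_retract_trans:
  assumes "is_rep G U" "is_rep G V" "is_rep G W" "double_retract G U V" "retract G V W"
  shows "double_retract G U W"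
proof -
  obtain f f' h h' where f: "is_hom G U V f" "is_hom G V U h" "is_hom G U V f'" "is_hom G V U h'"
      "\<And>v. v \<in> verts G \<Longrightarrow> h v * f v = 1\<^sub>m (rdim U v) \<and> h' v * f' v = 1\<^sub>m (rdim U v) \<and>
        h v * f' v = 0\<^sub>m (rdim U v) (rdim U v) \<and> h' v * f v = 0\<^sub>m (rdim U v) (rdim U v)"
    using assms(4) unfolding double_retract_def by auto
  obtain g g' where g: "is_hom G V W g" "is_hom G W V g'"
      "\<And>v. v \<in> verts G \<Longrightarrow> g' v * g v = 1\<^sub>m (rdim V v)"
    using assms(5) unfolding retract_def by auto
  have c: "(a * g' v) * (g v * b) = a * b"
    if v: "v \<in> verts G" and "dim_col a = rdim V v" "dim_row b = rdim V v" for v a b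
  proof -
    note [simp] = is_hom_dims[OF g(1) v] is_hom_dims[OF g(2) v] that
    have "(a * g' v) * (g v * b) = a * ((g' v * g v) * b)"
      by (simp add: mat_assoc)
    then show ?thesis using g(3)[OF v] by (simp add: mat_simps)
  qed
  show ?thesis
    unfolding double_retract_def
  proof (intro exI conjI ballI)
    show "is_hom G U W (\<lambda>v. g v * f v)" "is_hom G W U (\<lambda>v. h v * g' v)"
      "is_hom G U W (\<lambda>v. g v * f' v)" "is_hom G W U (\<lambda>v. h' v * g' v)"
      by (intro is_hom_comp[OF assms(1-3)] is_hom_comp[OF assms(3,2,1)] f g)+
  qed (use f(5) in \<open>simp_all add: c is_hom_dims[OF f(1)] is_hom_dims[OF f(2)] is_hom_dims[OF f(3)] is_hom_dims[OF f(4)]\<close>)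
qed

text \<open>One copy of \<open>A\<close> sits in each summand; the two copies are orthogonal because
  a projection to one summand kills the inclusion of the other.\<close>

lemma double_retract_plus:
  assumes "is_rep G A" "is_rep G V" "is_rep G W" "retract G A V" "retract G A W"
  shows "double_retract G A (rep_plus V W)"
proof -
  obtain i p j q where b0: "biproduct G (rep_plus V W) V W i p j q"
    using rep_plus_biproduct[OF assms(2,3)] by blast
  note b = this[unfolded biproduct_def]
  obtain f g where fg: "is_hom G A V f" "is_hom G V A g"
      "\<And>v. v \<in> verts G \<Longrightarrow> g v * f v = 1\<^sub>m (rdim A v)"
    using assms(4) unfolding retract_def by auto
  obtain f' g' where fg': "is_hom G A W f'" "is_hom G W A g'"
      "\<And>v. v \<in> verts G \<Longrightarrow> g' v * f' v = 1\<^sub>m (rdim A v)"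
    using assms(5) unfolding retract_def by auto
  show ?thesis
    unfolding double_retract_def
  proof (intro exI conjI ballI)
    show "is_hom G A (rep_plus V W) (\<lambda>v. i v * f v)" "is_hom G (rep_plus V W) A (\<lambda>v. g v * p v)"
      "is_hom G A (rep_plus V W) (\<lambda>v. j v * f' v)" "is_hom G (rep_plus V W) A (\<lambda>v. g' v * q v)"
      by (intro is_hom_comp[OF assms(1,2) is_rep_plus[OF assms(2,3)]] is_hom_comp[OF assms(1,3) is_rep_plus[OF assms(2,3)]]
        is_hom_comp[OF is_rep_plus[OF assms(2,3)] assms(2,1)] is_hom_comp[OF is_rep_plus[OF assms(2,3)] assms(3,1)]
        biproduct_homs[OF b0] fg fg')+
    fix v assume v: "v \<in> verts G"
    have homs: "is_hom G V (rep_plus V W) i" "is_hom G (rep_plus V W) V p"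
      "is_hom G W (rep_plus V W) j" "is_hom G (rep_plus V W) W q"
      using b by auto
    note [simp] = homs[THEN is_hom_dims(2), OF v] homs[THEN is_hom_dims(3), OF v]
      is_hom_dims[OF fg(1) v] is_hom_dims[OF fg(2) v] is_hom_dims[OF fg'(1) v] is_hom_dims[OF fg'(2) v]
    have e: "p v * i v = 1\<^sub>m (rdim V v)" "q v * j v = 1\<^sub>m (rdim W v)"
      "p v * j v = 0\<^sub>m (rdim V v) (rdim W v)" "q v * i v = 0\<^sub>m (rdim W v) (rdim V v)"
      using b v by auto
    have r: "p v * (i v * X) = X" "q v * (i v * X) = 0\<^sub>m (rdim W v) (dim_col X)"
      if "dim_row X = rdim V v" for X
      using that by (simp_all add: e mat_simps flip: mat_assoc)
    have r': "q v * (j v * X) = X" "p v * (j v * X) = 0\<^sub>m (rdim V v) (dim_col X)"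
      if "dim_row X = rdim W v" for X
      using that by (simp_all add: e mat_simps flip: mat_assoc)
    show "g v * p v * (i v * f v) = 1\<^sub>m (rdim A v)" "g' v * q v * (j v * f' v) = 1\<^sub>m (rdim A v)"
      "g v * p v * (j v * f' v) = 0\<^sub>m (rdim A v) (rdim A v)" "g' v * q v * (i v * f v) = 0\<^sub>m (rdim A v) (rdim A v)"
      using fg(3) fg'(3) v by (simp_all add: mat_simps r r')
  qed
qed

end

section \<open>Separating functionals and complements\<close>

lemma separating_functional:
  fixes U :: "(nat \<Rightarrow> 'k::field) set"
  assumes "\<And>u i. u \<in> U \<Longrightarrow> n \<le> i \<Longrightarrow> u i = 0" "\<And>i. n \<le> i \<Longrightarrow> x i = 0"
    and "(\<lambda>_. 0) \<in> U" "\<And>u w. u \<in> U \<Longrightarrow> w \<in> U \<Longrightarrow> (\<lambda>i. u i + w i) \<in> U"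
    and "\<And>c u. u \<in> U \<Longrightarrow> (\<lambda>i. c * u i) \<in> U" "x \<notin> U"
  shows "\<exists>\<phi>. (\<Sum>i<n. \<phi> i * x i) = 1 \<and> (\<forall>u\<in>U. (\<Sum>i<n. \<phi> i * u i) = 0)"
  using assms
proof (induction n arbitrary: U x)
  case 0
  then have "x = (\<lambda>_. 0)" by auto
  then show ?case using 0 by simp
next
  case (Suc n)
  show ?case
  proof (cases "\<forall>u\<in>U. u n = 0")
    case True
    show ?thesis
    proof (cases "x n = 0")
      case xn: True
      have "\<exists>\<phi>. (\<Sum>i<n. \<phi> i * x i) = 1 \<and> (\<forall>u\<in>U. (\<Sum>i<n. \<phi> i * u i) = 0)"
      proof (rule Suc.IH)
        show "u i = 0" if "u \<in> U" "n \<le> i" for u i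
          using that True Suc.prems(1)[of u i] by (cases "i = n") auto
        show "x i = 0" if "n \<le> i" for i
          using that xn Suc.prems(2)[of i] by (cases "i = n") auto
      qed (use Suc.prems in auto)
      then obtain \<phi> where "(\<Sum>i<n. \<phi> i * x i) = 1 \<and> (\<forall>u\<in>U. (\<Sum>i<n. \<phi> i * u i) = 0)" by blast
      then show ?thesis using True xn by (intro exI[of _ \<phi>]) auto
    next
      case False
      have "(\<Sum>i<n. (if i = n then c else 0) * y i) = 0" for c and y :: "nat \<Rightarrow> 'k"
        by (rule sum.neutral) auto
      then show ?thesis using True False by (intro exI[of _ "\<lambda>i. if i = n then 1 / x n else 0"]) auto
    qed
  next
    case False
    then obtain u0 where u0: "u0 \<in> U" "u0 n \<noteq> 0" by auto
    define u where "u = (\<lambda>i. (1 / u0 n) * u0 i)"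
    have u: "u \<in> U" "u n = 1" using u0 Suc.prems(5)[of u0 "1 / u0 n"] by (simp_all add: u_def)
    \<comment> \<open>Subtracts the multiple of \<open>u\<close> that clears coordinate
      \<open>n\<close>; since \<open>u\<close> lies in \<open>U\<close>, this does not affect
      membership in \<open>U\<close>.\<close>
    define red where "red = (\<lambda>y i. y i + (- y n) * u i)"
    have red: "red y \<in> U \<longleftrightarrow> y \<in> U" for y
    proof
      assume "red y \<in> U"
      then have "(\<lambda>i. red y i + y n * u i) \<in> U" using Suc.prems(4,5) u by simp
      moreover have "(\<lambda>i. red y i + y n * u i) = y" by (auto simp: red_def)
      ultimately show "y \<in> U" by simp
    next
      assume "y \<in> U"
      have "(\<lambda>i. (- y n) * u i) \<in> U" using Suc.prems(5) u by blast
      then show "red y \<in> U" using \<open>y \<in> U\<close> Suc.prems(4) unfolding red_def by blast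
    qed
    have "\<exists>\<phi>. (\<Sum>i<n. \<phi> i * red x i) = 1 \<and> (\<forall>u\<in>{w \<in> U. w n = 0}. (\<Sum>i<n. \<phi> i * u i) = 0)"
    proof (rule Suc.IH)
      show "w i = 0" if "w \<in> {w \<in> U. w n = 0}" "n \<le> i" for w i
        using that Suc.prems(1)[of w i] by (cases "i = n") auto
      show "red x i = 0" if "n \<le> i" for i
        using that Suc.prems(2)[of i] Suc.prems(1)[of u i] u by (cases "i = n") (auto simp: red_def)
      show "red x \<notin> {w \<in> U. w n = 0}" using red Suc.prems(6) by auto
    qed (use Suc.prems in auto)
    then obtain \<phi> where \<phi>: "(\<Sum>i<n. \<phi> i * red x i) = 1"
      "\<And>w. w \<in> U \<Longrightarrow> w n = 0 \<Longrightarrow> (\<Sum>i<n. \<phi> i * w i) = 0" by auto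
    \<comment> \<open>The last value makes the functional vanish at \<open>u\<close>, so it depends
      only on the reduced vector.\<close>
    define \<psi> where "\<psi> = (\<lambda>i. if i = n then - (\<Sum>i<n. \<phi> i * u i) else \<phi> i)"
    have eq: "(\<Sum>i<Suc n. \<psi> i * y i) = (\<Sum>i<n. \<phi> i * red y i)" for y
    proof -
      have "(\<Sum>i<n. \<psi> i * y i) = (\<Sum>i<n. \<phi> i * y i)"
        by (rule sum.cong) (auto simp: \<psi>_def)
      moreover have "(\<Sum>i<n. \<phi> i * red y i) = (\<Sum>i<n. \<phi> i * y i) - y n * (\<Sum>i<n. \<phi> i * u i)"
        by (simp add: red_def algebra_simps sum.distrib sum_subtractf sum_distrib_left)
      ultimately show ?thesis by (simp add: \<psi>_def)
    qed
    show ?thesis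
    proof (intro exI[of _ \<psi>] conjI ballI)
      show "(\<Sum>i<Suc n. \<psi> i * x i) = 1" using \<phi>(1) eq by simp
      show "(\<Sum>i<Suc n. \<psi> i * w i) = 0" if "w \<in> U" for w
        unfolding eq using that u red[of w] by (intro \<phi>(2)) (auto simp: red_def)
    qed
  qed
qed

text \<open>Vectors are matrices with one column, so that maps, vectors and functionals (matrices
  with one row) all multiply by the same rules.\<close>

definition col_subspace :: "nat \<Rightarrow> 'k::field mat set \<Rightarrow> bool" where
  "col_subspace n U \<longleftrightarrow> U \<subseteq> carrier_mat n 1 \<and> 0\<^sub>m n 1 \<in> U \<and>
     (\<forall>u\<in>U. \<forall>w\<in>U. u + w \<in> U) \<and> (\<forall>c. \<forall>u\<in>U. c \<cdot>\<^sub>m u \<in> U)"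

lemma col_subspace_separate:
  fixes x :: "'k::field mat"
  assumes U: "col_subspace n U" and x: "x \<in> carrier_mat n 1" "x \<notin> U"
  shows "\<exists>\<phi>\<in>carrier_mat 1 n. \<phi> * x = 1\<^sub>m 1 \<and> (\<forall>u\<in>U. \<phi> * u = 0\<^sub>m 1 1)"
proof -
  define h where "h = (\<lambda>(y :: 'k mat) i. if i < n then y $$ (i, 0) else 0)"
  have inj: "y = z" if "y \<in> carrier_mat n 1" "z \<in> carrier_mat n 1" "h y = h z" for y z
  proof (rule eq_matI)
    fix i j assume "i < dim_row z" "j < dim_col z"
    moreover have "h y i = h z i" using that(3) by simp
    ultimately show "y $$ (i,j) = z $$ (i,j)" using that(1,2) by (auto simp: h_def)
  qed (use that in auto)
  have "\<exists>\<phi>. (\<Sum>i<n. \<phi> i * h x i) = 1 \<and> (\<forall>u\<in>h ` U. (\<Sum>i<n. \<phi> i * u i) = 0)"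
  proof (rule separating_functional)
    show "(\<lambda>_. 0) \<in> h ` U"
      using U by (intro image_eqI[of _ _ "0\<^sub>m n 1"]) (auto simp: h_def col_subspace_def)
    show "(\<lambda>i. u i + w i) \<in> h ` U" if uw: "u \<in> h ` U" "w \<in> h ` U" for u w
    proof -
      obtain y z where yz: "y \<in> U" "z \<in> U" "u = h y" "w = h z" using uw by auto
      moreover have "y \<in> carrier_mat n 1" "z \<in> carrier_mat n 1" "y + z \<in> U"
        using U yz(1,2) unfolding col_subspace_def by auto
      ultimately show ?thesis
        by (intro image_eqI[of _ _ "y + z"]) (auto simp: h_def fun_eq_iff)
    qed
    show "(\<lambda>i. c * u i) \<in> h ` U" if u: "u \<in> h ` U" for u c
    proof -
      obtain y where y: "y \<in> U" "u = h y" using u by auto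
      moreover have "y \<in> carrier_mat n 1" "c \<cdot>\<^sub>m y \<in> U"
        using U y(1) unfolding col_subspace_def by auto
      ultimately show ?thesis
        by (intro image_eqI[of _ _ "c \<cdot>\<^sub>m y"]) (auto simp: h_def fun_eq_iff)
    qed
    show "h x \<notin> h ` U" using inj U x by (auto simp: col_subspace_def)
  qed (auto simp: h_def)
  then obtain \<phi> where \<phi>: "(\<Sum>i<n. \<phi> i * h x i) = 1" "\<And>u. u \<in> U \<Longrightarrow> (\<Sum>i<n. \<phi> i * h u i) = 0"
    by auto
  define \<Phi> where "\<Phi> = mat 1 n (\<lambda>(i,j). \<phi> j)"
  have \<Phi>: "\<Phi> * y = (\<Sum>i<n. \<phi> i * h y i) \<cdot>\<^sub>m 1\<^sub>m 1" if "y \<in> carrier_mat n 1" for y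
    using that by (auto intro!: eq_matI simp: \<Phi>_def scalar_prod_def h_def lessThan_atLeast0)
  show ?thesis
  proof (intro bexI[of _ \<Phi>] conjI ballI)
    show "\<Phi> * u = 0\<^sub>m 1 1" if "u \<in> U" for u
      using that U by (subst \<Phi>) (auto simp: \<phi>(2) col_subspace_def intro!: eq_matI)
    show "\<Phi> * x = 1\<^sub>m 1"
      using \<Phi>[OF x(1)] \<phi>(1) by (auto intro!: eq_matI)
  qed (auto simp: \<Phi>_def)
qed

text \<open>The functionals \<open>\<psi> * \<alpha>\<close> with \<open>\<psi>\<close> vanishing on
  \<open>K\<close> form a subspace of the dual space. If it missed \<open>\<phi>\<close>, separation
  in the dual would give a vector \<open>y\<close> with \<open>\<phi> * y = 1\<close> that all of
  them kill; separation in the target then puts \<open>\<alpha> * y\<close> into \<open>K\<close>,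
  where \<open>\<phi>\<close> has to vanish.\<close>

lemma functional_factor:
  fixes \<alpha> :: "'k::field mat"
  assumes \<alpha>: "\<alpha> \<in> carrier_mat p n" and K: "col_subspace p K" and \<phi>: "\<phi> \<in> carrier_mat 1 n"
    and van: "\<And>y. y \<in> carrier_mat n 1 \<Longrightarrow> \<alpha> * y \<in> K \<Longrightarrow> \<phi> * y = 0\<^sub>m 1 1"
  shows "\<exists>\<psi>\<in>carrier_mat 1 p. \<psi> * \<alpha> = \<phi> \<and> (\<forall>u\<in>K. \<psi> * u = 0\<^sub>m 1 1)"
proof -
  have Kc: "u \<in> carrier_mat p 1" if "u \<in> K" for u using K that by (auto simp: col_subspace_def)
  have Kd: "dim_row u = p" "dim_col u = 1" if "u \<in> K" for u using Kc[OF that] by auto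
  define P where "P = {\<psi> \<in> carrier_mat 1 p. \<forall>u\<in>K. \<psi> * u = 0\<^sub>m 1 1}"
  define W where "W = (\<lambda>\<psi>. transpose_mat (\<psi> * \<alpha>)) ` P"
  have [simp]: "dim_row \<alpha> = p" "dim_col \<alpha> = n" using \<alpha> by auto
  have P0: "0\<^sub>m 1 p \<in> P" by (auto simp: P_def mat_zero_left Kd)
  have P1: "\<psi> + \<psi>' \<in> P" if "\<psi> \<in> P" "\<psi>' \<in> P" for \<psi> \<psi>'
    using that by (auto simp: P_def mat_distrib_right Kd)
  have P2: "c \<cdot>\<^sub>m \<psi> \<in> P" if "\<psi> \<in> P" for \<psi> c
    using that by (auto simp: P_def mat_smult_left Kd)
  have Pd: "dim_row \<psi> = 1" "dim_col \<psi> = p" if "\<psi> \<in> P" for \<psi>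
    using that by (auto simp: P_def)
  have W: "col_subspace n W"
    unfolding col_subspace_def
  proof (intro conjI allI ballI)
    show "W \<subseteq> carrier_mat n 1" using Pd by (auto simp: W_def intro!: carrier_matI)
    show "0\<^sub>m n 1 \<in> W" unfolding W_def
      by (rule image_eqI[OF _ P0]) (auto simp: mat_zero_left)
    show "u + w \<in> W" if uw: "u \<in> W" "w \<in> W" for u w
    proof -
      obtain y z where "y \<in> P" "z \<in> P" "u = transpose_mat (y * \<alpha>)" "w = transpose_mat (z * \<alpha>)"
        using uw unfolding W_def by blast
      then show ?thesis unfolding W_def
        by (intro image_eqI[OF _ P1[of y z]]) (auto simp: mat_distrib_right Pd intro!: eq_matI)
    qed
    show "c \<cdot>\<^sub>m u \<in> W" if uw: "u \<in> W" for u c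
    proof -
      obtain y where "y \<in> P" "u = transpose_mat (y * \<alpha>)" using uw unfolding W_def by blast
      then show ?thesis unfolding W_def
        by (intro image_eqI[OF _ P2[of y c]]) (auto simp: mat_smult_left Pd intro!: eq_matI)
    qed
  qed
  have "transpose_mat \<phi> \<in> W"
  proof (rule ccontr)
    assume "transpose_mat \<phi> \<notin> W"
    then obtain \<xi> where \<xi>: "\<xi> \<in> carrier_mat 1 n" "\<xi> * transpose_mat \<phi> = 1\<^sub>m 1" "\<And>w. w \<in> W \<Longrightarrow> \<xi> * w = 0\<^sub>m 1 1"
      using col_subspace_separate[OF W, of "transpose_mat \<phi>"] \<phi> by auto
    \<comment> \<open>A functional on the dual space is evaluation at a vector; in coordinates this
      is a transposition.\<close>
    define y where "y = transpose_mat \<xi>"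
    have y: "y \<in> carrier_mat n 1" using \<xi> by (simp add: y_def)
    have tr: "\<xi> * transpose_mat \<psi> = transpose_mat (\<psi> * y)" if "\<psi> \<in> carrier_mat 1 n" for \<psi>
      using transpose_mult[OF that y] by (simp add: y_def)
    have "transpose_mat (\<phi> * y) = 1\<^sub>m 1" using tr[OF \<phi>] \<xi>(2) by simp
    then have \<phi>y: "\<phi> * y = 1\<^sub>m 1" by (metis transpose_transpose transpose_one)
    have "\<alpha> * y \<in> K"
    proof (rule ccontr)
      assume "\<alpha> * y \<notin> K"
      then obtain \<psi> where \<psi>: "\<psi> \<in> carrier_mat 1 p" "\<psi> * (\<alpha> * y) = 1\<^sub>m 1" "\<forall>u\<in>K. \<psi> * u = 0\<^sub>m 1 1"
        using col_subspace_separate[OF K, of "\<alpha> * y"] y \<alpha> by auto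
      then have "transpose_mat (\<psi> * \<alpha>) \<in> W" by (auto simp: W_def P_def)
      then have "transpose_mat (\<psi> * \<alpha> * y) = 0\<^sub>m 1 1"
        using \<xi>(3) tr[of "\<psi> * \<alpha>"] \<psi>(1) \<alpha> by auto
      then have "transpose_mat (1\<^sub>m 1 :: 'k mat) = 0\<^sub>m 1 1"
        using \<psi>(1,2) y by (simp add: mat_assoc)
      then show False by (auto dest!: arg_cong[of _ _ "\<lambda>M. M $$ (0,0)"])
    qed
    then have "\<phi> * y = 0\<^sub>m 1 1" using van y by blast
    then show False using \<phi>y by (auto dest!: arg_cong[of _ _ "\<lambda>M. M $$ (0,0)"])
  qed
  then obtain \<psi> where \<psi>: "\<psi> \<in> P" "transpose_mat \<phi> = transpose_mat (\<psi> * \<alpha>)" by (auto simp: W_def)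
  then have "\<phi> = \<psi> * \<alpha>" by (metis transpose_transpose)
  then show ?thesis using \<psi>(1) by (auto simp: P_def)
qed

text \<open>Differences are written with the scalar -1 throughout, so that the rules for sums and
  scalar multiples suffice.\<close>

lemma mat_add_neg: "A + (- 1) \<cdot>\<^sub>m A = 0\<^sub>m (dim_row A) (dim_col (A :: 'k::field mat))"
  by (auto intro!: eq_matI)

text \<open>For \<open>d = 1\<close> the kernel of \<open>g\<close> has an explicit basis: take a
  coordinate \<open>i\<close> at which \<open>g\<close> is nonzero and move the other unit vectors
  into the kernel along the \<open>i\<close>-th one.\<close>

lemma complement_exists:
  fixes f g :: "'k::field mat"
  assumes f: "f \<in> carrier_mat n d" and g: "g \<in> carrier_mat d n" and gf: "g * f = 1\<^sub>m d" and d: "d \<le> 1"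
  shows "\<exists>j q. j \<in> carrier_mat n (n - d) \<and> q \<in> carrier_mat (n - d) n \<and> q * j = 1\<^sub>m (n - d) \<and>
    g * j = 0\<^sub>m d (n - d) \<and> q * f = 0\<^sub>m (n - d) d \<and> f * g + j * q = 1\<^sub>m n"
proof (cases "d = 0")
  case True
  have "f * g = 0\<^sub>m n n" using f g True by (auto intro!: eq_matI simp: scalar_prod_def)
  then show ?thesis using f g True
    by (intro exI[of _ "1\<^sub>m n"]) (auto simp: mat_simps intro!: eq_matI)
next
  case False
  with d have d1: "d = 1" by simp
  have n0: "n \<noteq> 0"
  proof
    assume "n = 0"
    with f g d1 have "(g * f) $$ (0,0) = 0" by (auto simp: scalar_prod_def)
    then show False using gf d1 by simp
  qed
  then obtain N where n: "n = Suc N" by (cases n) auto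
  have [simp]: "dim_row f = n" "dim_col f = 1" "dim_row g = 1" "dim_col g = n" using f g d1 by auto
  obtain i where i: "i < n" "g $$ (0, i) \<noteq> 0"
  proof (rule ccontr)
    assume "\<not> thesis"
    then have "\<And>i. i < n \<Longrightarrow> g $$ (0, i) = 0" using that by blast
    then have "(g * f) $$ (0,0) = 0" by (auto simp: scalar_prod_def)
    then show False using gf d1 by simp
  qed
  \<comment> \<open>Enumerates the coordinates other than \<open>i\<close>; \<open>E\<close> deletes
    coordinate \<open>i\<close> and \<open>E'\<close> inserts a zero there.\<close>
  define \<iota> where "\<iota> = (\<lambda>c. if c < i then c else Suc c)"
  have \<iota>: "\<iota> c < n \<longleftrightarrow> c < N" "\<iota> c = \<iota> c' \<longleftrightarrow> c = c'" "\<iota> c \<noteq> i" for c c'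
    using i n by (auto simp: \<iota>_def)
  define E where "E = (mat N n (\<lambda>(c,r). if r = \<iota> c then 1 else 0) :: 'k mat)"
  define E' where "E' = (mat n N (\<lambda>(r,c). if r = \<iota> c then 1 else 0) :: 'k mat)"
  define e where "e = (mat n 1 (\<lambda>(r,c). if r = i then 1 else 0) :: 'k mat)"
  \<comment> \<open>The correction along \<open>e\<close> is scaled so that \<open>g\<close>
    vanishes on each column.\<close>
  define j where "j = E' + (- 1) \<cdot>\<^sub>m ((1 / g $$ (0,i)) \<cdot>\<^sub>m (e * (g * E')))"
  have [simp]: "dim_row E = N" "dim_col E = n" "dim_row E' = n" "dim_col E' = N" "dim_row e = n" "dim_col e = 1"
    by (simp_all add: E_def E'_def e_def)
  have EE: "E * E' = 1\<^sub>m N"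
    using \<iota> by (auto intro!: eq_matI simp: E_def E'_def scalar_prod_def sum_delta_one)
  have Ee: "E * e = 0\<^sub>m N 1"
    using \<iota> by (auto intro!: eq_matI simp: E_def e_def scalar_prod_def sum_delta_one)
  have ge: "g * e = (g $$ (0,i)) \<cdot>\<^sub>m 1\<^sub>m 1"
    using i by (auto intro!: eq_matI simp: e_def scalar_prod_def if_distrib[of "\<lambda>x. _ * x"] sum.delta cong: if_cong)
  have gex: "g * (e * X) = (g $$ (0,i)) \<cdot>\<^sub>m X" if "dim_row X = 1" for X
    using that by (simp add: ge mat_smult_left mat_one_left flip: mat_assoc)
  have Eex: "E * (e * X) = 0\<^sub>m N (dim_col X)" if "dim_row X = 1" for X
    using that by (simp add: Ee mat_zero_left flip: mat_assoc)
  have [simp]: "dim_row j = n" "dim_col j = N" by (simp_all add: j_def)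
  have gj: "g * j = 0\<^sub>m 1 N"
  proof -
    have "g * j = g * E' + (- 1) \<cdot>\<^sub>m (g * E')"
      using i by (simp add: j_def mat_distrib_left mat_smult_right gex) (auto intro!: eq_matI)
    then show ?thesis by (simp add: mat_add_neg)
  qed
  have Ej: "E * j = 1\<^sub>m N"
    by (simp add: j_def mat_distrib_left mat_smult_right Eex EE)
  \<comment> \<open>The projection \<open>1 - f * g\<close> onto the kernel of \<open>g\<close>,
    followed by forgetting coordinate \<open>i\<close>.\<close>
  define q where "q = E + (- 1) \<cdot>\<^sub>m (E * (f * g))"
  have [simp]: "dim_row q = N" "dim_col q = n" by (simp_all add: q_def)
  have qj: "q * j = 1\<^sub>m N"
    by (simp add: q_def mat_simps gj Ej)
  have qf: "q * f = 0\<^sub>m N 1"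
    using gf d1 by (simp add: q_def mat_simps mat_add_neg)
  \<comment> \<open>The four relations proved so far combine to \<open>R * P = 1\<close>. Both
    matrices are square, so \<open>P * R = 1\<close>, which is the remaining relation.\<close>
  define P where "P = f * prj1 1 N + j * prj2 1 N"
  define R where "R = inc1 1 N * g + inc2 1 N * q"
  have [simp]: "dim_row P = n" "dim_col P = n" "dim_row R = n" "dim_col R = n"
    by (simp_all add: P_def R_def n)
  have red: "g * (f * X) = X" "q * (f * X) = 0\<^sub>m N (dim_col X)" if "dim_row X = 1" for X
    using that gf d1 qf by (simp_all add: mat_one_left mat_zero_left flip: mat_assoc)
  have red': "g * (j * X) = 0\<^sub>m 1 (dim_col X)" "q * (j * X) = X" if "dim_row X = N" for X
    using that gj qj by (simp_all add: mat_one_left mat_zero_left flip: mat_assoc)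
  have "R * P = inc1 1 N * prj1 1 N + inc2 1 N * prj2 1 N"
    by (simp add: R_def P_def mat_simps red red')
  also have "\<dots> = 1\<^sub>m n" by (simp add: inc_prj_sum n)
  finally have "P * R = 1\<^sub>m n"
    by (intro mat_mult_left_right_inverse[of R n P]) (auto intro: carrier_matI)
  moreover have "P * R = f * g + j * q"
  proof -
    have i1: "prj1 1 N * (inc1 1 N * X) = X" "prj2 1 N * (inc1 1 N * X) = 0\<^sub>m N (dim_col X)"
      if "dim_row X = 1" for X :: "'k mat"
      using that by (simp_all add: mat_one_left mat_zero_left flip: mat_assoc)
    have i2: "prj1 1 N * (inc2 1 N * X) = 0\<^sub>m 1 (dim_col X)" "prj2 1 N * (inc2 1 N * X) = X"
      if "dim_row X = N" for X :: "'k mat"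
      using that by (simp_all add: mat_one_left mat_zero_left flip: mat_assoc)
    show ?thesis by (simp add: R_def P_def mat_simps i1 i2 del: One_nat_def)
  qed
  ultimately show ?thesis using gj qj qf d1 n
    by (intro exI[of _ j] exI[of _ q]) (auto intro: carrier_matI)
qed

section \<open>Interval representations\<close>

context wf_digraph
begin

text \<open>The complements are chosen independently at the vertices. They fit together because
  \<open>g\<close> is a morphism, so the arrows preserve its kernel, and because \<open>f\<close> is
  one, so the arrows preserve its image.\<close>

lemma retract_complement:
  assumes A: "is_rep G A" and V: "is_rep G V" and f: "is_hom G A V f" and g: "is_hom G V A g"
    and gf: "\<And>v. v \<in> verts G \<Longrightarrow> g v * f v = 1\<^sub>m (rdim A v)"
    and thin: "\<And>v. v \<in> verts G \<Longrightarrow> rdim A v \<le> 1"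
  shows "\<exists>B j q. is_rep G B \<and> biproduct G V A B f g j q"
proof -
  have "\<forall>v\<in>verts G. \<exists>j q. j \<in> carrier_mat (rdim V v) (rdim V v - rdim A v) \<and>
    q \<in> carrier_mat (rdim V v - rdim A v) (rdim V v) \<and> q * j = 1\<^sub>m (rdim V v - rdim A v) \<and>
    g v * j = 0\<^sub>m (rdim A v) (rdim V v - rdim A v) \<and> q * f v = 0\<^sub>m (rdim V v - rdim A v) (rdim A v) \<and>
    f v * g v + j * q = 1\<^sub>m (rdim V v)"
    by (intro ballI complement_exists is_hom_dims(1)[OF f] is_hom_dims(1)[OF g] gf thin)
  then obtain j where "\<forall>v\<in>verts G. \<exists>q. j v \<in> carrier_mat (rdim V v) (rdim V v - rdim A v) \<and>
    q \<in> carrier_mat (rdim V v - rdim A v) (rdim V v) \<and> q * j v = 1\<^sub>m (rdim V v - rdim A v) \<and>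
    g v * j v = 0\<^sub>m (rdim A v) (rdim V v - rdim A v) \<and> q * f v = 0\<^sub>m (rdim V v - rdim A v) (rdim A v) \<and>
    f v * g v + j v * q = 1\<^sub>m (rdim V v)"
    by (rule bchoice[THEN exE])
  then obtain q where "\<forall>v\<in>verts G. j v \<in> carrier_mat (rdim V v) (rdim V v - rdim A v) \<and>
    q v \<in> carrier_mat (rdim V v - rdim A v) (rdim V v) \<and> q v * j v = 1\<^sub>m (rdim V v - rdim A v) \<and>
    g v * j v = 0\<^sub>m (rdim A v) (rdim V v - rdim A v) \<and> q v * f v = 0\<^sub>m (rdim V v - rdim A v) (rdim A v) \<and>
    f v * g v + j v * q v = 1\<^sub>m (rdim V v)"
    by (rule bchoice[THEN exE])
  then have jq: "j v \<in> carrier_mat (rdim V v) (rdim V v - rdim A v)"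
    "q v \<in> carrier_mat (rdim V v - rdim A v) (rdim V v)" "q v * j v = 1\<^sub>m (rdim V v - rdim A v)"
    "g v * j v = 0\<^sub>m (rdim A v) (rdim V v - rdim A v)" "q v * f v = 0\<^sub>m (rdim V v - rdim A v) (rdim A v)"
    "f v * g v + j v * q v = 1\<^sub>m (rdim V v)" if "v \<in> verts G" for v
    using that by blast+
  \<comment> \<open>The arrow maps of \<open>V\<close>, compressed to the complements.\<close>
  define B where "B = \<lparr> rdim = (\<lambda>v. rdim V v - rdim A v), rmap = (\<lambda>a. q (head G a) * (rmap V a * j (tail G a))) \<rparr>"
  have [simp]: "rdim B v = rdim V v - rdim A v" for v by (simp add: B_def)
  have rB: "rmap B a = q (head G a) * (rmap V a * j (tail G a))" for a by (simp add: B_def)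
  have jqd: "dim_row (j v) = rdim V v" "dim_col (j v) = rdim V v - rdim A v"
    "dim_row (q v) = rdim V v - rdim A v" "dim_col (q v) = rdim V v" if "v \<in> verts G" for v
    using jq(1,2)[OF that] by auto
  have B: "is_rep G B"
    unfolding is_rep_def by (auto simp: rB jqd intro!: carrier_matI)
  have jhom: "is_hom G B V j" and qhom: "is_hom G V B q"
  proof -
    have "j (head G a) * rmap B a = rmap V a * j (tail G a) \<and> q (head G a) * rmap V a = rmap B a * q (tail G a)"
      if a: "a \<in> arcs G" for a
    proof -
      define h t where "h = head G a" and "t = tail G a"
      have v: "h \<in> verts G" "t \<in> verts G" using a by (auto simp: h_def t_def)
      note [simp] = jqd[OF v(1)] jqd[OF v(2)] is_rep_dims[OF V a, folded h_def t_def]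
        is_rep_dims[OF A a, folded h_def t_def] is_hom_dims[OF f v(1)] is_hom_dims[OF g v(1)]
        is_hom_dims[OF f v(2)] is_hom_dims[OF g v(2)]
      let ?X = "rmap V a * j t"
      have gX: "g h * ?X = 0\<^sub>m (rdim A h) (rdim V t - rdim A t)"
      proof -
        have "g h * ?X = (g h * rmap V a) * j t" by (simp add: mat_assoc)
        also have "\<dots> = rmap A a * (g t * j t)"
          using is_hom_square[OF g a, folded h_def t_def] by (simp add: mat_assoc)
        finally show ?thesis using jq(4)[OF v(2)] by (simp add: mat_zero_right)
      qed
      have "?X = (f h * g h + j h * q h) * ?X" by (simp add: jq(6)[OF v(1)] mat_one_left)
      also have "\<dots> = f h * (g h * ?X) + j h * (q h * ?X)" by (simp add: mat_assoc mat_distrib_right)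
      finally have 1: "j h * rmap B a = ?X"
        unfolding gX by (simp add: rB h_def[symmetric] t_def[symmetric] mat_zero_right mat_add_zero_left)
      let ?Y = "q h * rmap V a"
      have Yf: "?Y * f t = 0\<^sub>m (rdim V h - rdim A h) (rdim A t)"
      proof -
        have "?Y * f t = q h * (rmap V a * f t)" by (simp add: mat_assoc)
        also have "\<dots> = (q h * f h) * rmap A a"
          using is_hom_square[OF f a, folded h_def t_def] by (simp add: mat_assoc)
        finally show ?thesis using jq(5)[OF v(1)] by (simp add: mat_zero_left)
      qed
      have "?Y = ?Y * (f t * g t + j t * q t)" by (simp add: jq(6)[OF v(2)] mat_one_right)
      also have "\<dots> = (?Y * f t) * g t + q h * (rmap V a * j t) * q t" by (simp add: mat_assoc mat_distrib_left)
      finally have 2: "?Y = rmap B a * q t"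
        unfolding Yf by (simp add: rB h_def[symmetric] t_def[symmetric] mat_zero_left mat_add_zero_left)
      from 1 2 show ?thesis by (simp add: h_def t_def)
    qed
    then show "is_hom G B V j" "is_hom G V B q"
      using jq(1,2) unfolding is_hom_def by simp_all
  qed
  have "biproduct G V A B f g j q"
    using f g jhom qhom gf jq(3-6) by (auto simp: biproduct_def)
  with B show ?thesis by blast
qed

lemma retract_iff_summand:
  assumes "is_rep G A" "is_rep G V" "\<And>v. v \<in> verts G \<Longrightarrow> rdim A v \<le> 1"
  shows "retract G A V \<longleftrightarrow> (\<exists>B. is_rep G B \<and> rep_iso G V (rep_plus A B))"
proof
  assume "retract G A V"
  then show "\<exists>B. is_rep G B \<and> rep_iso G V (rep_plus A B)"
    using retract_complement[OF assms(1,2) _ _ _ assms(3)] biproduct_iso_rep_plus[OF assms(2,1)]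
    unfolding retract_def by blast
next
  assume "\<exists>B. is_rep G B \<and> rep_iso G V (rep_plus A B)"
  then obtain B i p j q where "biproduct G V A B i p j q"
    using rep_iso_plus_iff[OF assms(2,1)] by blast
  then show "retract G A V" unfolding biproduct_def retract_def by blast
qed

text \<open>After the first copy is split off with complement \<open>B\<close>, orthogonality makes
  the second retraction factor through \<open>B\<close>, where it is split off in turn. This is why
  the given \<open>f\<close> and \<open>g\<close> are kept in
  \<open>retract_complement\<close>.\<close>

lemma double_retract_iff_summand:
  assumes A: "is_rep G A" and V: "is_rep G V" and thin: "\<And>v. v \<in> verts G \<Longrightarrow> rdim A v \<le> 1"
  shows "double_retract G A V \<longleftrightarrow> (\<exists>B. is_rep G B \<and> rep_iso G V (rep_plus A (rep_plus A B)))"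
proof
  assume "double_retract G A V"
  then obtain f f' g g' where f: "is_hom G A V f" "is_hom G V A g" "is_hom G A V f'" "is_hom G V A g'"
    and e: "\<And>v. v \<in> verts G \<Longrightarrow> g v * f v = 1\<^sub>m (rdim A v) \<and> g' v * f' v = 1\<^sub>m (rdim A v) \<and>
      g v * f' v = 0\<^sub>m (rdim A v) (rdim A v) \<and> g' v * f v = 0\<^sub>m (rdim A v) (rdim A v)"
    unfolding double_retract_def by blast
  obtain B j q where B: "is_rep G B" and b: "biproduct G V A B f g j q"
    using retract_complement[OF A V f(1,2) _ thin] e by blast
  note b' = biproduct_homs[OF b]
  have h: "is_hom G A B (\<lambda>v. q v * f' v)" "is_hom G B A (\<lambda>v. g' v * j v)"
    by (intro is_hom_comp[OF A V B] is_hom_comp[OF B V A] f b')+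
  have "g' v * j v * (q v * f' v) = 1\<^sub>m (rdim A v)" if v: "v \<in> verts G" for v
  proof -
    note [simp] = b'[THEN is_hom_dims(2), OF v] b'[THEN is_hom_dims(3), OF v]
      f[THEN is_hom_dims(2), OF v] f[THEN is_hom_dims(3), OF v]
    have "1\<^sub>m (rdim A v) = g' v * ((f v * g v + j v * q v) * f' v)"
      using b e[OF v] v by (simp add: biproduct_def mat_one_left)
    also have "\<dots> = (g' v * f v) * (g v * f' v) + g' v * j v * (q v * f' v)"
      by (simp add: mat_assoc mat_distrib_left mat_distrib_right)
    finally show ?thesis using e[OF v] by (simp add: mat_zero_left mat_add_zero_left)
  qed
  with h have "retract G A B" unfolding retract_def by blast
  then obtain B' where B': "is_rep G B'" "rep_iso G B (rep_plus A B')"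
    using retract_iff_summand[OF A B thin] by blast
  have "rep_iso G V (rep_plus A B)" by (rule biproduct_iso_rep_plus[OF V A B b])
  moreover have "rep_iso G (rep_plus A B) (rep_plus A (rep_plus A B'))"
    using rep_iso_plus_cong[OF A B A is_rep_plus[OF A B'(1)] rep_iso_refl[OF A] B'(2)] .
  ultimately have "rep_iso G V (rep_plus A (rep_plus A B'))"
    using A V B B' by (blast intro: rep_iso_trans is_rep_plus)
  with B' show "\<exists>B. is_rep G B \<and> rep_iso G V (rep_plus A (rep_plus A B))" by blast
next
  assume "\<exists>B. is_rep G B \<and> rep_iso G V (rep_plus A (rep_plus A B))"
  then obtain B where B: "is_rep G B" "rep_iso G V (rep_plus A (rep_plus A B))" by blast
  have AB: "is_rep G (rep_plus A B)" by (rule is_rep_plus[OF A B(1)])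
  have "double_retract G A (rep_plus A (rep_plus A B))"
    by (rule double_retract_plus[OF A A AB retract_refl[OF A] retract_plus_left[OF A B(1)]])
  moreover have "retract G (rep_plus A (rep_plus A B)) V"
    using rep_iso_retract[OF rep_iso_sym[OF B(2)]] .
  ultimately show "double_retract G A V"
    using double_retract_trans[OF A is_rep_plus[OF A AB] V] by blast
qed

end

section \<open>Quivers of type A and morphisms to and from intervals\<close>

locale dynkin =
  fixes m :: nat and Q :: "(nat, nat) pre_digraph"
  assumes dyn: "dynkin_A m Q"
begin

lemma verts_Q: "verts Q = {1..m}" and arcs_Q: "arcs Q = {1..<m}"
  using dyn by (auto simp: dynkin_A_def)

lemma arc_cases:
  assumes "i \<in> arcs Q"
  obtains "tail Q i = i" "head Q i = Suc i" | "tail Q i = Suc i" "head Q i = i"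
proof -
  have "tail Q i = i \<and> head Q i = i + 1 \<or> tail Q i = i + 1 \<and> head Q i = i"
    using dyn assms by (simp add: dynkin_A_def)
  then show thesis using that by auto
qed

lemma arc_ends:
  assumes "i \<in> arcs Q"
  shows "tail Q i \<in> verts Q" "head Q i \<in> verts Q"
  using assms by (cases rule: arc_cases[OF assms]; simp add: verts_Q arcs_Q)+

end

sublocale dynkin \<subseteq> wf_digraph Q
  by unfold_locales (rule arc_ends, assumption)+

context dynkin
begin

abbreviation I :: "nat \<Rightarrow> nat \<Rightarrow> (nat, nat, 'k::field) quiver_rep" where
  "I a b \<equiv> interval_rep Q a b"

lemma rdim_interval: "rdim (I a b) v = (if v \<in> {a..b} then 1 else 0)"
  by (simp add: interval_rep_def Let_def)

lemma rdim_interval_le: "rdim (I a b) v \<le> 1"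
  by (simp add: rdim_interval)

text \<open>A uniform description: zero maps occur only as matrices without rows or without columns,
  so every entry that exists is 1.\<close>

lemma rmap_interval:
  "rmap (I a b) e = mat (if head Q e \<in> {a..b} then 1 else 0) (if tail Q e \<in> {a..b} then 1 else 0) (\<lambda>_. 1)"
  by (rule eq_matI) (auto simp: interval_rep_def Let_def split: if_splits)

lemma is_rep_interval: "is_rep Q (I a b)"
  by (auto simp: is_rep_def rmap_interval rdim_interval)

lemma rmap_interval_in:
  "head Q e \<in> {a..b} \<Longrightarrow> tail Q e \<in> {a..b} \<Longrightarrow> rmap (I a b) e = 1\<^sub>m 1"
  by (simp add: interval_rep_def Let_def)

lemma hom_from_intervalD:
  fixes V :: "(nat, nat, 'k::field) quiver_rep"
  assumes f: "is_hom Q (I a b) V f" and V: "is_rep Q V" and e: "e \<in> arcs Q" and t: "tail Q e \<in> {a..b}"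
  shows "rmap V e * f (tail Q e) = (if head Q e \<in> {a..b} then f (head Q e) else 0\<^sub>m (rdim V (head Q e)) 1)"
proof -
  note s = is_hom_square[OF f e, symmetric]
  have d: "dim_col (f (head Q e)) = rdim (I a b :: (nat, nat, 'k) quiver_rep) (head Q e)"
    "dim_row (f (head Q e)) = rdim V (head Q e)"
    using is_hom_dims[OF f] e by auto
  show ?thesis
  proof (cases "head Q e \<in> {a..b}")
    case True
    then show ?thesis using s d t by (simp add: rmap_interval_in mat_one_right rdim_interval)
  next
    case False
    then show ?thesis unfolding s using d t
      by (auto intro!: eq_matI simp: rmap_interval rdim_interval scalar_prod_def)
  qed
qed

lemma hom_to_intervalD:
  fixes V :: "(nat, nat, 'k::field) quiver_rep"
  assumes f: "is_hom Q V (I a b) f" and V: "is_rep Q V" and e: "e \<in> arcs Q" and t: "head Q e \<in> {a..b}"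
  shows "f (head Q e) * rmap V e = (if tail Q e \<in> {a..b} then f (tail Q e) else 0\<^sub>m 1 (rdim V (tail Q e)))"
proof -
  note s = is_hom_square[OF f e]
  have d: "dim_row (f (tail Q e)) = rdim (I a b :: (nat, nat, 'k) quiver_rep) (tail Q e)"
    "dim_col (f (tail Q e)) = rdim V (tail Q e)"
    using is_hom_dims[OF f] e by auto
  show ?thesis
  proof (cases "tail Q e \<in> {a..b}")
    case True
    then show ?thesis using s d t by (simp add: rmap_interval_in mat_one_left rdim_interval)
  next
    case False
    then show ?thesis unfolding s using d t
      by (auto intro!: eq_matI simp: rmap_interval rdim_interval scalar_prod_def)
  qed
qed

lemma hom_from_intervalI:
  fixes V :: "(nat, nat, 'k::field) quiver_rep"
  assumes V: "is_rep Q V" and x: "\<And>v. v \<in> {a..b} \<Longrightarrow> x v \<in> carrier_mat (rdim V v) 1"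
    and e1: "\<And>e. e \<in> arcs Q \<Longrightarrow> tail Q e \<in> {a..b} \<Longrightarrow> head Q e \<in> {a..b} \<Longrightarrow> rmap V e * x (tail Q e) = x (head Q e)"
    and e2: "\<And>e. e \<in> arcs Q \<Longrightarrow> tail Q e \<in> {a..b} \<Longrightarrow> head Q e \<notin> {a..b} \<Longrightarrow>
      rmap V e * x (tail Q e) = 0\<^sub>m (rdim V (head Q e)) 1"
  shows "is_hom Q (I a b) V (\<lambda>v. if v \<in> {a..b} then x v else 0\<^sub>m (rdim V v) 0)" (is "is_hom _ _ _ ?f")
  unfolding is_hom_def
proof (intro conjI ballI)
  fix v show "?f v \<in> carrier_mat (rdim V v) (rdim (I a b :: (nat, nat, 'k) quiver_rep) v)"
    using x by (auto simp: rdim_interval)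
next
  fix e assume e: "e \<in> arcs Q"
  show "?f (head Q e) * rmap (I a b) e = rmap V e * ?f (tail Q e)"
  proof (cases "tail Q e \<in> {a..b}")
    case False
    then show ?thesis using x[of "tail Q e"] x[of "head Q e"] is_rep_dims[OF V e]
      by (intro eq_matI) (auto simp: rmap_interval rdim_interval)
  next
    case t: True
    show ?thesis
    proof (cases "head Q e \<in> {a..b}")
      case True
      then show ?thesis using t e1[OF e t True] x[OF True] by (simp add: rmap_interval_in mat_one_right)
    next
      case False
      then show ?thesis using t e2[OF e t False]
        by (auto intro!: eq_matI simp: rmap_interval rdim_interval scalar_prod_def)
    qed
  qed
qed

lemma hom_to_intervalI:
  fixes V :: "(nat, nat, 'k::field) quiver_rep"
  assumes V: "is_rep Q V" and x: "\<And>v. v \<in> {a..b} \<Longrightarrow> x v \<in> carrier_mat 1 (rdim V v)"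
    and e1: "\<And>e. e \<in> arcs Q \<Longrightarrow> tail Q e \<in> {a..b} \<Longrightarrow> head Q e \<in> {a..b} \<Longrightarrow> x (head Q e) * rmap V e = x (tail Q e)"
    and e2: "\<And>e. e \<in> arcs Q \<Longrightarrow> head Q e \<in> {a..b} \<Longrightarrow> tail Q e \<notin> {a..b} \<Longrightarrow>
      x (head Q e) * rmap V e = 0\<^sub>m 1 (rdim V (tail Q e))"
  shows "is_hom Q V (I a b) (\<lambda>v. if v \<in> {a..b} then x v else 0\<^sub>m 0 (rdim V v))" (is "is_hom _ _ _ ?f")
  unfolding is_hom_def
proof (intro conjI ballI)
  fix v show "?f v \<in> carrier_mat (rdim (I a b :: (nat, nat, 'k) quiver_rep) v) (rdim V v)"
    using x by (auto simp: rdim_interval)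
next
  fix e assume e: "e \<in> arcs Q"
  show "?f (head Q e) * rmap V e = rmap (I a b) e * ?f (tail Q e)"
  proof (cases "head Q e \<in> {a..b}")
    case False
    then show ?thesis using x[of "tail Q e"] x[of "head Q e"] is_rep_dims[OF V e]
      by (intro eq_matI) (auto simp: rmap_interval rdim_interval)
  next
    case t: True
    show ?thesis
    proof (cases "tail Q e \<in> {a..b}")
      case True
      then show ?thesis using t e1[OF e True t] x[OF True] by (simp add: rmap_interval_in mat_one_left)
    next
      case False
      then show ?thesis using t e2[OF e t False]
        by (auto intro!: eq_matI simp: rmap_interval rdim_interval scalar_prod_def)
    qed
  qed
qed

text \<open>Endomorphisms of interval representations are scalars, here for those that factor through \<open>V\<close>.\<close>

lemma interval_comp_const:
  fixes V :: "(nat, nat, 'k::field) quiver_rep"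
  assumes f: "is_hom Q (I a b) V f" and g: "is_hom Q V (I a b) g" and V: "is_rep Q V"
    and ab: "1 \<le> a" "b \<le> m" and uv: "u \<in> {a..b}" "v \<in> {a..b}"
  shows "g u * f u = g v * f v"
proof -
  have step: "g i * f i = g (Suc i) * f (Suc i)" if i: "i \<in> {a..<b}" for i
  proof -
    have e: "i \<in> arcs Q" using i ab by (auto simp: arcs_Q)
    have ht: "head Q i \<in> {a..b}" "tail Q i \<in> {a..b}"
      using i by (cases rule: arc_cases[OF e]; simp)+
    have v: "head Q i \<in> verts Q" "tail Q i \<in> verts Q" using e by auto
    note [simp] = is_hom_dims[OF f v(1)] is_hom_dims[OF f v(2)] is_hom_dims[OF g v(1)] is_hom_dims[OF g v(2)]
      is_rep_dims[OF V e]
    have "g (head Q i) * f (head Q i) = g (head Q i) * (rmap V i * f (tail Q i))"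
      using hom_from_intervalD[OF f V e ht(2)] ht by simp
    also have "\<dots> = g (tail Q i) * f (tail Q i)"
      using hom_to_intervalD[OF g V e ht(1)] ht by (simp flip: mat_assoc)
    finally show ?thesis by (cases rule: arc_cases[OF e]) simp_all
  qed
  have "g w * f w = g a * f a" if "w \<in> {a..b}" for w
  proof -
    have "a \<le> w" using that by simp
    then show ?thesis using that
    proof (induction w rule: dec_induct)
      case (step n) then show ?case using \<open>\<And>i. i \<in> {a..<b} \<Longrightarrow> g i * f i = _\<close>[of n] by simp
    qed simp
  qed
  then show ?thesis using uv by metis
qed

text \<open>The composite is the same scalar along the whole interval, so a nonzero value at one
  vertex is enough: dividing \<open>f\<close> by it gives the identity.\<close>

lemma retract_intervalI:
  fixes V :: "(nat, nat, 'k::field) quiver_rep"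
  assumes f: "is_hom Q (I a b) V f" and g: "is_hom Q V (I a b) g" and V: "is_rep Q V"
    and ab: "1 \<le> a" "b \<le> m" and v: "v \<in> {a..b}" and nz: "g v * f v \<noteq> 0\<^sub>m 1 1"
  shows "retract Q (I a b) V"
proof -
  have vQ: "v \<in> verts Q" using v ab by (simp add: verts_Q)
  define c where "c = (g v * f v) $$ (0,0)"
  have gfv: "g v * f v \<in> carrier_mat 1 1"
    using is_hom_dims[OF f vQ] is_hom_dims[OF g vQ] v by (auto simp: rdim_interval)
  have c: "c \<noteq> 0"
    using nz gfv by (auto simp: mat_one_by_one_eq_iff[OF gfv] c_def)
  have h: "is_hom Q (I a b) V (\<lambda>v. (1 / c) \<cdot>\<^sub>m f v)"
    by (rule is_hom_smult[OF is_rep_interval V f])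
  have "g w * ((1 / c) \<cdot>\<^sub>m f w) = 1\<^sub>m (rdim (I a b :: (nat, nat, 'k) quiver_rep) w)" if w: "w \<in> verts Q" for w
  proof (cases "w \<in> {a..b}")
    case True
    note [simp] = is_hom_dims[OF f w] is_hom_dims[OF g w]
    have "g w * ((1 / c) \<cdot>\<^sub>m f w) = (1 / c) \<cdot>\<^sub>m (g v * f v)"
      using interval_comp_const[OF f g V ab True v] by (simp add: mat_smult_right)
    moreover have "g v * f v = c \<cdot>\<^sub>m 1\<^sub>m 1"
      using gfv by (subst mat_one_by_one_eq_iff) (auto simp: c_def)
    ultimately show ?thesis using True c by (auto simp: rdim_interval intro!: eq_matI)
  next
    case False
    then show ?thesis using is_hom_dims[OF f w] is_hom_dims[OF g w]
      by (intro eq_matI) (auto simp: rdim_interval)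
  qed
  then show ?thesis using h g unfolding retract_def by blast
qed

text \<open>The identity of the interval is the sum of a composite through \<open>X\<close> and one
  through \<open>Y\<close>. Both are scalars, and they cannot both be zero.\<close>

lemma retract_interval_plus:
  fixes X Y :: "(nat, nat, 'k::field) quiver_rep"
  assumes X: "is_rep Q X" and Y: "is_rep Q Y" and ab: "1 \<le> a" "a \<le> b" "b \<le> m"
    and r: "retract Q (I a b) (rep_plus X Y)"
  shows "retract Q (I a b) X \<or> retract Q (I a b) Y"
proof (rule ccontr)
  assume contra: "\<not> ?thesis"
  let ?S = "rep_plus X Y"
  have S: "is_rep Q ?S" by (rule is_rep_plus[OF X Y])
  obtain i p j q where b: "biproduct Q ?S X Y i p j q"
    using rep_plus_biproduct[OF X Y] by blast
  note h = biproduct_homs[OF b]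
  obtain f g where fg: "is_hom Q (I a b) ?S f" "is_hom Q ?S (I a b) g"
    "\<And>v. v \<in> verts Q \<Longrightarrow> g v * f v = 1\<^sub>m (rdim (I a b :: (nat, nat, 'k) quiver_rep) v)"
    using r unfolding retract_def by blast
  have a: "a \<in> verts Q" "a \<in> {a..b}" using ab by (auto simp: verts_Q)
  have 1: "(g a * i a) * (p a * f a) = 0\<^sub>m 1 1"
    using retract_intervalI[OF is_hom_comp[OF is_rep_interval S X fg(1) h(2)] is_hom_comp[OF X S is_rep_interval h(1) fg(2)]
        X ab(1,3) a(2)] contra by blast
  have 2: "(g a * j a) * (q a * f a) = 0\<^sub>m 1 1"
    using retract_intervalI[OF is_hom_comp[OF is_rep_interval S Y fg(1) h(4)] is_hom_comp[OF Y S is_rep_interval h(3) fg(2)]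
        Y ab(1,3) a(2)] contra by blast
  note [simp] = h[THEN is_hom_dims(2), OF a(1)] h[THEN is_hom_dims(3), OF a(1)]
    is_hom_dims[OF fg(1) a(1)] is_hom_dims[OF fg(2) a(1)]
  have "g a * f a = g a * ((i a * p a + j a * q a) * f a)"
    using b a by (simp add: biproduct_def mat_one_left)
  also have "\<dots> = (g a * i a) * (p a * f a) + (g a * j a) * (q a * f a)"
    by (simp add: mat_assoc mat_distrib_left mat_distrib_right)
  also have "\<dots> = 0\<^sub>m 1 1" unfolding 1 2 by (simp add: mat_add_zero_left)
  finally have "1\<^sub>m 1 = (0\<^sub>m 1 1 :: 'k mat)" using fg(3)[OF a(1)] a(2) by (simp add: rdim_interval)
  then show False by (auto dest!: arg_cong[of _ _ "\<lambda>M. M $$ (0,0)"])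
qed

text \<open>If the interval is not a retract of \<open>Y\<close>, every composite through
  \<open>Y\<close> is zero. Composites through the sum then equal those through \<open>X\<close>,
  and the equations carry over unchanged.\<close>

lemma double_retract_interval_plus:
  fixes X Y :: "(nat, nat, 'k::field) quiver_rep"
  assumes X: "is_rep Q X" and Y: "is_rep Q Y" and ab: "1 \<le> a" "a \<le> b" "b \<le> m"
    and r: "double_retract Q (I a b) (rep_plus X Y)" and nY: "\<not> retract Q (I a b) Y"
  shows "double_retract Q (I a b) X"
proof -
  let ?S = "rep_plus X Y"
  have S: "is_rep Q ?S" by (rule is_rep_plus[OF X Y])
  obtain i p j q where b: "biproduct Q ?S X Y i p j q"
    using rep_plus_biproduct[OF X Y] by blast
  note h = biproduct_homs[OF b]
  have key: "(g v * i v) * (p v * f v) = g v * f v"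
    if v: "v \<in> verts Q" and fg: "is_hom Q (I a b) ?S f" "is_hom Q ?S (I a b) g" for f g v
  proof (cases "v \<in> {a..b}")
    case True
    have 2: "(g v * j v) * (q v * f v) = 0\<^sub>m 1 1"
      using retract_intervalI[OF is_hom_comp[OF is_rep_interval S Y fg(1) h(4)] is_hom_comp[OF Y S is_rep_interval h(3) fg(2)]
        Y ab(1,3) True] nY by blast
    note [simp] = h[THEN is_hom_dims(2), OF v] h[THEN is_hom_dims(3), OF v]
      is_hom_dims[OF fg(1) v] is_hom_dims[OF fg(2) v]
    have "g v * f v = g v * ((i v * p v + j v * q v) * f v)"
      using b v by (simp add: biproduct_def mat_one_left)
    also have "\<dots> = (g v * i v) * (p v * f v) + (g v * j v) * (q v * f v)"
      by (simp add: mat_assoc mat_distrib_left mat_distrib_right)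
    also have "\<dots> = (g v * i v) * (p v * f v)" unfolding 2
      using True by (intro mat_add_zero_right) (simp_all add: rdim_interval)
    finally show ?thesis by simp
  next
    case False
    then show ?thesis using is_hom_dims[OF fg(1) v] is_hom_dims[OF fg(2) v]
      by (intro eq_matI) (auto simp: rdim_interval)
  qed
  obtain f f' g g' where f: "is_hom Q (I a b) ?S f" "is_hom Q ?S (I a b) g" "is_hom Q (I a b) ?S f'" "is_hom Q ?S (I a b) g'"
    and e: "\<And>v. v \<in> verts Q \<Longrightarrow> g v * f v = 1\<^sub>m (rdim (I a b :: (nat, nat, 'k) quiver_rep) v) \<and> g' v * f' v = 1\<^sub>m (rdim (I a b :: (nat, nat, 'k) quiver_rep) v) \<and>
      g v * f' v = 0\<^sub>m (rdim (I a b :: (nat, nat, 'k) quiver_rep) v) (rdim (I a b :: (nat, nat, 'k) quiver_rep) v) \<and> g' v * f v = 0\<^sub>m (rdim (I a b :: (nat, nat, 'k) quiver_rep) v) (rdim (I a b :: (nat, nat, 'k) quiver_rep) v)"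
    using r unfolding double_retract_def by blast
  show ?thesis
    unfolding double_retract_def
  proof (intro exI conjI ballI)
    show "is_hom Q (I a b) X (\<lambda>v. p v * f v)" "is_hom Q X (I a b) (\<lambda>v. g v * i v)"
      "is_hom Q (I a b) X (\<lambda>v. p v * f' v)" "is_hom Q X (I a b) (\<lambda>v. g' v * i v)"
      by (intro is_hom_comp[OF is_rep_interval S X] is_hom_comp[OF X S is_rep_interval] f h)+
  qed (use e in \<open>simp_all add: key f\<close>)
qed

text \<open>\<open>g * f = 1\<close> forces the first support into the second. At \<open>a\<close>
  the scalars commute, so \<open>f * g\<close> is 1 there; as a composite from the second interval
  to itself it is constant on that interval, which gives the reverse inclusion.\<close>

lemma retract_interval_eq:
  assumes ab: "1 \<le> a" "a \<le> b" "b \<le> m" and cd: "1 \<le> c" "c \<le> d" "d \<le> m"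
    and r: "retract Q (I a b) (I c d :: (nat, nat, 'k::field) quiver_rep)"
  shows "a = c \<and> b = d"
proof -
  obtain f g where fg: "is_hom Q (I a b) (I c d) f" "is_hom Q (I c d) (I a b :: (nat, nat, 'k) quiver_rep) g"
    "\<And>v. v \<in> verts Q \<Longrightarrow> g v * f v = 1\<^sub>m (rdim (I a b :: (nat, nat, 'k) quiver_rep) v)"
    using r unfolding retract_def by blast
  have sub: "v \<in> {c..d}" if v: "v \<in> {a..b}" for v
  proof (rule ccontr)
    assume "v \<notin> {c..d}"
    have vQ: "v \<in> verts Q" using v ab by (auto simp: verts_Q)
    have "(g v * f v) $$ (0,0) = 0"
      using is_hom_dims[OF fg(1) vQ] is_hom_dims[OF fg(2) vQ] v \<open>v \<notin> {c..d}\<close>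
      by (simp add: rdim_interval scalar_prod_def)
    then show False using fg(3)[OF vQ] v by (simp add: rdim_interval)
  qed
  have aQ: "a \<in> verts Q" using ab by (auto simp: verts_Q)
  have acd: "a \<in> {c..d}" using sub ab by simp
  have c1: "f a \<in> carrier_mat 1 1" "g a \<in> carrier_mat 1 1"
    using is_hom_dims(1)[OF fg(1) aQ] is_hom_dims(1)[OF fg(2) aQ] acd ab by (auto simp: rdim_interval)
  have "g a $$ (0,0) * f a $$ (0,0) = 1"
    using mat_mult_one_by_one[OF c1(2,1)] fg(3)[OF aQ] ab by (simp add: rdim_interval)
  then have fga: "(f a * g a) $$ (0,0) = 1"
    using mat_mult_one_by_one[OF c1] by (simp add: mult.commute)
  have "v \<in> {a..b}" if v: "v \<in> {c..d}" for v
  proof (rule ccontr)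
    assume "v \<notin> {a..b}"
    have vQ: "v \<in> verts Q" using v cd by (auto simp: verts_Q)
    have "f v * g v = f a * g a"
      by (rule interval_comp_const[OF fg(2,1) is_rep_interval cd(1,3) v acd])
    moreover have "(f v * g v) $$ (0,0) = 0"
      using is_hom_dims[OF fg(1) vQ] is_hom_dims[OF fg(2) vQ] v \<open>v \<notin> {a..b}\<close>
      by (simp add: rdim_interval scalar_prod_def)
    ultimately show False using fga by simp
  qed
  then have "{a..b} = {c..d}" using sub by blast
  then show ?thesis using ab cd by auto
qed

text \<open>At the vertex \<open>a\<close> two nonzero scalars would have product zero.\<close>

lemma not_double_retract_interval:
  assumes ab: "1 \<le> a" "a \<le> b" "b \<le> m"
  shows "\<not> double_retract Q (I a b) (I a b :: (nat, nat, 'k::field) quiver_rep)"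
proof
  let ?I = "I a b :: (nat, nat, 'k) quiver_rep"
  assume "double_retract Q ?I ?I"
  then obtain f f' g g' where f: "is_hom Q ?I ?I f" "is_hom Q ?I ?I g" "is_hom Q ?I ?I f'" "is_hom Q ?I ?I g'"
    and e: "\<And>v. v \<in> verts Q \<Longrightarrow> g v * f v = 1\<^sub>m (rdim ?I v) \<and> g' v * f' v = 1\<^sub>m (rdim ?I v) \<and>
      g v * f' v = 0\<^sub>m (rdim ?I v) (rdim ?I v) \<and> g' v * f v = 0\<^sub>m (rdim ?I v) (rdim ?I v)"
    unfolding double_retract_def by blast
  have aQ: "a \<in> verts Q" using ab by (auto simp: verts_Q)
  have d: "rdim ?I a = 1" using ab by (simp add: rdim_interval)
  have c: "f a \<in> carrier_mat 1 1" "g a \<in> carrier_mat 1 1" "f' a \<in> carrier_mat 1 1" "g' a \<in> carrier_mat 1 1"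
    using f[THEN is_hom_dims(1), OF aQ] d by simp_all
  have "g a $$ (0,0) * f a $$ (0,0) = 1" "g' a $$ (0,0) * f' a $$ (0,0) = 1" "g a $$ (0,0) * f' a $$ (0,0) = 0"
    using e[OF aQ] d c by (simp_all flip: mat_mult_one_by_one)
  then show False by auto
qed

end

section \<open>Every nonzero representation has an interval summand\<close>

lemma row_eq_zero:
  fixes \<phi> :: "'k::field mat"
  assumes "\<phi> \<in> carrier_mat 1 n" "\<And>y. y \<in> carrier_mat n 1 \<Longrightarrow> \<phi> * y = 0\<^sub>m 1 1"
  shows "\<phi> = 0\<^sub>m 1 n"
proof (rule eq_matI)
  fix i j assume ij: "i < dim_row (0\<^sub>m 1 n :: 'k mat)" "j < dim_col (0\<^sub>m 1 n :: 'k mat)"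
  define e :: "'k mat" where "e = mat n 1 (\<lambda>(r,c). if r = j then 1 else 0)"
  have "(\<phi> * e) $$ (0,0) = \<phi> $$ (0,j)"
    using ij assms(1) by (auto simp: e_def scalar_prod_def if_distrib[of "\<lambda>x. _ * x"] sum.delta cong: if_cong)
  moreover have "\<phi> * e = 0\<^sub>m 1 1" by (rule assms(2)) (simp add: e_def)
  ultimately show "\<phi> $$ (i,j) = 0\<^sub>m 1 n $$ (i,j)" using ij by simp
qed (use assms(1) in auto)

context wf_digraph
begin

lemma rep_plus_comm:
  assumes V: "is_rep G V" and W: "is_rep G W"
  shows "rep_iso G (rep_plus V W) (rep_plus W V)"
proof -
  obtain i p j q where b: "biproduct G (rep_plus V W) V W i p j q"
    using rep_plus_biproduct[OF assms] by blast
  have "j v * q v + i v * p v = i v * p v + j v * q v" if v: "v \<in> verts G" for v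
    using biproduct_homs[OF b, THEN is_hom_dims(2), OF v] biproduct_homs[OF b, THEN is_hom_dims(3), OF v]
    by (intro comm_add_mat[of _ "rdim V v + rdim W v" "rdim V v + rdim W v"]) (auto intro: carrier_matI)
  then have "biproduct G (rep_plus V W) W V j q i p"
    using b by (auto simp: biproduct_def)
  then show ?thesis by (rule biproduct_iso_rep_plus[OF is_rep_plus[OF V W] W V])
qed

lemma double_retract_imp_retract: "double_retract G A V \<Longrightarrow> retract G A V"
  unfolding double_retract_def retract_def by blast

end

context dynkin
begin

text \<open>The arrow is regarded as a linear relation from left to right, whichever way it points,
  and \<open>S\<close> is pulled back along that relation. For an arrow pointing left this is an
  image.\<close>

definition pull_back :: "(nat, nat, 'k::field) quiver_rep \<Rightarrow> nat \<Rightarrow> 'k mat set \<Rightarrow> 'k mat set" where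
  "pull_back V i S =
     (if tail Q i = i then {y \<in> carrier_mat (rdim V i) 1. rmap V i * y \<in> S}
      else (\<lambda>y. rmap V i * y) ` S)"

text \<open>Transports \<open>S\<close> from vertex \<open>a + k\<close> to \<open>a\<close>. The
  rightmost arrow is peeled off first, so extending the interval by one vertex only changes the
  argument \<open>S\<close>.\<close>

fun pull_back_to :: "(nat, nat, 'k::field) quiver_rep \<Rightarrow> nat \<Rightarrow> nat \<Rightarrow> 'k mat set \<Rightarrow> 'k mat set" where
  "pull_back_to V a 0 S = S"
| "pull_back_to V a (Suc k) S = pull_back_to V a k (pull_back V (a + k) S)"

lemma pull_back_mono: "S \<subseteq> S' \<Longrightarrow> pull_back V i S \<subseteq> pull_back V i S'"
  by (auto simp: pull_back_def)

lemma pull_back_to_mono: "S \<subseteq> S' \<Longrightarrow> pull_back_to V a k S \<subseteq> pull_back_to V a k S'"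
  by (induction k arbitrary: S S') (simp_all add: pull_back_mono)

lemma pull_back_carrier:
  assumes V: "is_rep Q V" and i: "i \<in> arcs Q" and S: "S \<subseteq> carrier_mat (rdim V (Suc i)) 1"
  shows "pull_back V i S \<subseteq> carrier_mat (rdim V i) 1"
  using is_rep_dims[OF V i] S
  by (cases rule: arc_cases[OF i]) (auto simp: pull_back_def)

lemma pull_back_subspace:
  assumes V: "is_rep Q V" and i: "i \<in> arcs Q" and S: "col_subspace (rdim V (Suc i)) S"
  shows "col_subspace (rdim V i) (pull_back V i S)"
proof (cases rule: arc_cases[OF i])
  case 1
  then have [simp]: "dim_row (rmap V i) = rdim V (Suc i)" "dim_col (rmap V i) = rdim V i"
    using is_rep_dims[OF V i] by auto
  have z: "rmap V i * 0\<^sub>m (rdim V i) 1 = 0\<^sub>m (rdim V (Suc i)) 1"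
    by (simp add: mat_zero_right)
  have "rmap V i * (y + z) = rmap V i * y + rmap V i * z" "rmap V i * (c \<cdot>\<^sub>m y) = c \<cdot>\<^sub>m (rmap V i * y)"
    if "y \<in> carrier_mat (rdim V i) 1" "z \<in> carrier_mat (rdim V i) 1" for y z c
    using that by (auto simp: mat_distrib_left mat_smult_right)
  then show ?thesis using S 1 z unfolding col_subspace_def pull_back_def by auto
next
  case 2
  then have [simp]: "dim_row (rmap V i) = rdim V i" "dim_col (rmap V i) = rdim V (Suc i)"
    using is_rep_dims[OF V i] by auto
  have Sc: "S \<subseteq> carrier_mat (rdim V (Suc i)) 1" using S by (simp add: col_subspace_def)
  have z: "rmap V i * 0\<^sub>m (rdim V (Suc i)) 1 = 0\<^sub>m (rdim V i) 1"
    by (simp add: mat_zero_right)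
  have "rmap V i * y + rmap V i * z = rmap V i * (y + z)" "c \<cdot>\<^sub>m (rmap V i * y) = rmap V i * (c \<cdot>\<^sub>m y)"
    if "y \<in> S" "z \<in> S" for y z c
  proof -
    have "dim_row y = rdim V (Suc i)" "dim_col y = 1" "dim_row z = rdim V (Suc i)" "dim_col z = 1"
      using that Sc by auto
    then show "rmap V i * y + rmap V i * z = rmap V i * (y + z)" "c \<cdot>\<^sub>m (rmap V i * y) = rmap V i * (c \<cdot>\<^sub>m y)"
      by (simp_all add: mat_distrib_left mat_smult_right)
  qed
  moreover have "0\<^sub>m (rdim V i) 1 \<in> (\<lambda>y. rmap V i * y) ` S"
    using S by (intro image_eqI[where x = "0\<^sub>m (rdim V (Suc i)) 1"] z[symmetric]) (simp add: col_subspace_def)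
  moreover have "(\<lambda>y. rmap V i * y) ` S \<subseteq> carrier_mat (rdim V i) 1"
    using Sc by (auto intro!: carrier_matI)
  ultimately show ?thesis using S 2(1) unfolding col_subspace_def pull_back_def
    by simp
qed

lemma pull_back_to_subspace:
  assumes "is_rep Q V" "1 \<le> a" "a + k \<le> m" "col_subspace (rdim V (a + k)) S"
  shows "col_subspace (rdim V a) (pull_back_to V a k S)"
  using assms
proof (induction k arbitrary: S)
  case (Suc k)
  then show ?case using pull_back_subspace[of V "a + k" S] by (simp add: arcs_Q)
qed simp

text \<open>Membership in a pull-back conceals a choice of vector at every vertex; walking to the
  right from \<open>a\<close> recovers these choices.\<close>

lemma pull_back_to_chain:
  assumes "is_rep Q V" "1 \<le> a" "a + k \<le> m" "S \<subseteq> carrier_mat (rdim V (a + k)) 1" "x \<in> pull_back_to V a k S"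
  shows "\<exists>xs. xs a = x \<and> xs (a + k) \<in> S \<and> (\<forall>v\<in>{a..a+k}. xs v \<in> carrier_mat (rdim V v) 1) \<and>
    (\<forall>e\<in>{a..<a+k}. rmap V e * xs (tail Q e) = xs (head Q e))"
  using assms
proof (induction k arbitrary: S)
  case 0
  then show ?case by (intro exI[of _ "\<lambda>_. x"]) auto
next
  case (Suc k)
  let ?b = "a + k"
  have e: "?b \<in> arcs Q" using Suc.prems by (simp add: arcs_Q)
  have "pull_back V ?b S \<subseteq> carrier_mat (rdim V ?b) 1"
    using pull_back_carrier[OF Suc.prems(1) e] Suc.prems(4) by simp
  then obtain xs where xs: "xs a = x" "xs ?b \<in> pull_back V ?b S" "\<forall>v\<in>{a..?b}. xs v \<in> carrier_mat (rdim V v) 1"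
    "\<forall>e\<in>{a..<?b}. rmap V e * xs (tail Q e) = xs (head Q e)"
    using Suc.IH[of "pull_back V ?b S"] Suc.prems by auto
  \<comment> \<open>An arrow to the right computes the next vector; an arrow to the left requires
    choosing a preimage.\<close>
  obtain y where y: "y \<in> S" "tail Q ?b = ?b \<Longrightarrow> y = rmap V ?b * xs ?b" "tail Q ?b \<noteq> ?b \<Longrightarrow> rmap V ?b * y = xs ?b"
  proof (cases "tail Q ?b = ?b")
    case True
    then show ?thesis using xs(2) that[of "rmap V ?b * xs ?b"] by (simp add: pull_back_def)
  next
    case False
    then show ?thesis using xs(2) that by (auto simp: pull_back_def)
  qed
  have neq: "tail Q e \<noteq> Suc ?b" "head Q e \<noteq> Suc ?b" if "e \<in> {a..<?b}" for e
  proof -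
    have "e \<in> arcs Q" using that Suc.prems by (simp add: arcs_Q)
    then show "tail Q e \<noteq> Suc ?b" "head Q e \<noteq> Suc ?b" using that by (cases rule: arc_cases; simp)+
  qed
  have "rmap V e * (xs(Suc ?b := y)) (tail Q e) = (xs(Suc ?b := y)) (head Q e)" if "e \<in> {a..<a + Suc k}" for e
  proof (cases "e = ?b")
    case True
    show ?thesis unfolding True using y(2,3) by (cases rule: arc_cases[OF e]) simp_all
  next
    case False
    then have "e \<in> {a..<?b}" using that by auto
    then show ?thesis using neq xs(4) by simp
  qed
  moreover have "\<forall>v\<in>{a..a + Suc k}. (xs(Suc ?b := y)) v \<in> carrier_mat (rdim V v) 1"
    using xs(3) y(1) Suc.prems(4) by auto
  ultimately show ?case using xs(1) y(1)
    by (intro exI[of _ "xs(Suc ?b := y)"]) simp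
qed

text \<open>The dual walk. An arrow to the left is met by composing with it. For an arrow to the
  right the functional has to be factored through the arrow, and \<open>functional_factor\<close>
  applies because it vanishes on the preimage of \<open>K\<close>.\<close>

lemma pull_back_to_functional:
  assumes "is_rep Q V" "1 \<le> a" "a + k \<le> m" "col_subspace (rdim V (a + k)) K"
    "\<phi> \<in> carrier_mat 1 (rdim V a)" "\<And>x. x \<in> pull_back_to V a k K \<Longrightarrow> \<phi> * x = 0\<^sub>m 1 1"
  shows "\<exists>\<phi>s. \<phi>s a = \<phi> \<and> (\<forall>u\<in>K. \<phi>s (a + k) * u = 0\<^sub>m 1 1) \<and> (\<forall>v\<in>{a..a+k}. \<phi>s v \<in> carrier_mat 1 (rdim V v)) \<and>
    (\<forall>e\<in>{a..<a+k}. \<phi>s (head Q e) * rmap V e = \<phi>s (tail Q e))"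
  using assms
proof (induction k arbitrary: K)
  case 0
  then show ?case by (intro exI[of _ "\<lambda>_. \<phi>"]) auto
next
  case (Suc k)
  let ?b = "a + k"
  have e: "?b \<in> arcs Q" using Suc.prems by (simp add: arcs_Q)
  have "col_subspace (rdim V ?b) (pull_back V ?b K)"
    using pull_back_subspace[OF Suc.prems(1) e] Suc.prems(4) by simp
  then obtain \<phi>s where ps: "\<phi>s a = \<phi>" "\<forall>u\<in>pull_back V ?b K. \<phi>s ?b * u = 0\<^sub>m 1 1"
    "\<forall>v\<in>{a..?b}. \<phi>s v \<in> carrier_mat 1 (rdim V v)"
    "\<forall>e\<in>{a..<?b}. \<phi>s (head Q e) * rmap V e = \<phi>s (tail Q e)"
    using Suc.IH[of "pull_back V ?b K"] Suc.prems by auto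
  have pb: "\<phi>s ?b \<in> carrier_mat 1 (rdim V ?b)" using ps(3) by simp
  obtain \<psi> where \<psi>: "\<psi> \<in> carrier_mat 1 (rdim V (Suc ?b))" "\<forall>u\<in>K. \<psi> * u = 0\<^sub>m 1 1"
    "tail Q ?b = ?b \<Longrightarrow> \<psi> * rmap V ?b = \<phi>s ?b" "tail Q ?b \<noteq> ?b \<Longrightarrow> \<phi>s ?b * rmap V ?b = \<psi>"
  proof (cases rule: arc_cases[OF e])
    case 1
    have "\<exists>\<psi>\<in>carrier_mat 1 (rdim V (Suc ?b)). \<psi> * rmap V ?b = \<phi>s ?b \<and> (\<forall>u\<in>K. \<psi> * u = 0\<^sub>m 1 1)"
      using functional_factor[of "rmap V ?b" "rdim V (Suc ?b)" "rdim V ?b" K "\<phi>s ?b"] pb ps(2) 1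
        is_rep_dims(1)[OF Suc.prems(1) e] Suc.prems(4) by (simp add: pull_back_def)
    then show ?thesis using that 1 by auto
  next
    case 2
    have d: "dim_row (rmap V ?b) = rdim V ?b" "dim_col (rmap V ?b) = rdim V (Suc ?b)"
      using is_rep_dims[OF Suc.prems(1) e] 2 by auto
    have "\<phi>s ?b * rmap V ?b * u = 0\<^sub>m 1 1" if u: "u \<in> K" for u
    proof -
      have "dim_row u = rdim V (Suc ?b)" using u Suc.prems(4) by (auto simp: col_subspace_def)
      then have "\<phi>s ?b * rmap V ?b * u = \<phi>s ?b * (rmap V ?b * u)" using d pb by (intro mat_assoc) auto
      also have "rmap V ?b * u \<in> pull_back V ?b K" using u 2 by (simp add: pull_back_def)
      then have "\<phi>s ?b * (rmap V ?b * u) = 0\<^sub>m 1 1" using ps(2) by blast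
      finally show ?thesis .
    qed
    moreover have "\<phi>s ?b * rmap V ?b \<in> carrier_mat 1 (rdim V (Suc ?b))" using d pb by (intro carrier_matI) auto
    ultimately show ?thesis using that[of "\<phi>s ?b * rmap V ?b"] 2 by simp
  qed
  have neq: "tail Q e \<noteq> Suc ?b" "head Q e \<noteq> Suc ?b" if "e \<in> {a..<?b}" for e
  proof -
    have "e \<in> arcs Q" using that Suc.prems by (simp add: arcs_Q)
    then show "tail Q e \<noteq> Suc ?b" "head Q e \<noteq> Suc ?b" using that by (cases rule: arc_cases; simp)+
  qed
  have "(\<phi>s(Suc ?b := \<psi>)) (head Q e) * rmap V e = (\<phi>s(Suc ?b := \<psi>)) (tail Q e)" if "e \<in> {a..<a + Suc k}" for e
  proof (cases "e = ?b")
    case True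
    show ?thesis unfolding True using \<psi>(3,4) by (cases rule: arc_cases[OF e]) simp_all
  next
    case False
    then have "e \<in> {a..<?b}" using that by auto
    then show ?thesis using neq ps(4) by simp
  qed
  moreover have "\<forall>v\<in>{a..a + Suc k}. (\<phi>s(Suc ?b := \<psi>)) v \<in> carrier_mat 1 (rdim V v)"
    using ps(3) \<psi>(1) by auto
  ultimately show ?case using ps(1) \<psi>(2)
    by (intro exI[of _ "\<phi>s(Suc ?b := \<psi>)"]) simp
qed

text \<open>The vector \<open>x\<close> spreads to the right inside the interval and a functional
  separating it from the pull-back of \<open>K\<close> spreads dually; their pairing at
  \<open>a\<close> is 1. The hypotheses on \<open>D\<close> and \<open>K\<close> are the boundary
  conditions at \<open>b\<close>: an outgoing arrow kills the vector, and an incoming one lands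
  where the functional vanishes. To the left of \<open>a\<close> the representation is zero.\<close>

lemma retract_from_gap:
  assumes V: "is_rep Q V" and a: "1 \<le> a" and b: "b = a + k" "b \<le> m"
    and low: "\<And>v. v \<in> verts Q \<Longrightarrow> v < a \<Longrightarrow> rdim V v = 0"
    and D: "D \<subseteq> carrier_mat (rdim V b) 1" and K: "col_subspace (rdim V b) K"
    and x: "x \<in> pull_back_to V a k D" "x \<notin> pull_back_to V a k K"
    and right: "\<And>y. b < m \<Longrightarrow> tail Q b = b \<Longrightarrow> y \<in> D \<Longrightarrow> rmap V b * y = 0\<^sub>m (rdim V (Suc b)) 1"
    and left: "\<And>y. b < m \<Longrightarrow> head Q b = b \<Longrightarrow> y \<in> carrier_mat (rdim V (Suc b)) 1 \<Longrightarrow> rmap V b * y \<in> K"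
  shows "retract Q (I a b) V"
proof -
  obtain xs where xs: "xs a = x" "xs b \<in> D" "\<And>v. v \<in> {a..b} \<Longrightarrow> xs v \<in> carrier_mat (rdim V v) 1"
    "\<And>e. e \<in> {a..<b} \<Longrightarrow> rmap V e * xs (tail Q e) = xs (head Q e)"
    using pull_back_to_chain[OF V a, of k D x] b D x(1) by auto
  have xc: "x \<in> carrier_mat (rdim V a) 1" using xs(3)[of a] xs(1) b by simp
  have "col_subspace (rdim V a) (pull_back_to V a k K)"
    using pull_back_to_subspace[OF V a] b K by simp
  then obtain \<phi> where \<phi>: "\<phi> \<in> carrier_mat 1 (rdim V a)" "\<phi> * x = 1\<^sub>m 1"
    "\<And>u. u \<in> pull_back_to V a k K \<Longrightarrow> \<phi> * u = 0\<^sub>m 1 1"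
    using col_subspace_separate[OF _ xc x(2)] by blast
  obtain \<phi>s where ps: "\<phi>s a = \<phi>" "\<And>u. u \<in> K \<Longrightarrow> \<phi>s b * u = 0\<^sub>m 1 1"
    "\<And>v. v \<in> {a..b} \<Longrightarrow> \<phi>s v \<in> carrier_mat 1 (rdim V v)"
    "\<And>e. e \<in> {a..<b} \<Longrightarrow> \<phi>s (head Q e) * rmap V e = \<phi>s (tail Q e)"
    using pull_back_to_functional[OF V a _ _ \<phi>(1), of k K] \<phi>(3) b K by auto
  have ins: "e \<in> {a..<b}" if "e \<in> arcs Q" "tail Q e \<in> {a..b}" "head Q e \<in> {a..b}" for e
    using that by (cases rule: arc_cases[OF that(1)]) auto
  have f: "is_hom Q (I a b) V (\<lambda>v. if v \<in> {a..b} then xs v else 0\<^sub>m (rdim V v) 0)"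
  proof (rule hom_from_intervalI[OF V xs(3)])
    fix e assume e: "e \<in> arcs Q" "tail Q e \<in> {a..b}" "head Q e \<notin> {a..b}"
    have d: "rmap V e * xs (tail Q e) \<in> carrier_mat (rdim V (head Q e)) 1"
      using is_rep_dims[OF V e(1)] xs(3)[OF e(2)] by (auto intro!: carrier_matI)
    show "rmap V e * xs (tail Q e) = 0\<^sub>m (rdim V (head Q e)) 1"
    proof (cases rule: arc_cases[OF e(1)])
      case 1
      then have "e = b" using e by auto
      then show ?thesis using right[of "xs b"] xs(2) 1 e(1) by (simp add: arcs_Q)
    next
      case 2
      then have "head Q e < a" using e by auto
      then have "rdim V (head Q e) = 0" using low e(1) by simp
      then show ?thesis using d by (auto intro!: eq_matI)
    qed
  qed (use xs(4) ins in auto)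
  have g: "is_hom Q V (I a b) (\<lambda>v. if v \<in> {a..b} then \<phi>s v else 0\<^sub>m 0 (rdim V v))"
  proof (rule hom_to_intervalI[OF V ps(3)])
    fix e assume e: "e \<in> arcs Q" "head Q e \<in> {a..b}" "tail Q e \<notin> {a..b}"
    have d: "\<phi>s (head Q e) * rmap V e \<in> carrier_mat 1 (rdim V (tail Q e))"
      using is_rep_dims[OF V e(1)] ps(3)[OF e(2)] by (auto intro!: carrier_matI)
    show "\<phi>s (head Q e) * rmap V e = 0\<^sub>m 1 (rdim V (tail Q e))"
    proof (cases rule: arc_cases[OF e(1)])
      case 2
      then have eb: "e = b" using e by auto
      have bm: "b < m" using e eb by (simp add: arcs_Q)
      show ?thesis
      proof (rule row_eq_zero[OF d])
        fix y :: "'a mat" assume y: "y \<in> carrier_mat (rdim V (tail Q e)) 1"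
        have "\<phi>s b * rmap V b * y = \<phi>s b * (rmap V b * y)"
          using y eb 2 ps(3)[of b] is_rep_dims[OF V e(1)] b by (intro mat_assoc) auto
        also have "\<dots> = 0\<^sub>m 1 1"
          using ps(2) left[OF bm, of y] y 2 eb by simp
        finally show "\<phi>s (head Q e) * rmap V e * y = 0\<^sub>m 1 1" using 2 eb by simp
      qed
    next
      case 1
      then have "tail Q e < a" using e by auto
      then have "rdim V (tail Q e) = 0" using low e(1) by simp
      then show ?thesis using d by (auto intro!: eq_matI)
    qed
  qed (use ps(4) ins in auto)
  have aab: "a \<in> {a..b}" using b by simp
  have "(if a \<in> {a..b} then \<phi>s a else 0\<^sub>m 0 (rdim V a)) * (if a \<in> {a..b} then xs a else 0\<^sub>m (rdim V a) 0) \<noteq> 0\<^sub>m 1 1"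
    using aab xs(1) ps(1) \<phi>(2) by (auto dest!: arg_cong[of _ _ "\<lambda>M. M $$ (0,0)"])
  then show ?thesis
    using retract_intervalI[OF f g V a b(2) aab] by blast
qed

text \<open>By contradiction: as long as no interval starting at \<open>a\<close> splits off, the
  pull-backs of 0 and of the full space stay different, up to the last vertex, where their
  difference itself yields an interval.\<close>

lemma nonzero_has_interval_retract:
  assumes V: "is_rep Q V" and nz: "\<not> rep_is_zero Q V"
  shows "\<exists>a b. 1 \<le> a \<and> a \<le> b \<and> b \<le> m \<and> retract Q (I a b) V"
proof (rule ccontr)
  assume contra: "\<not> ?thesis"
  define a where "a = (LEAST v. v \<in> verts Q \<and> rdim V v \<noteq> 0)"
  have "\<exists>v. v \<in> verts Q \<and> rdim V v \<noteq> 0" using nz by (auto simp: rep_is_zero_def)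
  then have "a \<in> verts Q \<and> rdim V a \<noteq> 0" unfolding a_def by (rule LeastI_ex)
  then have a: "1 \<le> a" "a \<le> m" "rdim V a \<noteq> 0" by (auto simp: verts_Q)
  have low: "rdim V v = 0" if "v \<in> verts Q" "v < a" for v
    using not_less_Least[of v "\<lambda>v. v \<in> verts Q \<and> rdim V v \<noteq> 0"] that by (auto simp: a_def)
  define C where "C = (\<lambda>v. carrier_mat (rdim V v) 1 :: 'a mat set)"
  have C: "col_subspace (rdim V v) (C v)" for v by (auto simp: col_subspace_def C_def)
  have Z: "col_subspace (rdim V v) {0\<^sub>m (rdim V v) 1}" for v
    by (auto simp: col_subspace_def mat_add_zero_left)
  have gap: "pull_back_to V a k {0\<^sub>m (rdim V (a + k)) 1} \<noteq> pull_back_to V a k (C (a + k))"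
    if "a + k \<le> m" for k
    using that
  proof (induction k)
    case 0
    have "mat (rdim V a) 1 (\<lambda>_. 1) \<in> C a" by (simp add: C_def)
    moreover have "mat (rdim V a) 1 (\<lambda>_. 1) \<noteq> (0\<^sub>m (rdim V a) 1 :: 'a mat)"
      using a(3) by (auto dest!: arg_cong[of _ _ "\<lambda>M. M $$ (0,0)"])
    ultimately have "C a \<noteq> {0\<^sub>m (rdim V a) 1}" by blast
    then show ?case by auto
  next
    case (Suc k)
    let ?b = "a + k"
    have e: "?b \<in> arcs Q" "?b < m" using Suc.prems a by (auto simp: arcs_Q)
    have no: "\<not> retract Q (I a ?b) V" using contra a e(2) by auto
    have IH: "pull_back_to V a k {0\<^sub>m (rdim V ?b) 1} \<noteq> pull_back_to V a k (C ?b)" using Suc by simp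
    show ?case
    proof (cases rule: arc_cases[OF e(1)])
      case 1
      \<comment> \<open>An arrow to the right leaves the full space full and replaces 0 by its
        kernel. A vector that enters the pull-back in this way would split off the interval ending
        here, since the arrow kills its end.\<close>
      let ?X = "{y \<in> C ?b. rmap V ?b * y = 0\<^sub>m (rdim V (Suc ?b)) 1}"
      have d: "dim_row (rmap V ?b) = rdim V (Suc ?b)" "dim_col (rmap V ?b) = rdim V ?b"
        using is_rep_dims[OF V e(1)] 1 by auto
      have "pull_back V ?b (C (Suc ?b)) = C ?b"
        using 1 d by (auto simp: pull_back_def C_def intro!: carrier_matI)
      moreover have "pull_back V ?b {0\<^sub>m (rdim V (Suc ?b)) 1} = ?X"
        using 1 by (auto simp: pull_back_def C_def)
      moreover have "pull_back_to V a k ?X \<subseteq> pull_back_to V a k {0\<^sub>m (rdim V ?b) 1}"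
      proof (rule subsetI, rule ccontr)
        fix x assume x: "x \<in> pull_back_to V a k ?X" "x \<notin> pull_back_to V a k {0\<^sub>m (rdim V ?b) 1}"
        have "retract Q (I a ?b) V"
          by (rule retract_from_gap[OF V a(1) refl _ low _ Z x]) (use e 1 in \<open>auto simp: C_def\<close>)
        with no show False by simp
      qed
      moreover have "0\<^sub>m (rdim V ?b) 1 \<in> ?X" using d by (auto simp: C_def mat_zero_right)
      then have "pull_back_to V a k {0\<^sub>m (rdim V ?b) 1} \<subseteq> pull_back_to V a k ?X"
        by (intro pull_back_to_mono) simp
      ultimately show ?thesis using IH by simp
    next
      case 2
      \<comment> \<open>An arrow to the left leaves 0 alone and replaces the full space by its
        image. A vector lost in this way would split off the interval ending here, with a functional
        vanishing on the image.\<close>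
      let ?X = "(\<lambda>y. rmap V ?b * y) ` C (Suc ?b)"
      have d: "dim_row (rmap V ?b) = rdim V ?b" "dim_col (rmap V ?b) = rdim V (Suc ?b)"
        using is_rep_dims[OF V e(1)] 2 by auto
      have XX: "pull_back V ?b (C (Suc ?b)) = ?X"
        using 2 by (auto simp: pull_back_def C_def)
      have "pull_back V ?b {0\<^sub>m (rdim V (Suc ?b)) 1} = {0\<^sub>m (rdim V ?b) 1}"
        using 2 d by (auto simp: pull_back_def mat_zero_right)
      moreover have "pull_back_to V a k (C ?b) \<subseteq> pull_back_to V a k ?X"
      proof (rule subsetI, rule ccontr)
        fix x assume x: "x \<in> pull_back_to V a k (C ?b)" "x \<notin> pull_back_to V a k ?X"
        have X: "col_subspace (rdim V ?b) ?X"
          using pull_back_subspace[OF V e(1) C] unfolding XX .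
        have "retract Q (I a ?b) V"
          by (rule retract_from_gap[OF V a(1) refl _ low _ X x]) (use e 2 in \<open>auto simp: C_def\<close>)
        with no show False by simp
      qed
      moreover have "?X \<subseteq> C ?b" using d by (auto simp: C_def intro!: carrier_matI)
      then have "pull_back_to V a k ?X \<subseteq> pull_back_to V a k (C ?b)" by (rule pull_back_to_mono)
      ultimately show ?thesis using IH XX by simp
    qed
  qed
  define k where "k = m - a"
  have k: "m = a + k" using a by (simp add: k_def)
  have "0\<^sub>m (rdim V m) 1 \<in> C m" by (simp add: C_def)
  then have "pull_back_to V a k {0\<^sub>m (rdim V m) 1} \<subseteq> pull_back_to V a k (C m)"
    by (intro pull_back_to_mono) simp
  then obtain x where x: "x \<in> pull_back_to V a k (C m)" "x \<notin> pull_back_to V a k {0\<^sub>m (rdim V m) 1}"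
    using gap[of k] k by auto
  \<comment> \<open>No arrow leads beyond \<open>m\<close>, so both boundary conditions are
    void.\<close>
  have "retract Q (I a m) V"
    by (rule retract_from_gap[OF V a(1) k _ low _ Z x]) (auto simp: C_def)
  then show False using contra a by blast
qed

end

section \<open>Indecomposables and sums of intervals\<close>

context dynkin
begin

lemma not_retract_zero:
  assumes ab: "1 \<le> a" "a \<le> b" "b \<le> m" and V: "rep_is_zero Q V"
  shows "\<not> retract Q (I a b) (V :: (nat, nat, 'k::field) quiver_rep)"
proof
  assume "retract Q (I a b) V"
  then obtain f g where fg: "is_hom Q (I a b) V f" "is_hom Q V (I a b) g"
    "\<And>v. v \<in> verts Q \<Longrightarrow> g v * f v = 1\<^sub>m (rdim (I a b :: (nat, nat, 'k) quiver_rep) v)"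
    unfolding retract_def by blast
  have a: "a \<in> verts Q" using ab by (auto simp: verts_Q)
  have "(g a * f a) $$ (0,0) = 0"
    using is_hom_dims[OF fg(1) a] is_hom_dims[OF fg(2) a] V a ab
    by (simp add: rep_is_zero_def rdim_interval scalar_prod_def)
  then show False using fg(3)[OF a] ab by (simp add: rdim_interval)
qed

lemma rep_iso_interval_of_zero_summand:
  assumes V: "is_rep Q V" and B: "is_rep Q B" and z: "rep_is_zero Q B"
    and b: "biproduct Q V (I a b) B i p j q"
  shows "rep_iso Q V (I a b)"
proof -
  have "i v * p v = 1\<^sub>m (rdim V v)" if v: "v \<in> verts Q" for v
  proof -
    note h = biproduct_homs[OF b, THEN is_hom_dims(2), OF v] biproduct_homs[OF b, THEN is_hom_dims(3), OF v]
    have "j v * q v = 0\<^sub>m (rdim V v) (rdim V v)"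
      using h z v by (intro eq_matI) (auto simp: rep_is_zero_def scalar_prod_def)
    moreover have "i v * p v + j v * q v = 1\<^sub>m (rdim V v)" using b v by (auto simp: biproduct_def)
    ultimately show ?thesis using h by (simp add: mat_add_zero_right)
  qed
  then show ?thesis using b unfolding rep_iso_def biproduct_def by blast
qed

lemma indecomposable_cong:
  assumes V: "is_rep Q V" and W: "is_rep Q W" and iso: "rep_iso Q V W" and ind: "indecomposable Q W"
  shows "indecomposable Q V"
  unfolding indecomposable_def
proof (intro conjI allI impI)
  show "\<not> rep_is_zero Q V"
    using ind rep_iso_rdim[OF iso] by (auto simp: indecomposable_def rep_is_zero_def)
  fix A B assume AB: "is_rep Q A \<and> is_rep Q B \<and> rep_iso Q V (rep_plus A B)"
  then have "rep_iso Q W (rep_plus A B)"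
    using rep_iso_trans[OF W V is_rep_plus rep_iso_sym[OF iso]] by blast
  then show "rep_is_zero Q A \<or> rep_is_zero Q B" using ind AB by (auto simp: indecomposable_def)
qed (rule V)

text \<open>The interval is a retract of one of the two summands; counting dimensions leaves nothing
  for the other.\<close>

lemma indecomposable_interval:
  assumes ab: "1 \<le> a" "a \<le> b" "b \<le> m"
  shows "indecomposable Q (I a b :: (nat, nat, 'k::field) quiver_rep)"
  unfolding indecomposable_def
proof (intro conjI allI impI)
  let ?I = "I a b :: (nat, nat, 'k) quiver_rep"
  show "is_rep Q ?I" by (rule is_rep_interval)
  show "\<not> rep_is_zero Q ?I"
    using ab by (auto simp: rep_is_zero_def rdim_interval verts_Q intro!: bexI[of _ a])
  fix A B :: "(nat, nat, 'k) quiver_rep"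
  assume AB: "is_rep Q A \<and> is_rep Q B \<and> rep_iso Q ?I (rep_plus A B)"
  have dim: "rdim ?I v = rdim A v + rdim B v" if "v \<in> verts Q" for v
    using rep_iso_rdim[of ?I "rep_plus A B" v] AB that by simp
  have zero: "rep_is_zero Q Y" if r: "retract Q ?I X" and X: "is_rep Q X"
    and d: "\<And>v. v \<in> verts Q \<Longrightarrow> rdim ?I v = rdim X v + rdim Y v" for X Y :: "(nat, nat, 'k) quiver_rep"
  proof -
    obtain C where "rep_iso Q X (rep_plus ?I C)"
      using retract_iff_summand[OF is_rep_interval X rdim_interval_le] r by blast
    then have "rdim X v \<ge> rdim ?I v" if "v \<in> verts Q" for v
      using rep_iso_rdim[of X "rep_plus ?I C" v] that by simp
    then show ?thesis using d by (fastforce simp: rep_is_zero_def)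
  qed
  have "retract Q ?I (rep_plus A B)" using AB rep_iso_retract by blast
  then have "retract Q ?I A \<or> retract Q ?I B" using retract_interval_plus AB ab by blast
  then show "rep_is_zero Q A \<or> rep_is_zero Q B"
    using zero[of A B] zero[of B A] AB dim by (auto simp: add.commute)
qed

lemma indecomposable_imp_interval:
  assumes "indecomposable Q (V :: (nat, nat, 'k::field) quiver_rep)"
  shows "\<exists>a b. 1 \<le> a \<and> a \<le> b \<and> b \<le> m \<and> rep_iso Q V (I a b)"
proof -
  have V: "is_rep Q V" "\<not> rep_is_zero Q V" using assms by (auto simp: indecomposable_def)
  obtain a b where ab: "1 \<le> a" "a \<le> b" "b \<le> m" and r: "retract Q (I a b) V"
    using nonzero_has_interval_retract[OF V] by blast
  let ?I = "I a b :: (nat, nat, 'k) quiver_rep"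
  obtain B where B: "is_rep Q B" "rep_iso Q V (rep_plus ?I B)"
    using retract_iff_summand[OF is_rep_interval V(1) rdim_interval_le] r by blast
  have "\<not> rep_is_zero Q ?I" using indecomposable_interval[OF ab] by (auto simp: indecomposable_def)
  then have z: "rep_is_zero Q B" using assms B is_rep_interval by (auto simp: indecomposable_def)
  obtain i p j q where "biproduct Q V ?I B i p j q"
    using rep_iso_plus_iff[OF V(1) is_rep_interval B(1)] B(2) by blast
  then have "rep_iso Q V ?I" by (rule rep_iso_interval_of_zero_summand[OF V(1) B(1) z])
  then show ?thesis using ab by blast
qed

lemma indec_summand_interval_iff:
  assumes ab: "1 \<le> a" "a \<le> b" "b \<le> m" and V: "is_rep Q V"
  shows "indec_summand Q (I a b) V \<longleftrightarrow> retract Q (I a b) V"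
  using retract_iff_summand[OF is_rep_interval V rdim_interval_le] indecomposable_interval[OF ab]
  by (auto simp: indec_summand_def)

text \<open>Replaces arbitrary indecomposable summands by pairs \<open>(a, b)\<close>; the
  representation \<open>M\<close> itself matters only up to isomorphism.\<close>

lemma indec_summand_iff:
  assumes V: "is_rep Q (V :: (nat, nat, 'k::field) quiver_rep)"
  shows "indec_summand Q M V \<longleftrightarrow>
    is_rep Q M \<and> (\<exists>a b. 1 \<le> a \<and> a \<le> b \<and> b \<le> m \<and> rep_iso Q M (I a b) \<and> retract Q (I a b) V)"
proof
  assume s: "indec_summand Q M V"
  then have M: "is_rep Q M" "indecomposable Q M" by (auto simp: indec_summand_def indecomposable_def)
  obtain a b where ab: "1 \<le> a" "a \<le> b" "b \<le> m" "rep_iso Q M (I a b)"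
    using indecomposable_imp_interval[OF M(2)] by blast
  obtain B where B: "is_rep Q B" "rep_iso Q V (rep_plus M B)" using s by (auto simp: indec_summand_def)
  have "retract Q (I a b) M" using rep_iso_retract[OF rep_iso_sym[OF ab(4)]] .
  moreover have "retract Q M V"
    using retract_trans[OF M(1) is_rep_plus[OF M(1) B(1)] V retract_plus_left[OF M(1) B(1)]]
      rep_iso_retract[OF rep_iso_sym[OF B(2)]] by blast
  ultimately have "retract Q (I a b) V" using retract_trans[OF is_rep_interval M(1) V] by blast
  then show "is_rep Q M \<and> (\<exists>a b. 1 \<le> a \<and> a \<le> b \<and> b \<le> m \<and> rep_iso Q M (I a b) \<and> retract Q (I a b) V)"
    using M ab by blast
next
  assume "is_rep Q M \<and> (\<exists>a b. 1 \<le> a \<and> a \<le> b \<and> b \<le> m \<and> rep_iso Q M (I a b) \<and> retract Q (I a b) V)"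
  then obtain a b where M: "is_rep Q M" and ab: "1 \<le> a" "a \<le> b" "b \<le> m"
    and iso: "rep_iso Q M (I a b)" and r: "retract Q (I a b) V" by blast
  obtain B where B: "is_rep Q B" "rep_iso Q V (rep_plus (I a b) B)"
    using retract_iff_summand[OF is_rep_interval V rdim_interval_le] r by blast
  have "rep_iso Q (rep_plus (I a b) B) (rep_plus M B)"
    by (rule rep_iso_plus_cong[OF is_rep_interval B(1) M B(1) rep_iso_sym[OF iso] rep_iso_refl[OF B(1)]])
  then have "rep_iso Q V (rep_plus M B)"
    using rep_iso_trans[OF V is_rep_plus[OF is_rep_interval B(1)] is_rep_plus[OF M B(1)] B(2)] by blast
  then show "indec_summand Q M V"
    using indecomposable_cong[OF M is_rep_interval iso indecomposable_interval[OF ab]] B(1)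
    by (auto simp: indec_summand_def)
qed

lemma no_repeated_summand_iff:
  assumes V: "is_rep Q (V :: (nat, nat, 'k::field) quiver_rep)"
  shows "(\<forall>A B. indecomposable Q A \<and> is_rep Q B \<longrightarrow> \<not> rep_iso Q V (rep_plus A (rep_plus A B))) \<longleftrightarrow>
    (\<forall>a b. 1 \<le> a \<longrightarrow> a \<le> b \<longrightarrow> b \<le> m \<longrightarrow> \<not> double_retract Q (I a b) V)"
proof (intro iffI allI impI notI)
  fix a b assume "\<forall>A B. indecomposable Q A \<and> is_rep Q B \<longrightarrow> \<not> rep_iso Q V (rep_plus A (rep_plus A B))"
    and "1 \<le> a" "a \<le> b" "b \<le> m" "double_retract Q (I a b) V"
  then show False
    using double_retract_iff_summand[OF is_rep_interval V rdim_interval_le] indecomposable_interval by blast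
next
  fix A B assume no: "\<forall>a b. 1 \<le> a \<longrightarrow> a \<le> b \<longrightarrow> b \<le> m \<longrightarrow> \<not> double_retract Q (I a b) V"
    and A: "indecomposable Q A \<and> is_rep Q B" and iso: "rep_iso Q V (rep_plus A (rep_plus A B))"
  then have rep: "is_rep Q A" "is_rep Q B" by (auto simp: indecomposable_def)
  note AB = is_rep_plus[OF rep]
  obtain a b where ab: "1 \<le> a" "a \<le> b" "b \<le> m" "rep_iso Q A (I a b)"
    using indecomposable_imp_interval A by blast
  have 1: "retract Q (I a b) A" using rep_iso_retract[OF rep_iso_sym[OF ab(4)]] .
  have 2: "retract Q (I a b) (rep_plus A B)"
    by (rule retract_trans[OF is_rep_interval rep(1) AB 1 retract_plus_left[OF rep]])
  have "double_retract Q (I a b) V"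
    by (rule double_retract_trans[OF is_rep_interval is_rep_plus[OF rep(1) AB] V
        double_retract_plus[OF is_rep_interval rep(1) AB 1 2] rep_iso_retract[OF rep_iso_sym[OF iso]]])
  then show False using no ab by blast
qed

section \<open>Direct sums of intervals and their uniqueness\<close>

definition interval_sum :: "(nat \<times> nat) list \<Rightarrow> (nat, nat, 'k::field) quiver_rep" where
  "interval_sum L = rep_sum (map (\<lambda>(a, b). I a b) L)"

lemma is_rep_interval_sum: "is_rep Q (interval_sum L)"
  unfolding interval_sum_def by (rule is_rep_sum) (auto simp: is_rep_interval)

lemma interval_sum_Cons: "interval_sum ((a, b) # L) = rep_plus (I a b) (interval_sum L)"
  by (simp add: interval_sum_def)

lemma retract_interval_sum_iff:
  assumes "1 \<le> a" "a \<le> b" "b \<le> m" "\<And>c d. (c, d) \<in> set L \<Longrightarrow> 1 \<le> c \<and> c \<le> d \<and> d \<le> m"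
  shows "retract Q (I a b) (interval_sum L :: (nat, nat, 'k::field) quiver_rep) \<longleftrightarrow> (a, b) \<in> set L"
  using assms
proof (induction L)
  case Nil
  have "rep_is_zero Q (interval_sum [] :: (nat, nat, 'k) quiver_rep)"
    by (simp add: interval_sum_def rep_is_zero_def zero_rep_def)
  then show ?case using not_retract_zero[OF Nil(1-3)] by simp
next
  case (Cons x L)
  obtain c d where x: "x = (c, d)" by (cases x)
  have cd: "1 \<le> c" "c \<le> d" "d \<le> m" using Cons.prems(4) x by auto
  have sub: "1 \<le> c \<and> c \<le> d \<and> d \<le> m" if "(c, d) \<in> set L" for c d
    by (rule Cons.prems(4)) (simp add: that)
  have IH: "retract Q (I a b) (interval_sum L :: (nat, nat, 'k) quiver_rep) \<longleftrightarrow> (a, b) \<in> set L"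
    by (rule Cons.IH[OF Cons.prems(1-3) sub])
  let ?I = "I a b :: (nat, nat, 'k) quiver_rep" and ?S = "interval_sum L :: (nat, nat, 'k) quiver_rep"
  note pl = is_rep_plus[OF is_rep_interval is_rep_interval_sum]
  show ?case unfolding x interval_sum_Cons
  proof
    assume "retract Q ?I (rep_plus (I c d) ?S)"
    then have "retract Q ?I (I c d) \<or> retract Q ?I ?S"
      using retract_interval_plus[OF is_rep_interval is_rep_interval_sum Cons.prems(1-3)] by blast
    then show "(a, b) \<in> set ((c, d) # L)"
      using retract_interval_eq[OF Cons.prems(1-3) cd] IH by auto
  next
    assume "(a, b) \<in> set ((c, d) # L)"
    then consider "a = c" "b = d" | "(a, b) \<in> set L" by auto
    then show "retract Q ?I (rep_plus (I c d) ?S)"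
    proof cases
      case 1
      then show ?thesis using retract_plus_left[OF is_rep_interval is_rep_interval_sum] by simp
    next
      case 2
      then show ?thesis
        using IH retract_trans[OF is_rep_interval is_rep_interval_sum pl _ retract_plus_right[OF is_rep_interval is_rep_interval_sum]]
        by blast
    qed
  qed
qed

text \<open>Since the list is distinct, the interval can come either from the head or from the tail
  but not from both, and the other part contributes only zero composites.\<close>

lemma not_double_retract_interval_sum:
  assumes "1 \<le> a" "a \<le> b" "b \<le> m" "\<And>c d. (c, d) \<in> set L \<Longrightarrow> 1 \<le> c \<and> c \<le> d \<and> d \<le> m" "distinct L"
  shows "\<not> double_retract Q (I a b) (interval_sum L :: (nat, nat, 'k::field) quiver_rep)"
  using assms
proof (induction L)
  case Nil
  have "rep_is_zero Q (interval_sum [] :: (nat, nat, 'k) quiver_rep)"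
    by (simp add: interval_sum_def rep_is_zero_def zero_rep_def)
  then show ?case using not_retract_zero[OF Nil(1-3)] double_retract_imp_retract by blast
next
  case (Cons x L)
  obtain c d where x: "x = (c, d)" by (cases x)
  have cd: "1 \<le> c" "c \<le> d" "d \<le> m" using Cons.prems(4) x by auto
  let ?I = "I a b :: (nat, nat, 'k) quiver_rep" and ?S = "interval_sum L :: (nat, nat, 'k) quiver_rep"
    and ?J = "I c d :: (nat, nat, 'k) quiver_rep"
  have sub: "1 \<le> c \<and> c \<le> d \<and> d \<le> m" if "(c, d) \<in> set L" for c d
    by (rule Cons.prems(4)) (simp add: that)
  have IH: "\<not> double_retract Q ?I ?S" using Cons.IH[OF Cons.prems(1-3) sub] Cons.prems(5) by simp
  have iff: "retract Q ?I ?S \<longleftrightarrow> (a, b) \<in> set L"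
    by (rule retract_interval_sum_iff[OF Cons.prems(1-3) sub])
  show ?case unfolding x interval_sum_Cons
  proof
    assume d: "double_retract Q ?I (rep_plus ?J ?S)"
    show False
    proof (cases "(a, b) \<in> set L")
      case True
      then have "(a, b) \<noteq> (c, d)" using Cons.prems(5) x by auto
      then have n: "\<not> retract Q ?I ?J" using retract_interval_eq[OF Cons.prems(1-3) cd] by blast
      \<comment> \<open>The summands are exchanged because
        \<open>double_retract_interval_plus\<close> discards the second one.\<close>
      have "double_retract Q ?I (rep_plus ?S ?J)"
        by (rule double_retract_trans[OF is_rep_interval is_rep_plus[OF is_rep_interval is_rep_interval_sum]
          is_rep_plus[OF is_rep_interval_sum is_rep_interval] d
          rep_iso_retract[OF rep_plus_comm[OF is_rep_interval is_rep_interval_sum]]])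
      then show False
        using double_retract_interval_plus[OF is_rep_interval_sum is_rep_interval Cons.prems(1-3) _ n] IH by blast
    next
      case False
      then have dd: "double_retract Q ?I ?J"
        using double_retract_interval_plus[OF is_rep_interval is_rep_interval_sum Cons.prems(1-3) d] iff by blast
      then have "a = c \<and> b = d"
        using retract_interval_eq[OF Cons.prems(1-3) cd] double_retract_imp_retract by blast
      then show False using not_double_retract_interval[OF Cons.prems(1-3)] dd by metis
    qed
  qed
qed

text \<open>The intervals of \<open>L\<close> are split off one at a time. The exclusion of double
  retracts ensures that the complement no longer contains the interval just removed. When the list
  is exhausted, the remainder has no interval retract and is therefore zero.\<close>

lemma rep_iso_interval_sum:
  assumes "is_rep Q (T :: (nat, nat, 'k::field) quiver_rep)" "distinct L"
    "\<And>c d. (c, d) \<in> set L \<Longrightarrow> 1 \<le> c \<and> c \<le> d \<and> d \<le> m"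
    "\<And>a b. 1 \<le> a \<Longrightarrow> a \<le> b \<Longrightarrow> b \<le> m \<Longrightarrow> retract Q (I a b) T \<longleftrightarrow> (a, b) \<in> set L"
    "\<And>a b. 1 \<le> a \<Longrightarrow> a \<le> b \<Longrightarrow> b \<le> m \<Longrightarrow> \<not> double_retract Q (I a b) T"
  shows "rep_iso Q T (interval_sum L)"
  using assms
proof (induction L arbitrary: T)
  case Nil
  have "rep_is_zero Q T"
    using nonzero_has_interval_retract[OF Nil(1)] Nil(4) by auto
  moreover have "is_hom Q T (interval_sum []) (\<lambda>v. 0\<^sub>m 0 0)" "is_hom Q (interval_sum []) T (\<lambda>v. 0\<^sub>m 0 0)"
    using calculation is_rep_dims[OF Nil(1)]
    by (auto simp: is_hom_def interval_sum_def zero_rep_def rep_is_zero_def intro!: eq_matI)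
  ultimately show ?case
    unfolding rep_iso_def
    by (intro exI[of _ "\<lambda>v. 0\<^sub>m 0 0"]) (auto simp: interval_sum_def zero_rep_def rep_is_zero_def intro!: eq_matI)
next
  case (Cons x L)
  obtain c d where x: "x = (c, d)" by (cases x)
  have cd: "1 \<le> c" "c \<le> d" "d \<le> m" using Cons.prems(3) x by auto
  let ?J = "I c d :: (nat, nat, 'k) quiver_rep"
  have "retract Q ?J T" using Cons.prems(4)[OF cd] x by simp
  then obtain T' where T': "is_rep Q T'" "rep_iso Q T (rep_plus ?J T')"
    using retract_iff_summand[OF is_rep_interval Cons.prems(1) rdim_interval_le] by blast
  note JT = is_rep_plus[OF is_rep_interval T'(1)]
  have T'T: "retract Q T' T"
    using retract_trans[OF T'(1) JT Cons.prems(1) retract_plus_right[OF is_rep_interval T'(1)]]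
      rep_iso_retract[OF rep_iso_sym[OF T'(2)]] by blast
  have "rep_iso Q T' (interval_sum L)"
  proof (rule Cons.IH[OF T'(1)])
    show "distinct L" using Cons.prems(2) by simp
    show "1 \<le> c \<and> c \<le> d \<and> d \<le> m" if "(c, d) \<in> set L" for c d
      by (rule Cons.prems(3)) (simp add: that)
    fix a b assume ab: "1 \<le> a" "a \<le> b" "b \<le> m"
    let ?I = "I a b :: (nat, nat, 'k) quiver_rep"
    show "\<not> double_retract Q ?I T'"
      using Cons.prems(5)[OF ab] double_retract_trans[OF is_rep_interval T'(1) Cons.prems(1) _ T'T] by blast
    show "retract Q ?I T' \<longleftrightarrow> (a, b) \<in> set L"
    proof
      assume r: "retract Q ?I T'"
      then have "retract Q ?I T" using retract_trans[OF is_rep_interval T'(1) Cons.prems(1) _ T'T] by blast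
      then have "(a, b) \<in> set (x # L)" using Cons.prems(4)[OF ab] by simp
      moreover have "(a, b) \<noteq> x"
      proof
        assume "(a, b) = x"
        then have "retract Q ?J T'" using r x by simp
        then have "double_retract Q ?J (rep_plus ?J T')"
          by (rule double_retract_plus[OF is_rep_interval is_rep_interval T'(1) retract_refl[OF is_rep_interval]])
        then have "double_retract Q ?J T"
          using double_retract_trans[OF is_rep_interval JT Cons.prems(1) _ rep_iso_retract[OF rep_iso_sym[OF T'(2)]]]
          by blast
        then show False using Cons.prems(5)[OF cd] by simp
      qed
      ultimately show "(a, b) \<in> set L" by simp
    next
      assume i: "(a, b) \<in> set L"
      then have "retract Q ?I T" using Cons.prems(4)[OF ab] by simp
      then have "retract Q ?I (rep_plus ?J T')"
        using retract_trans[OF is_rep_interval Cons.prems(1) JT _ rep_iso_retract[OF T'(2)]] by blast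
      then have "retract Q ?I ?J \<or> retract Q ?I T'"
        by (rule retract_interval_plus[OF is_rep_interval T'(1) ab])
      moreover have "(a, b) \<noteq> (c, d)" using i Cons.prems(2) x by auto
      then have "\<not> retract Q ?I ?J" using retract_interval_eq[OF ab cd] by blast
      ultimately show "retract Q ?I T'" by blast
    qed
  qed
  then have "rep_iso Q (rep_plus ?J T') (rep_plus ?J (interval_sum L))"
    by (rule rep_iso_plus_cong[OF is_rep_interval T'(1) is_rep_interval is_rep_interval_sum rep_iso_refl[OF is_rep_interval]])
  then show ?case unfolding x interval_sum_Cons
    using rep_iso_trans[OF Cons.prems(1) JT is_rep_plus[OF is_rep_interval is_rep_interval_sum] T'(2)] by blast
qed

end

section \<open>Extensions and cocycles\<close>

text \<open>Isolates the linear algebra of a short exact sequence at a single vertex.\<close>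

definition exact_pair :: "'k::field mat \<Rightarrow> 'k mat \<Rightarrow> nat \<Rightarrow> nat \<Rightarrow> nat \<Rightarrow> bool" where
  "exact_pair F H b e a \<longleftrightarrow> mat_kernel F = {0\<^sub>v b} \<and>
     (\<lambda>x. F *\<^sub>v x) ` carrier_vec b = mat_kernel H \<and> (\<lambda>x. H *\<^sub>v x) ` carrier_vec e = carrier_vec a"

lemma mat_kernel_iff:
  "M \<in> carrier_mat r c \<Longrightarrow> x \<in> mat_kernel M \<longleftrightarrow> x \<in> carrier_vec c \<and> M *\<^sub>v x = 0\<^sub>v r"
  by (auto simp: mat_kernel_def)

lemma mat_lift_columns:
  fixes F :: "'k::field mat"
  assumes F: "F \<in> carrier_mat n k" and Y: "Y \<in> carrier_mat n c"
    and im: "\<And>j. j < c \<Longrightarrow> \<exists>x\<in>carrier_vec k. F *\<^sub>v x = col Y j"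
  shows "\<exists>Z\<in>carrier_mat k c. F * Z = Y"
proof -
  obtain z where z: "\<And>j. j < c \<Longrightarrow> z j \<in> carrier_vec k" "\<And>j. j < c \<Longrightarrow> F *\<^sub>v z j = col Y j"
    using im by metis
  define Z where "Z = mat k c (\<lambda>(i,j). z j $ i)"
  have Z: "Z \<in> carrier_mat k c" by (simp add: Z_def)
  have cZ: "col Z j = z j" if "j < c" for j
    using z(1)[OF that] that by (auto simp: Z_def)
  have "F * Z = Y"
  proof (rule eq_matI)
    fix i j assume ij: "i < dim_row Y" "j < dim_col Y"
    then have "(F * Z) $$ (i,j) = (F *\<^sub>v col Z j) $ i" using F Y Z by simp
    also have "\<dots> = Y $$ (i,j)" using ij Y z(2)[of j] cZ[of j] by simp
    finally show "(F * Z) $$ (i,j) = Y $$ (i,j)" .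
  qed (use F Y Z in auto)
  with Z show ?thesis by blast
qed

context
  fixes F H :: "'k::field mat" and b e a :: nat
  assumes F: "F \<in> carrier_mat e b" and H: "H \<in> carrier_mat a e" and ex: "exact_pair F H b e a"
begin

lemma exact_image: "(\<lambda>x. F *\<^sub>v x) ` carrier_vec b = mat_kernel H"
  "(\<lambda>x. H *\<^sub>v x) ` carrier_vec e = carrier_vec a"
  using ex by (simp_all add: exact_pair_def)

lemma exact_section: "\<exists>S\<in>carrier_mat e a. H * S = 1\<^sub>m a"
proof (rule mat_lift_columns[OF H])
  fix j assume "j < a"
  then have "col (1\<^sub>m a) j \<in> (\<lambda>x. H *\<^sub>v x) ` carrier_vec e" unfolding exact_image by simp
  then show "\<exists>x\<in>carrier_vec e. H *\<^sub>v x = col (1\<^sub>m a) j" by auto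
qed simp

lemma exact_lift:
  assumes Y: "Y \<in> carrier_mat e c" and z: "H * Y = 0\<^sub>m a c"
  shows "\<exists>Z\<in>carrier_mat b c. F * Z = Y"
proof (rule mat_lift_columns[OF F Y])
  fix j assume j: "j < c"
  have "H *\<^sub>v col Y j = col (H * Y) j" by (rule col_mult2[OF H Y j, symmetric])
  also have "\<dots> = 0\<^sub>v a" using z j by simp
  finally have "col Y j \<in> mat_kernel H" using H Y j by (intro mat_kernelI) auto
  then have "col Y j \<in> (\<lambda>x. F *\<^sub>v x) ` carrier_vec b" unfolding exact_image .
  then show "\<exists>x\<in>carrier_vec b. F *\<^sub>v x = col Y j" by auto
qed

lemma exact_comp_zero: "H * F = 0\<^sub>m a b"
proof (rule eq_matI)
  fix i j assume ij: "i < dim_row (0\<^sub>m a b :: 'k mat)" "j < dim_col (0\<^sub>m a b :: 'k mat)"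
  have "F *\<^sub>v unit_vec b j \<in> (\<lambda>x. F *\<^sub>v x) ` carrier_vec b" by simp
  then have "F *\<^sub>v unit_vec b j \<in> mat_kernel H" unfolding exact_image .
  moreover have "F *\<^sub>v unit_vec b j = col F j" using F ij by (auto intro!: eq_vecI)
  ultimately have "H *\<^sub>v col F j = 0\<^sub>v a" using H by (auto simp: mat_kernel_def)
  then have "(H *\<^sub>v col F j) $ i = 0" using ij by simp
  then show "(H * F) $$ (i,j) = 0\<^sub>m a b $$ (i,j)" using F H ij by simp
qed (use F H in auto)

lemma exact_transport:
  assumes \<beta>: "\<beta> \<in> carrier_mat b b'" "\<beta>' \<in> carrier_mat b' b" "\<beta>' * \<beta> = 1\<^sub>m b'" "\<beta> * \<beta>' = 1\<^sub>m b"
    and \<alpha>: "\<alpha> \<in> carrier_mat a' a" "\<alpha>' \<in> carrier_mat a a'" "\<alpha>' * \<alpha> = 1\<^sub>m a" "\<alpha> * \<alpha>' = 1\<^sub>m a'"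
  shows "exact_pair (F * \<beta>) (\<alpha> * H) b' e a'"
  unfolding exact_pair_def
proof (intro conjI)
  have \<beta>x: "\<beta>' *\<^sub>v (\<beta> *\<^sub>v x) = x" if "x \<in> carrier_vec b'" for x
    using that assoc_mult_mat_vec[OF \<beta>(2,1) that] \<beta>(3) by simp
  have \<beta>x': "\<beta> *\<^sub>v (\<beta>' *\<^sub>v x) = x" if "x \<in> carrier_vec b" for x
    using that assoc_mult_mat_vec[OF \<beta>(1,2) that] \<beta>(4) by simp
  have \<alpha>x: "\<alpha>' *\<^sub>v (\<alpha> *\<^sub>v x) = x" if "x \<in> carrier_vec a" for x
    using that assoc_mult_mat_vec[OF \<alpha>(2,1) that] \<alpha>(3) by simp
  have \<alpha>x': "\<alpha> *\<^sub>v (\<alpha>' *\<^sub>v x) = x" if "x \<in> carrier_vec a'" for x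
    using that assoc_mult_mat_vec[OF \<alpha>(1,2) that] \<alpha>(4) by simp
  have F\<beta>: "(F * \<beta>) *\<^sub>v x = F *\<^sub>v (\<beta> *\<^sub>v x)" if "x \<in> carrier_vec b'" for x
    by (rule assoc_mult_mat_vec[OF F \<beta>(1) that])
  have \<alpha>H: "(\<alpha> * H) *\<^sub>v x = \<alpha> *\<^sub>v (H *\<^sub>v x)" if "x \<in> carrier_vec e" for x
    by (rule assoc_mult_mat_vec[OF \<alpha>(1) H that])
  have c\<beta>: "\<beta> *\<^sub>v x \<in> carrier_vec b" "\<beta>' *\<^sub>v y \<in> carrier_vec b'" for x y
    using \<beta>(1,2) by (auto intro!: carrier_vecI)
  have c\<alpha>: "\<alpha> *\<^sub>v x \<in> carrier_vec a'" "\<alpha>' *\<^sub>v y \<in> carrier_vec a" for x y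
    using \<alpha>(1,2) by (auto intro!: carrier_vecI)
  have cH: "H *\<^sub>v x \<in> carrier_vec a" for x using H by (auto intro!: carrier_vecI)
  have zero: "M *\<^sub>v 0\<^sub>v c = 0\<^sub>v r" if "M \<in> carrier_mat r c" for M :: "'k mat" and r c
    using that by (auto intro!: eq_vecI)
  have kF: "x = 0\<^sub>v b" if "x \<in> carrier_vec b" "F *\<^sub>v x = 0\<^sub>v e" for x
    using ex that mat_kernel_iff[OF F, of x] by (simp add: exact_pair_def)
  have kH: "mat_kernel (\<alpha> * H) = mat_kernel H"
  proof -
    have eq: "\<alpha> *\<^sub>v (H *\<^sub>v x) = 0\<^sub>v a' \<longleftrightarrow> H *\<^sub>v x = 0\<^sub>v a" for x
    proof
      assume "\<alpha> *\<^sub>v (H *\<^sub>v x) = 0\<^sub>v a'"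
      then have "H *\<^sub>v x = \<alpha>' *\<^sub>v 0\<^sub>v a'" using \<alpha>x[OF cH, of x] by simp
      then show "H *\<^sub>v x = 0\<^sub>v a" by (simp only: zero[OF \<alpha>(2)])
    qed (simp only: zero[OF \<alpha>(1)])
    have "x \<in> mat_kernel (\<alpha> * H) \<longleftrightarrow> x \<in> mat_kernel H" for x
      unfolding mat_kernel_iff[OF H] mat_kernel_iff[OF mult_carrier_mat[OF \<alpha>(1) H]]
      by (rule conj_cong[OF refl]) (simp only: \<alpha>H eq)
    then show ?thesis by blast
  qed
  show "mat_kernel (F * \<beta>) = {0\<^sub>v b'}"
  proof (intro equalityI subsetI)
    fix x assume "x \<in> mat_kernel (F * \<beta>)"
    then have x: "x \<in> carrier_vec b'" "F *\<^sub>v (\<beta> *\<^sub>v x) = 0\<^sub>v e"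
      unfolding mat_kernel_iff[OF mult_carrier_mat[OF F \<beta>(1)]] using F\<beta>[of x] by auto
    then have "\<beta> *\<^sub>v x = 0\<^sub>v b" using kF c\<beta> by blast
    then have "x = \<beta>' *\<^sub>v 0\<^sub>v b" using \<beta>x[OF x(1)] by simp
    then show "x \<in> {0\<^sub>v b'}" using zero[OF \<beta>(2)] by simp
  next
    fix x :: "'k vec" assume "x \<in> {0\<^sub>v b'}"
    then show "x \<in> mat_kernel (F * \<beta>)"
      using zero[OF mult_carrier_mat[OF F \<beta>(1)]] unfolding mat_kernel_iff[OF mult_carrier_mat[OF F \<beta>(1)]] by simp
  qed
  show "(\<lambda>x. F * \<beta> *\<^sub>v x) ` carrier_vec b' = mat_kernel (\<alpha> * H)"
  proof -
    have "(\<lambda>x. F * \<beta> *\<^sub>v x) ` carrier_vec b' = (\<lambda>x. F *\<^sub>v x) ` ((\<lambda>x. \<beta> *\<^sub>v x) ` carrier_vec b')"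
      by (simp add: image_image F\<beta>)
    also have "(\<lambda>x. \<beta> *\<^sub>v x) ` carrier_vec b' = carrier_vec b"
    proof (intro equalityI subsetI)
      fix x :: "'k vec" assume "x \<in> carrier_vec b"
      then show "x \<in> (\<lambda>x. \<beta> *\<^sub>v x) ` carrier_vec b'" using \<beta>x' c\<beta>(2) by (metis image_eqI)
    qed (use c\<beta> in auto)
    finally show ?thesis using ex kH by (simp add: exact_pair_def)
  qed
  show "(\<lambda>x. \<alpha> * H *\<^sub>v x) ` carrier_vec e = carrier_vec a'"
  proof -
    have "(\<lambda>x. \<alpha> * H *\<^sub>v x) ` carrier_vec e = (\<lambda>x. \<alpha> *\<^sub>v x) ` ((\<lambda>x. H *\<^sub>v x) ` carrier_vec e)"
      by (simp add: image_image \<alpha>H)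
    also have "\<dots> = (\<lambda>x. \<alpha> *\<^sub>v x) ` carrier_vec a" using ex by (simp add: exact_pair_def)
    also have "\<dots> = carrier_vec a'"
    proof (intro equalityI subsetI)
      fix x :: "'k vec" assume "x \<in> carrier_vec a'"
      then show "x \<in> (\<lambda>x. \<alpha> *\<^sub>v x) ` carrier_vec a" using \<alpha>x' c\<alpha>(2) by (metis image_eqI)
    qed (use c\<alpha> in auto)
    finally show ?thesis .
  qed
qed

end

text \<open>Serves the sequence with middle term \<open>ext_rep\<close>, which splits at every
  vertex although it need not split as a sequence of representations.\<close>

lemma exact_pair_splitI:
  fixes F H P S :: "'k::field mat"
  assumes F: "F \<in> carrier_mat e b" and H: "H \<in> carrier_mat a e"
    and P: "P \<in> carrier_mat b e" and S: "S \<in> carrier_mat e a"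
    and PF: "P * F = 1\<^sub>m b" and HS: "H * S = 1\<^sub>m a" and HF: "H * F = 0\<^sub>m a b" and sum: "F * P + S * H = 1\<^sub>m e"
  shows "exact_pair F H b e a"
proof -
  have c: "F *\<^sub>v x \<in> carrier_vec e" "H *\<^sub>v x \<in> carrier_vec a" "P *\<^sub>v x \<in> carrier_vec b" "S *\<^sub>v x \<in> carrier_vec e" for x
    using F H P S by (auto intro!: carrier_vecI)
  have 1: "P *\<^sub>v (F *\<^sub>v x) = x" if "x \<in> carrier_vec b" for x
    using assoc_mult_mat_vec[OF P F that] PF that by simp
  have 2: "H *\<^sub>v (S *\<^sub>v x) = x" if "x \<in> carrier_vec a" for x
    using assoc_mult_mat_vec[OF H S that] HS that by simp
  have 3: "H *\<^sub>v (F *\<^sub>v x) = 0\<^sub>v a" if "x \<in> carrier_vec b" for x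
  proof -
    have "H *\<^sub>v (F *\<^sub>v x) = 0\<^sub>m a b *\<^sub>v x" using assoc_mult_mat_vec[OF H F that] by (simp only: HF)
    also have "\<dots> = 0\<^sub>v a" using that by (intro eq_vecI) auto
    finally show ?thesis .
  qed
  have 4: "x = F *\<^sub>v (P *\<^sub>v x) + S *\<^sub>v (H *\<^sub>v x)" if x: "x \<in> carrier_vec e" for x
  proof -
    have "x = (F * P + S * H) *\<^sub>v x" using sum x by simp
    also have "\<dots> = (F * P) *\<^sub>v x + (S * H) *\<^sub>v x"
      using F P S H x by (intro add_mult_distrib_mat_vec[of _ e e]) auto
    finally show ?thesis using assoc_mult_mat_vec[OF F P x] assoc_mult_mat_vec[OF S H x] by simp
  qed
  have zero: "M *\<^sub>v 0\<^sub>v c = 0\<^sub>v r" if "M \<in> carrier_mat r c" for M :: "'k mat" and r c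
    using that by (auto intro!: eq_vecI)
  show ?thesis
    unfolding exact_pair_def
  proof (intro conjI equalityI subsetI)
    fix x assume "x \<in> mat_kernel F"
    then have x: "x \<in> carrier_vec b" "F *\<^sub>v x = 0\<^sub>v e" unfolding mat_kernel_iff[OF F] by auto
    then show "x \<in> {0\<^sub>v b}" using 1[OF x(1)] zero[OF P] by simp
  next
    fix x :: "'k vec" assume "x \<in> {0\<^sub>v b}"
    then show "x \<in> mat_kernel F" using zero[OF F] unfolding mat_kernel_iff[OF F] by simp
  next
    fix y assume "y \<in> (\<lambda>x. F *\<^sub>v x) ` carrier_vec b"
    then show "y \<in> mat_kernel H" unfolding mat_kernel_iff[OF H] using c 3 by auto
  next
    fix y assume "y \<in> mat_kernel H"
    then have y: "y \<in> carrier_vec e" "H *\<^sub>v y = 0\<^sub>v a" unfolding mat_kernel_iff[OF H] by auto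
    have "y = F *\<^sub>v (P *\<^sub>v y)" using 4[OF y(1)] y(2) zero[OF S] c by simp
    then show "y \<in> (\<lambda>x. F *\<^sub>v x) ` carrier_vec b" using c by blast
  next
    fix y assume "y \<in> (\<lambda>x. H *\<^sub>v x) ` carrier_vec e"
    then show "y \<in> carrier_vec a" using c by auto
  next
    fix y :: "'k vec" assume "y \<in> carrier_vec a"
    then show "y \<in> (\<lambda>x. H *\<^sub>v x) ` carrier_vec e" using 2 c by (metis image_eqI)
  qed
qed

lemma short_exact_iff:
  "short_exact Q B A (E, f, g) \<longleftrightarrow> is_rep Q E \<and> is_hom Q B E f \<and> is_hom Q E A g \<and>
     (\<forall>v\<in>verts Q. exact_pair (f v) (g v) (rdim B v) (rdim E v) (rdim A v))"
  by (simp add: exact_pair_def)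

text \<open>The clause of \<open>almost_rigid\<close> about two summands, named so that its
  invariance under isomorphism can be stated.\<close>

definition rigid_pair ::
  "('v, 'a) pre_digraph \<Rightarrow> ('v, 'a, 'k::field) quiver_rep \<Rightarrow> ('v, 'a, 'k) quiver_rep \<Rightarrow> bool" where
  "rigid_pair Q A B \<longleftrightarrow> Ext1_zero Q A B \<or>
     (\<exists>E f g. indecomposable Q E \<and> Ext1_line_generated_by Q A B (E, f, g))"

text \<open>Extensions of \<open>A\<close> by \<open>B\<close> are described by cocycles \<open>\<psi>\<^sub>a : A\<^sub>t \<rightarrow> B\<^sub>h\<close>, one for each arrow
  \<open>a : t \<rightarrow> h\<close>; \<open>shifts Q A B \<psi> \<sigma> \<psi>'\<close> says that \<open>\<psi>\<close> and \<open>\<psi>'\<close> differ by the coboundary of \<open>\<sigma>\<close>.\<close>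

definition cocycle ::
  "('v, 'a) pre_digraph \<Rightarrow> ('v, 'a, 'k::field) quiver_rep \<Rightarrow> ('v, 'a, 'k) quiver_rep \<Rightarrow> ('a \<Rightarrow> 'k mat) \<Rightarrow> bool" where
  "cocycle Q A B \<psi> \<longleftrightarrow> (\<forall>a\<in>arcs Q. \<psi> a \<in> carrier_mat (rdim B (head Q a)) (rdim A (tail Q a)))"

definition shifts ::
  "('v, 'a) pre_digraph \<Rightarrow> ('v, 'a, 'k::field) quiver_rep \<Rightarrow> ('v, 'a, 'k) quiver_rep \<Rightarrow> ('a \<Rightarrow> 'k mat) \<Rightarrow>
     ('v \<Rightarrow> 'k mat) \<Rightarrow> ('a \<Rightarrow> 'k mat) \<Rightarrow> bool" where
  "shifts Q A B \<psi> \<sigma> \<psi>' \<longleftrightarrow> (\<forall>v\<in>verts Q. \<sigma> v \<in> carrier_mat (rdim B v) (rdim A v)) \<and>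
     (\<forall>a\<in>arcs Q. \<psi> a + rmap B a * \<sigma> (tail Q a) = \<sigma> (head Q a) * rmap A a + \<psi>' a)"

text \<open>The block of \<open>B\<close> comes first, as \<open>B\<close> is the subrepresentation;
  the cocycle occupies the corner that maps \<open>A\<close> at the tail into \<open>B\<close> at
  the head.\<close>

definition ext_rep ::
  "('v, 'a, 'k::field) quiver_rep \<Rightarrow> ('v, 'a, 'k) quiver_rep \<Rightarrow> ('a \<Rightarrow> 'k mat) \<Rightarrow> ('v, 'a, 'k) quiver_rep" where
  "ext_rep A B \<psi> = \<lparr> rdim = (\<lambda>v. rdim B v + rdim A v),
     rmap = (\<lambda>a. four_block_mat (rmap B a) (\<psi> a) (0\<^sub>m (dim_row (rmap A a)) (dim_col (rmap B a))) (rmap A a)) \<rparr>"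

lemma rdim_ext_rep [simp]: "rdim (ext_rep A B \<psi>) v = rdim B v + rdim A v"
  by (simp add: ext_rep_def)

context wf_digraph
begin

lemma short_exact_transport:
  assumes rep: "is_rep G A" "is_rep G B" "is_rep G A'" "is_rep G B'"
    and se: "short_exact G B A (E, f, g)"
    and \<beta>: "is_hom G B' B \<beta>" "is_hom G B B' \<beta>'"
      "\<And>v. v \<in> verts G \<Longrightarrow> \<beta>' v * \<beta> v = 1\<^sub>m (rdim B' v) \<and> \<beta> v * \<beta>' v = 1\<^sub>m (rdim B v)"
    and \<alpha>: "is_hom G A A' \<alpha>" "is_hom G A' A \<alpha>'"
      "\<And>v. v \<in> verts G \<Longrightarrow> \<alpha>' v * \<alpha> v = 1\<^sub>m (rdim A v) \<and> \<alpha> v * \<alpha>' v = 1\<^sub>m (rdim A' v)"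
  shows "short_exact G B' A' (E, \<lambda>v. f v * \<beta> v, \<lambda>v. \<alpha> v * g v)"
proof -
  note s = se[unfolded short_exact_iff]
  have E: "is_rep G E" and f: "is_hom G B E f" and g: "is_hom G E A g" using s by auto
  show ?thesis
    unfolding short_exact_iff
    using E is_hom_comp[OF rep(4,2) E \<beta>(1) f] is_hom_comp[OF E rep(1,3) g \<alpha>(1)] s
    by (auto intro!: exact_transport is_hom_dims(1)[OF f] is_hom_dims(1)[OF g] is_hom_dims(1)[OF \<beta>(1)]
      is_hom_dims(1)[OF \<beta>(2)] is_hom_dims(1)[OF \<alpha>(1)] is_hom_dims(1)[OF \<alpha>(2)] simp: \<alpha>(3) \<beta>(3))
qed

text \<open>Composing the outer maps with isomorphisms changes the ends of a sequence and keeps its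
  middle term. Splittings and morphisms of sequences are carried along, and the indecomposability of
  the middle term is untouched.\<close>

lemma rigid_pair_cong:
  assumes rep: "is_rep G A" "is_rep G B" "is_rep G A'" "is_rep G B'"
    and iso: "rep_iso G A A'" "rep_iso G B B'" and r: "rigid_pair G A' B'"
  shows "rigid_pair G A B"
proof -
  obtain \<alpha> \<alpha>' where \<alpha>: "is_hom G A A' \<alpha>" "is_hom G A' A \<alpha>'"
    "\<And>v. v \<in> verts G \<Longrightarrow> \<alpha>' v * \<alpha> v = 1\<^sub>m (rdim A v) \<and> \<alpha> v * \<alpha>' v = 1\<^sub>m (rdim A' v)"
    using iso(1) unfolding rep_iso_def by blast
  obtain \<beta>' \<beta> where \<beta>: "is_hom G B' B \<beta>" "is_hom G B B' \<beta>'"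
    "\<And>v. v \<in> verts G \<Longrightarrow> \<beta>' v * \<beta> v = 1\<^sub>m (rdim B' v) \<and> \<beta> v * \<beta>' v = 1\<^sub>m (rdim B v)"
    using iso(2) unfolding rep_iso_def by blast
  have \<alpha>s: "\<And>v. v \<in> verts G \<Longrightarrow> \<alpha> v * \<alpha>' v = 1\<^sub>m (rdim A' v) \<and> \<alpha>' v * \<alpha> v = 1\<^sub>m (rdim A v)"
    and \<beta>s: "\<And>v. v \<in> verts G \<Longrightarrow> \<beta> v * \<beta>' v = 1\<^sub>m (rdim B v) \<and> \<beta>' v * \<beta> v = 1\<^sub>m (rdim B' v)"
    using \<alpha>(3) \<beta>(3) by auto
  have to: "short_exact G B' A' (E, \<lambda>v. f v * \<beta> v, \<lambda>v. \<alpha> v * g v)" if "short_exact G B A (E, f, g)" for E f g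
    by (rule short_exact_transport[OF rep that \<beta> \<alpha>])
  have from': "short_exact G B A (E, \<lambda>v. f v * \<beta>' v, \<lambda>v. \<alpha>' v * g v)" if "short_exact G B' A' (E, f, g)" for E f g
    by (rule short_exact_transport[OF rep(3,4,1,2) that \<beta>(2,1) \<beta>s \<alpha>(2,1) \<alpha>s])
  have d: "dim_row (\<alpha> v) = rdim A' v" "dim_col (\<alpha> v) = rdim A v" "dim_row (\<alpha>' v) = rdim A v" "dim_col (\<alpha>' v) = rdim A' v"
    "dim_row (\<beta> v) = rdim B v" "dim_col (\<beta> v) = rdim B' v" "dim_row (\<beta>' v) = rdim B' v" "dim_col (\<beta>' v) = rdim B v"
    if "v \<in> verts G" for v
    using \<alpha>(1,2) \<beta>(1,2) that by (auto dest: is_hom_dims)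
  have split: "split_ses G A (E, f, g)"
    if g: "is_hom G E A g" and E: "is_rep G E" and s: "split_ses G A' (E, f', \<lambda>v. \<alpha> v * g v)" for E f f' g
  proof -
    obtain \<sigma> where \<sigma>: "is_hom G A' E \<sigma>" "\<And>v. v \<in> verts G \<Longrightarrow> \<alpha> v * g v * \<sigma> v = 1\<^sub>m (rdim A' v)"
      using s by auto
    have "g v * (\<sigma> v * \<alpha> v) = 1\<^sub>m (rdim A v)" if v: "v \<in> verts G" for v
    proof -
      note [simp] = d[OF v] is_hom_dims[OF g v] is_hom_dims[OF \<sigma>(1) v]
      have "g v * (\<sigma> v * \<alpha> v) = (\<alpha>' v * \<alpha> v) * (g v * (\<sigma> v * \<alpha> v))"
        using \<alpha>(3)[OF v] by (simp add: mat_one_left)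
      also have "\<dots> = \<alpha>' v * ((\<alpha> v * g v * \<sigma> v) * \<alpha> v)" by (simp add: mat_assoc)
      finally show ?thesis using \<sigma>(2)[OF v] \<alpha>(3)[OF v] by (simp add: mat_one_left)
    qed
    then show ?thesis using is_hom_comp[OF rep(1,3) E \<alpha>(1) \<sigma>(1)] by auto
  qed
  from r consider "Ext1_zero G A' B'" |
    E f g where "indecomposable G E" "Ext1_line_generated_by G A' B' (E, f, g)"
    unfolding rigid_pair_def by blast
  then show ?thesis
  proof cases
    case 1
    have "Ext1_zero G A B"
      unfolding Ext1_zero_def
    proof (intro allI impI)
      fix \<xi> assume "short_exact G B A \<xi>"
      moreover obtain E f g where \<xi>: "\<xi> = (E, f, g)" by (cases \<xi>)
      ultimately have se: "short_exact G B A (E, f, g)" by simp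
      then have "split_ses G A' (E, \<lambda>v. f v * \<beta> v, \<lambda>v. \<alpha> v * g v)"
        using 1 to unfolding Ext1_zero_def by blast
      then show "split_ses G A \<xi>" unfolding \<xi> using split se by (auto simp: short_exact_iff simp del: split_ses.simps)
    qed
    then show ?thesis by (simp add: rigid_pair_def)
  next
    case (2 E f g)
    have se: "short_exact G B' A' (E, f, g)" and ns: "\<not> split_ses G A' (E, f, g)"
      and gen: "\<And>\<zeta>. short_exact G B' A' \<zeta> \<Longrightarrow> \<exists>c. represents_multiple G c (E, f, g) \<zeta>"
      using 2(2) unfolding Ext1_line_generated_by_def by blast+
    have E: "is_rep G E" and f: "is_hom G B' E f" and g: "is_hom G E A' g"
      using se by (auto simp: short_exact_iff)
    let ?\<xi> = "(E, \<lambda>v. f v * \<beta>' v, \<lambda>v. \<alpha>' v * g v)"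
    have "\<not> split_ses G A ?\<xi>"
    proof
      assume "split_ses G A ?\<xi>"
      then obtain \<sigma> where \<sigma>: "is_hom G A E \<sigma>" "\<And>v. v \<in> verts G \<Longrightarrow> \<alpha>' v * g v * \<sigma> v = 1\<^sub>m (rdim A v)" by auto
      have "g v * (\<sigma> v * \<alpha>' v) = 1\<^sub>m (rdim A' v)" if v: "v \<in> verts G" for v
      proof -
        note [simp] = d[OF v] is_hom_dims[OF g v] is_hom_dims[OF \<sigma>(1) v]
        have "g v * (\<sigma> v * \<alpha>' v) = (\<alpha> v * \<alpha>' v) * (g v * (\<sigma> v * \<alpha>' v))"
          using \<alpha>(3)[OF v] by (simp add: mat_one_left)
        also have "\<dots> = \<alpha> v * ((\<alpha>' v * g v * \<sigma> v) * \<alpha>' v)" by (simp add: mat_assoc)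
        finally show ?thesis using \<sigma>(2)[OF v] \<alpha>(3)[OF v] by (simp add: mat_one_left)
      qed
      then have "split_ses G A' (E, f, g)" using is_hom_comp[OF rep(3,1) E \<alpha>(2) \<sigma>(1)] by auto
      with ns show False by blast
    qed
    moreover have "\<exists>c. represents_multiple G c ?\<xi> \<zeta>" if "short_exact G B A \<zeta>" for \<zeta>
    proof -
      obtain E' f' g' where \<zeta>: "\<zeta> = (E', f', g')" by (cases \<zeta>)
      then have se': "short_exact G B A (E', f', g')" using that by simp
      then have fg': "is_hom G B E' f'" "is_hom G E' A g'" by (auto simp: short_exact_iff)
      obtain c h where h: "is_hom G E E' h" "\<And>v. v \<in> verts G \<Longrightarrow> h v * f v = c \<cdot>\<^sub>m (f' v * \<beta> v) \<and> \<alpha> v * g' v * h v = g v"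
        using gen[OF to[OF se']] by auto
      have "h v * (f v * \<beta>' v) = c \<cdot>\<^sub>m f' v \<and> g' v * h v = \<alpha>' v * g v" if v: "v \<in> verts G" for v
      proof -
        note [simp] = d[OF v] is_hom_dims[OF g v] is_hom_dims[OF f v] is_hom_dims[OF h(1) v]
          is_hom_dims[OF fg'(1) v] is_hom_dims[OF fg'(2) v]
        have "h v * (f v * \<beta>' v) = (h v * f v) * \<beta>' v" by (simp add: mat_assoc)
        also have "\<dots> = c \<cdot>\<^sub>m (f' v * (\<beta> v * \<beta>' v))" using h(2)[OF v] by (simp add: mat_simps)
        also have "\<dots> = c \<cdot>\<^sub>m f' v" using \<beta>(3)[OF v] by (simp add: mat_one_right)
        finally have 1: "h v * (f v * \<beta>' v) = c \<cdot>\<^sub>m f' v" .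
        have "\<alpha>' v * g v = \<alpha>' v * (\<alpha> v * g' v * h v)" using h(2)[OF v] by simp
        also have "\<dots> = (\<alpha>' v * \<alpha> v) * (g' v * h v)" by (simp add: mat_assoc)
        also have "\<dots> = g' v * h v" using \<alpha>(3)[OF v] by (simp add: mat_one_left)
        finally show ?thesis using 1 by simp
      qed
      then show ?thesis unfolding \<zeta> using h(1) by auto
    qed
    ultimately have "Ext1_line_generated_by G A B ?\<xi>"
      using from'[OF se] unfolding Ext1_line_generated_by_def by blast
    then show ?thesis using 2(1) unfolding rigid_pair_def by blast
  qed
qed

text \<open>A section exists at each vertex separately. Its failure to commute with an arrow is
  killed by \<open>g\<close>, hence comes from \<open>B\<close>, and this defect is the
  cocycle.\<close>

lemma short_exact_cocycle:
  assumes A: "is_rep G A" and B: "is_rep G B" and se: "short_exact G B A (E, f, g)"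
  shows "\<exists>s \<psi>. (\<forall>v\<in>verts G. s v \<in> carrier_mat (rdim E v) (rdim A v) \<and> g v * s v = 1\<^sub>m (rdim A v)) \<and>
    cocycle G A B \<psi> \<and> (\<forall>a\<in>arcs G. rmap E a * s (tail G a) = s (head G a) * rmap A a + f (head G a) * \<psi> a)"
proof -
  note se' = se[unfolded short_exact_iff]
  have E: "is_rep G E" and f: "is_hom G B E f" and g: "is_hom G E A g"
    and ex: "\<And>v. v \<in> verts G \<Longrightarrow> exact_pair (f v) (g v) (rdim B v) (rdim E v) (rdim A v)" using se' by auto
  have "\<forall>v\<in>verts G. \<exists>S. S \<in> carrier_mat (rdim E v) (rdim A v) \<and> g v * S = 1\<^sub>m (rdim A v)"
    using exact_section[OF is_hom_dims(1)[OF f] is_hom_dims(1)[OF g] ex] by blast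
  then obtain s where s: "\<And>v. v \<in> verts G \<Longrightarrow> s v \<in> carrier_mat (rdim E v) (rdim A v)"
    "\<And>v. v \<in> verts G \<Longrightarrow> g v * s v = 1\<^sub>m (rdim A v)" by metis
  have "\<exists>Z. Z \<in> carrier_mat (rdim B (head G a)) (rdim A (tail G a)) \<and>
      rmap E a * s (tail G a) = s (head G a) * rmap A a + f (head G a) * Z" if a: "a \<in> arcs G" for a
  proof -
    define h t where "h = head G a" and "t = tail G a"
    have v: "h \<in> verts G" "t \<in> verts G" using a by (auto simp: h_def t_def)
    note [simp] = is_hom_dims[OF f v(1)] is_hom_dims[OF g v(1)] is_hom_dims[OF g v(2)]
      is_rep_dims[OF A a, folded h_def t_def] is_rep_dims[OF B a, folded h_def t_def] is_rep_dims[OF E a, folded h_def t_def]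
      carrier_matD[OF s(1)[OF v(1)]] carrier_matD[OF s(1)[OF v(2)]]
    let ?X = "rmap E a * s t" and ?Y = "s h * rmap A a"
    have "g h * ?X = rmap A a * (g t * s t)"
      using is_hom_square[OF g a, folded h_def t_def] by (simp flip: mat_assoc)
    also have "\<dots> = rmap A a" using s(2)[OF v(2)] by (simp add: mat_one_right)
    finally have 1: "g h * ?X = rmap A a" .
    have 2: "g h * ?Y = rmap A a" using s(2)[OF v(1)] by (simp add: mat_one_left flip: mat_assoc)
    \<comment> \<open>\<open>?X\<close> and \<open>?Y\<close> have the same image in
      \<open>A\<close>, so exactness lifts their difference to \<open>B\<close>.\<close>
    have "g h * (?X + (- 1) \<cdot>\<^sub>m ?Y) = rmap A a + (- 1) \<cdot>\<^sub>m rmap A a"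
      by (simp add: mat_distrib_left mat_smult_right 1 2)
    then have z: "g h * (?X + (- 1) \<cdot>\<^sub>m ?Y) = 0\<^sub>m (rdim A h) (rdim A t)" by (simp add: mat_add_neg)
    have c: "?X + (- 1) \<cdot>\<^sub>m ?Y \<in> carrier_mat (rdim E h) (rdim A t)" by (rule carrier_matI) simp_all
    obtain Z where Z: "Z \<in> carrier_mat (rdim B h) (rdim A t)" "f h * Z = ?X + (- 1) \<cdot>\<^sub>m ?Y"
      using exact_lift[OF is_hom_dims(1)[OF f v(1)] is_hom_dims(1)[OF g v(1)] ex[OF v(1)] c z] by blast
    have "?X = ?Y + (?X + (- 1) \<cdot>\<^sub>m ?Y)" by (rule eq_matI) auto
    then have "?X = ?Y + f h * Z" by (simp only: Z(2))
    with Z(1) show ?thesis unfolding h_def t_def by blast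
  qed
  then obtain \<psi> where "\<And>a. a \<in> arcs G \<Longrightarrow> \<psi> a \<in> carrier_mat (rdim B (head G a)) (rdim A (tail G a)) \<and>
      rmap E a * s (tail G a) = s (head G a) * rmap A a + f (head G a) * \<psi> a" by metis
  then show ?thesis using s unfolding cocycle_def by blast
qed

text \<open>The sections at a vertex differ by maps into \<open>B\<close>; moving the section by
  \<open>f * \<sigma>\<close> moves its defect by the coboundary of \<open>\<sigma>\<close>.\<close>

lemma shifted_section:
  assumes A: "is_rep G A" and B: "is_rep G B" and se: "short_exact G B A (E, f, g)"
    and s: "\<forall>v\<in>verts G. s v \<in> carrier_mat (rdim E v) (rdim A v) \<and> g v * s v = 1\<^sub>m (rdim A v)"
    and \<psi>: "cocycle G A B \<psi>" "\<forall>a\<in>arcs G. rmap E a * s (tail G a) = s (head G a) * rmap A a + f (head G a) * \<psi> a"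
    and sh: "shifts G A B \<psi> \<sigma> \<psi>'" and \<psi>': "cocycle G A B \<psi>'"
  defines "r \<equiv> \<lambda>v. s v + f v * \<sigma> v"
  shows "v \<in> verts G \<Longrightarrow> r v \<in> carrier_mat (rdim E v) (rdim A v)"
    and "v \<in> verts G \<Longrightarrow> g v * r v = 1\<^sub>m (rdim A v)"
    and "a \<in> arcs G \<Longrightarrow> rmap E a * r (tail G a) = r (head G a) * rmap A a + f (head G a) * \<psi>' a"
proof -
  note se' = se[unfolded short_exact_iff]
  have E: "is_rep G E" and f: "is_hom G B E f" and g: "is_hom G E A g"
    and ex: "\<And>v. v \<in> verts G \<Longrightarrow> exact_pair (f v) (g v) (rdim B v) (rdim E v) (rdim A v)" using se' by auto
  have sd: "dim_row (s v) = rdim E v" "dim_col (s v) = rdim A v" if "v \<in> verts G" for v using s that by auto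
  have \<sigma>d: "dim_row (\<sigma> v) = rdim B v" "dim_col (\<sigma> v) = rdim A v" if "v \<in> verts G" for v
    using sh that by (auto simp: shifts_def)
  {
    assume v: "v \<in> verts G"
    note [simp] = is_hom_dims[OF f v] is_hom_dims[OF g v] sd[OF v] \<sigma>d[OF v]
    show "r v \<in> carrier_mat (rdim E v) (rdim A v)" by (auto simp: r_def intro!: carrier_matI)
    have "g v * r v = g v * s v + (g v * f v) * \<sigma> v" by (simp add: r_def mat_assoc mat_distrib_left)
    also have "g v * f v = 0\<^sub>m (rdim A v) (rdim B v)"
      by (rule exact_comp_zero[OF is_hom_dims(1)[OF f v] is_hom_dims(1)[OF g v] ex[OF v]])
    finally show "g v * r v = 1\<^sub>m (rdim A v)" using s v by (simp add: mat_zero_left mat_add_zero_right)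
  }
  assume a: "a \<in> arcs G"
  define h t where "h = head G a" and "t = tail G a"
  have v: "h \<in> verts G" "t \<in> verts G" using a by (auto simp: h_def t_def)
  have \<psi>d: "dim_row (\<psi> a) = rdim B h" "dim_col (\<psi> a) = rdim A t" "dim_row (\<psi>' a) = rdim B h" "dim_col (\<psi>' a) = rdim A t"
    using \<psi>(1) \<psi>' a by (auto simp: cocycle_def h_def t_def)
  note [simp] = is_hom_dims[OF f v(1)] is_hom_dims[OF f v(2)] sd[OF v(1)] sd[OF v(2)] \<sigma>d[OF v(1)] \<sigma>d[OF v(2)] \<psi>d
    is_rep_dims[OF A a, folded h_def t_def] is_rep_dims[OF B a, folded h_def t_def] is_rep_dims[OF E a, folded h_def t_def]
  have "rmap E a * r t = rmap E a * s t + (rmap E a * f t) * \<sigma> t" by (simp add: r_def mat_assoc mat_distrib_left)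
  also have "\<dots> = s h * rmap A a + f h * \<psi> a + f h * (rmap B a * \<sigma> t)"
    using bspec[OF \<psi>(2) a, folded h_def t_def] is_hom_square[OF f a, folded h_def t_def, symmetric] by (simp add: mat_assoc)
  also have "\<dots> = s h * rmap A a + f h * (\<psi> a + rmap B a * \<sigma> t)"
    by (subst mat_distrib_left) (auto intro!: assoc_add_mat[of _ "rdim E h" "rdim A t"] intro: carrier_matI)
  also have "\<psi> a + rmap B a * \<sigma> t = \<sigma> h * rmap A a + \<psi>' a"
    using sh a by (auto simp: shifts_def h_def t_def)
  also have "s h * rmap A a + f h * (\<sigma> h * rmap A a + \<psi>' a) = r h * rmap A a + f h * \<psi>' a"
    unfolding r_def
    by (simp add: mat_distrib_left mat_distrib_right mat_assoc)
      (auto intro!: assoc_add_mat[of _ "rdim E h" "rdim A t", symmetric] intro: carrier_matI)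
  finally show "rmap E a * r (tail G a) = r (head G a) * rmap A a + f (head G a) * \<psi>' a" by (simp add: h_def t_def)
qed

lemma cocycle_zero: "cocycle G A B (\<lambda>a. 0\<^sub>m (rdim B (head G a)) (rdim A (tail G a)))"
  by (simp add: cocycle_def)

text \<open>A section whose cocycle is zero commutes with all arrows and is therefore a
  splitting.\<close>

lemma Ext1_zeroI:
  assumes A: "is_rep G A" and B: "is_rep G B"
    and sh: "\<And>\<psi>. cocycle G A B \<psi> \<Longrightarrow> \<exists>\<sigma>. shifts G A B \<psi> \<sigma> (\<lambda>a. 0\<^sub>m (rdim B (head G a)) (rdim A (tail G a)))"
  shows "Ext1_zero G A B"
  unfolding Ext1_zero_def
proof (intro allI impI)
  fix \<xi> assume "short_exact G B A \<xi>"
  moreover obtain E f g where \<xi>: "\<xi> = (E, f, g)" by (cases \<xi>)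
  ultimately have se: "short_exact G B A (E, f, g)" by simp
  then have E: "is_rep G E" and f: "is_hom G B E f" by (auto simp: short_exact_iff)
  obtain s \<psi> where s: "\<forall>v\<in>verts G. s v \<in> carrier_mat (rdim E v) (rdim A v) \<and> g v * s v = 1\<^sub>m (rdim A v)"
    and \<psi>: "cocycle G A B \<psi>" "\<forall>a\<in>arcs G. rmap E a * s (tail G a) = s (head G a) * rmap A a + f (head G a) * \<psi> a"
    using short_exact_cocycle[OF A B se] by blast
  obtain \<sigma> where \<sigma>: "shifts G A B \<psi> \<sigma> (\<lambda>a. 0\<^sub>m (rdim B (head G a)) (rdim A (tail G a)))"
    using sh[OF \<psi>(1)] by blast
  define r where "r v = s v + f v * \<sigma> v" for v
  note r = shifted_section[OF A B se s \<psi> \<sigma> cocycle_zero, folded r_def]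
  have "is_hom G A E r"
    unfolding is_hom_def
  proof (intro conjI ballI)
    fix a assume a: "a \<in> arcs G"
    have "f (head G a) * 0\<^sub>m (rdim B (head G a)) (rdim A (tail G a)) = 0\<^sub>m (rdim E (head G a)) (rdim A (tail G a))"
      using is_hom_dims[OF f head_in_verts[OF a]] by (simp add: mat_zero_right)
    then show "r (head G a) * rmap A a = rmap E a * r (tail G a)"
      using r(3)[OF a] r(1)[OF head_in_verts[OF a]] is_rep_dims[OF A a] by (simp add: mat_add_zero_right)
  qed (rule r(1))
  then show "split_ses G A \<xi>" unfolding \<xi> using r(2) by auto
qed

lemma rmap_ext_rep:
  assumes "is_rep G A" "is_rep G B" "a \<in> arcs G"
  shows "rmap (ext_rep A B \<psi>) a = four_block_mat (rmap B a) (\<psi> a) (0\<^sub>m (rdim A (head G a)) (rdim B (tail G a))) (rmap A a)"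
  using assms by (simp add: ext_rep_def is_rep_dims)

lemma is_rep_ext_rep:
  assumes "is_rep G A" "is_rep G B"
  shows "is_rep G (ext_rep A B \<psi>)"
  unfolding is_rep_def[of G "ext_rep A B \<psi>"] using assms
  by (auto simp: rmap_ext_rep is_rep_dims)

lemma ext_rep_short_exact:
  assumes A: "is_rep G A" and B: "is_rep G B" and \<psi>: "cocycle G A B \<psi>"
  shows "short_exact G B A (ext_rep A B \<psi>, \<lambda>v. inc1 (rdim B v) (rdim A v), \<lambda>v. prj2 (rdim B v) (rdim A v))"
  unfolding short_exact_iff
proof (intro conjI ballI is_rep_ext_rep A B)
  have *: "inc1 (rdim B (head G a)) (rdim A (head G a)) * rmap B a
      = rmap (ext_rep A B \<psi>) a * inc1 (rdim B (tail G a)) (rdim A (tail G a))"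
    "prj2 (rdim B (head G a)) (rdim A (head G a)) * rmap (ext_rep A B \<psi>) a
      = rmap A a * prj2 (rdim B (tail G a)) (rdim A (tail G a))" if a: "a \<in> arcs G" for a
  proof -
    have \<psi>a: "\<psi> a \<in> carrier_mat (rdim B (head G a)) (rdim A (tail G a))" using \<psi> a by (simp add: cocycle_def)
    note F = four_block_inc_prj[OF is_rep_dims(1)[OF B a] \<psi>a zero_carrier_mat is_rep_dims(1)[OF A a]]
    note [simp] = is_rep_dims[OF A a] is_rep_dims[OF B a]
    show "inc1 (rdim B (head G a)) (rdim A (head G a)) * rmap B a
      = rmap (ext_rep A B \<psi>) a * inc1 (rdim B (tail G a)) (rdim A (tail G a))"
    "prj2 (rdim B (head G a)) (rdim A (head G a)) * rmap (ext_rep A B \<psi>) a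
      = rmap A a * prj2 (rdim B (tail G a)) (rdim A (tail G a))"
      unfolding rmap_ext_rep[OF A B a] F
      by (simp_all add: mat_zero_left mat_zero_right mat_add_zero_left mat_add_zero_right)
  qed
  show "is_hom G B (ext_rep A B \<psi>) (\<lambda>v. inc1 (rdim B v) (rdim A v))"
    "is_hom G (ext_rep A B \<psi>) A (\<lambda>v. prj2 (rdim B v) (rdim A v))"
    unfolding is_hom_def by (auto simp: * intro: carrier_matI)
  show "exact_pair (inc1 (rdim B v) (rdim A v)) (prj2 (rdim B v) (rdim A v)) (rdim B v) (rdim (ext_rep A B \<psi>) v) (rdim A v)"
    for v
    by (rule exact_pair_splitI[of _ _ _ _ _ "prj1 (rdim B v) (rdim A v)" "inc2 (rdim B v) (rdim A v)"])
      (auto simp: inc_prj_sum intro: carrier_matI)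
qed

text \<open>A splitting has second component 1; its first component is the required
  \<open>\<sigma>\<close>.\<close>

lemma ext_rep_split_imp_shifts:
  assumes A: "is_rep G A" and B: "is_rep G B" and \<psi>: "cocycle G A B \<psi>"
    and sp: "split_ses G A (ext_rep A B \<psi>, \<lambda>v. inc1 (rdim B v) (rdim A v), \<lambda>v. prj2 (rdim B v) (rdim A v))"
  shows "\<exists>\<sigma>. shifts G A B \<psi> \<sigma> (\<lambda>a. 0\<^sub>m (rdim B (head G a)) (rdim A (tail G a)))"
proof -
  obtain s where s: "is_hom G A (ext_rep A B \<psi>) s" "\<And>v. v \<in> verts G \<Longrightarrow> prj2 (rdim B v) (rdim A v) * s v = 1\<^sub>m (rdim A v)"
    using sp by auto
  define \<sigma> where "\<sigma> = (\<lambda>v. prj1 (rdim B v) (rdim A v) * s v)"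
  have "\<psi> a + rmap B a * \<sigma> (tail G a) = \<sigma> (head G a) * rmap A a + 0\<^sub>m (rdim B (head G a)) (rdim A (tail G a))"
    if a: "a \<in> arcs G" for a
  proof -
    define h t where "h = head G a" and "t = tail G a"
    have v: "h \<in> verts G" "t \<in> verts G" using a by (auto simp: h_def t_def)
    have \<psi>a: "\<psi> a \<in> carrier_mat (rdim B h) (rdim A t)" using \<psi> a by (simp add: cocycle_def h_def t_def)
    note F = four_block_inc_prj(3)[OF is_rep_dims(1)[OF B a] \<psi>a[unfolded h_def t_def] zero_carrier_mat is_rep_dims(1)[OF A a], folded h_def t_def]
    note [simp] = is_rep_dims[OF A a, folded h_def t_def] is_rep_dims[OF B a, folded h_def t_def]
      is_rep_dims[OF is_rep_ext_rep[OF A B, of \<psi>] a, folded h_def t_def, simplified]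
      is_hom_dims[OF s(1) v(1), simplified] is_hom_dims[OF s(1) v(2), simplified] carrier_matD[OF \<psi>a]
    have "\<sigma> h * rmap A a = prj1 (rdim B h) (rdim A h) * (s h * rmap A a)" by (simp add: \<sigma>_def mat_assoc)
    also have "\<dots> = (prj1 (rdim B h) (rdim A h) * rmap (ext_rep A B \<psi>) a) * s t"
      using is_hom_square[OF s(1) a, folded h_def t_def] by (simp add: mat_assoc)
    also have "\<dots> = rmap B a * \<sigma> t + \<psi> a * (prj2 (rdim B t) (rdim A t) * s t)"
      unfolding rmap_ext_rep[OF A B a, folded h_def t_def] F by (simp add: \<sigma>_def mat_assoc mat_distrib_right)
    also have "\<dots> = \<psi> a + rmap B a * \<sigma> t"
      using s(2)[OF v(2)] by (simp add: mat_one_right \<sigma>_def) (auto intro!: comm_add_mat[of _ "rdim B h" "rdim A t"] intro: carrier_matI)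
    finally show ?thesis by (simp add: h_def[symmetric] t_def[symmetric] mat_add_zero_right \<sigma>_def)
  qed
  moreover have "\<sigma> v \<in> carrier_mat (rdim B v) (rdim A v)" if "v \<in> verts G" for v
    using is_hom_dims[OF s(1) that] by (auto simp: \<sigma>_def intro!: carrier_matI)
  ultimately show ?thesis unfolding shifts_def by blast
qed

text \<open>It is enough to work with cocycles modulo coboundaries: any extension has a section
  whose cocycle is a multiple of \<open>\<psi>0\<close>, and such a section yields a morphism out of
  \<open>ext_rep\<close>.\<close>

lemma Ext1_line_ext_rep:
  assumes A: "is_rep G A" and B: "is_rep G B" and \<psi>0: "cocycle G A B \<psi>0"
    and ns: "\<And>\<sigma>. \<not> shifts G A B \<psi>0 \<sigma> (\<lambda>a. 0\<^sub>m (rdim B (head G a)) (rdim A (tail G a)))"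
    and gen: "\<And>\<psi>. cocycle G A B \<psi> \<Longrightarrow> \<exists>c \<sigma>. shifts G A B \<psi> \<sigma> (\<lambda>a. c \<cdot>\<^sub>m \<psi>0 a)"
  shows "Ext1_line_generated_by G A B
    (ext_rep A B \<psi>0, \<lambda>v. inc1 (rdim B v) (rdim A v), \<lambda>v. prj2 (rdim B v) (rdim A v))"
  unfolding Ext1_line_generated_by_def
proof (intro conjI allI impI ext_rep_short_exact[OF A B \<psi>0])
  show "\<not> split_ses G A (ext_rep A B \<psi>0, \<lambda>v. inc1 (rdim B v) (rdim A v), \<lambda>v. prj2 (rdim B v) (rdim A v))"
    using ext_rep_split_imp_shifts[OF A B \<psi>0] ns by blast
  fix \<zeta> assume "short_exact G B A \<zeta>"
  moreover obtain E f g where \<zeta>: "\<zeta> = (E, f, g)" by (cases \<zeta>)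
  ultimately have se: "short_exact G B A (E, f, g)" by simp
  then have E: "is_rep G E" and f: "is_hom G B E f" and g: "is_hom G E A g"
    and ex: "\<And>v. v \<in> verts G \<Longrightarrow> exact_pair (f v) (g v) (rdim B v) (rdim E v) (rdim A v)"
    unfolding short_exact_iff by auto
  obtain s \<psi> where s: "\<forall>v\<in>verts G. s v \<in> carrier_mat (rdim E v) (rdim A v) \<and> g v * s v = 1\<^sub>m (rdim A v)"
    and \<psi>: "cocycle G A B \<psi>" "\<forall>a\<in>arcs G. rmap E a * s (tail G a) = s (head G a) * rmap A a + f (head G a) * \<psi> a"
    using short_exact_cocycle[OF A B se] by blast
  obtain c \<sigma> where \<sigma>: "shifts G A B \<psi> \<sigma> (\<lambda>a. c \<cdot>\<^sub>m \<psi>0 a)"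
    using gen[OF \<psi>(1)] by blast
  have c\<psi>: "cocycle G A B (\<lambda>a. c \<cdot>\<^sub>m \<psi>0 a)" using \<psi>0 by (auto simp: cocycle_def)
  define r where "r v = s v + f v * \<sigma> v" for v
  note r = shifted_section[OF A B se s \<psi> \<sigma> c\<psi>, folded r_def]
  \<comment> \<open>On the block \<open>B\<close> it is \<open>c\<close> times \<open>f\<close>, on
    the block \<open>A\<close> it is the section \<open>r\<close>. It commutes with the arrows
    because the cocycle of \<open>r\<close> is \<open>c\<close> times
    \<open>\<psi>0\<close>.\<close>
  define h where "h = (\<lambda>v. c \<cdot>\<^sub>m (f v * prj1 (rdim B v) (rdim A v)) + r v * prj2 (rdim B v) (rdim A v))"
  have rd: "dim_row (r v) = rdim E v" "dim_col (r v) = rdim A v" if "v \<in> verts G" for v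
    using r(1)[OF that] by auto
  have "h (head G a) * rmap (ext_rep A B \<psi>0) a = rmap E a * h (tail G a)" if a: "a \<in> arcs G" for a
  proof -
    define x t where "x = head G a" and "t = tail G a"
    have v: "x \<in> verts G" "t \<in> verts G" using a by (auto simp: x_def t_def)
    have \<psi>a: "\<psi>0 a \<in> carrier_mat (rdim B x) (rdim A t)" using \<psi>0 a by (simp add: cocycle_def x_def t_def)
    note F = four_block_inc_prj(3,4)[OF is_rep_dims(1)[OF B a] \<psi>a[unfolded x_def t_def] zero_carrier_mat is_rep_dims(1)[OF A a], folded x_def t_def]
    note [simp] = is_rep_dims[OF A a, folded x_def t_def] is_rep_dims[OF B a, folded x_def t_def] is_rep_dims[OF E a, folded x_def t_def]
      is_rep_dims[OF is_rep_ext_rep[OF A B, of \<psi>0] a, folded x_def t_def, simplified]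
      is_hom_dims[OF f v(1)] is_hom_dims[OF f v(2)] carrier_matD[OF \<psi>a] rd[OF v(1)] rd[OF v(2)]
    let ?p = "prj1 (rdim B t) (rdim A t) :: 'c mat" and ?q = "prj2 (rdim B t) (rdim A t) :: 'c mat"
    have "h x * rmap (ext_rep A B \<psi>0) a
      = c \<cdot>\<^sub>m (f x * (prj1 (rdim B x) (rdim A x) * rmap (ext_rep A B \<psi>0) a))
        + r x * (prj2 (rdim B x) (rdim A x) * rmap (ext_rep A B \<psi>0) a)"
      by (simp add: h_def mat_assoc mat_distrib_right mat_smult_left)
    also have "\<dots> = c \<cdot>\<^sub>m (f x * (rmap B a * ?p + \<psi>0 a * ?q)) + r x * (rmap A a * ?q)"
      unfolding rmap_ext_rep[OF A B a, folded x_def t_def] F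
      by (simp add: mat_zero_left mat_add_zero_left)
    also have "\<dots> = c \<cdot>\<^sub>m (f x * (rmap B a * ?p)) + (r x * (rmap A a * ?q) + c \<cdot>\<^sub>m (f x * (\<psi>0 a * ?q)))"
      by (subst mat_distrib_left) (auto intro!: eq_matI simp: algebra_simps)
    also have "\<dots> = c \<cdot>\<^sub>m (f x * (rmap B a * ?p)) + (r x * rmap A a + f x * (c \<cdot>\<^sub>m \<psi>0 a)) * ?q"
      by (simp add: mat_assoc mat_distrib_right mat_smult_left mat_smult_right)
    also have "\<dots> = c \<cdot>\<^sub>m (rmap E a * (f t * ?p)) + rmap E a * (r t * ?q)"
      using r(3)[OF a, folded x_def t_def] is_hom_square[OF f a, folded x_def t_def]
      by (simp flip: mat_assoc)
    also have "\<dots> = rmap E a * h t"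
      by (simp add: h_def mat_distrib_left mat_smult_right)
    finally show ?thesis by (simp add: x_def t_def)
  qed
  moreover have "h v \<in> carrier_mat (rdim E v) (rdim (ext_rep A B \<psi>0) v)" if "v \<in> verts G" for v
    using rd[OF that] is_hom_dims[OF f that] by (auto simp: h_def intro!: carrier_matI)
  ultimately have "is_hom G (ext_rep A B \<psi>0) E h" unfolding is_hom_def by blast
  moreover have "h v * inc1 (rdim B v) (rdim A v) = c \<cdot>\<^sub>m f v \<and> g v * h v = prj2 (rdim B v) (rdim A v)"
    if v: "v \<in> verts G" for v
  proof -
    note [simp] = is_hom_dims[OF f v] is_hom_dims[OF g v] rd[OF v]
    have "g v * f v = 0\<^sub>m (rdim A v) (rdim B v)"
      by (rule exact_comp_zero[OF is_hom_dims(1)[OF f v] is_hom_dims(1)[OF g v] ex[OF v]])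
    then have "g v * (f v * X) = 0\<^sub>m (rdim A v) (dim_col X)" if "dim_row X = rdim B v" for X
      using that by (simp add: mat_zero_left flip: mat_assoc)
    moreover have "g v * (r v * X) = X" if "dim_row X = rdim A v" for X
      using that r(2)[OF v] by (simp add: mat_one_left flip: mat_assoc)
    moreover have "c \<cdot>\<^sub>m 0\<^sub>m a b = (0\<^sub>m a b :: 'c mat)" for a b by (auto intro!: eq_matI)
    ultimately show ?thesis
      by (simp add: h_def mat_simps)
  qed
  ultimately show "\<exists>c. represents_multiple G c (ext_rep A B \<psi>0, \<lambda>v. inc1 (rdim B v) (rdim A v), \<lambda>v. prj2 (rdim B v) (rdim A v)) \<zeta>"
    unfolding \<zeta> by auto
qed

end

section \<open>Extensions between intervals\<close>

text \<open>For segments \<open>\<gamma>(i,j)\<close> and \<open>\<gamma>(k,l)\<close>: the second starts above the first and ends below it.\<close>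

definition crosses_down :: "nat set \<Rightarrow> nat set \<Rightarrow> nat \<Rightarrow> nat \<Rightarrow> nat \<Rightarrow> nat \<Rightarrow> bool" where
  "crosses_down Hi Lo i j k l \<longleftrightarrow> max i k < min j l \<and>
     (i < k \<and> k \<in> Hi \<or> k < i \<and> i \<in> Lo) \<and> (l < j \<and> l \<in> Lo \<or> j < l \<and> j \<in> Hi)"

context dynkin
begin

text \<open>All spaces have dimension at most 1. At an arrow from the first interval into the second
  the coboundary equation is an equation of scalars; at any other arrow both sides are matrices
  without entries.\<close>

lemma shifts_interval_arc_iff:
  fixes \<psi> \<psi>' \<sigma> :: "nat \<Rightarrow> 'k::field mat"
  assumes e: "e \<in> arcs Q" and \<psi>: "cocycle Q (I a b) (I c d) \<psi>" and \<psi>': "cocycle Q (I a b) (I c d) \<psi>'"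
    and \<sigma>: "\<And>v. v \<in> verts Q \<Longrightarrow>
      \<sigma> v \<in> carrier_mat (rdim (I c d :: (nat, nat, 'k) quiver_rep) v) (rdim (I a b :: (nat, nat, 'k) quiver_rep) v)"
  shows "\<psi> e + rmap (I c d) e * \<sigma> (tail Q e) = \<sigma> (head Q e) * rmap (I a b) e + \<psi>' e \<longleftrightarrow>
    (tail Q e \<in> {a..b} \<and> head Q e \<in> {c..d} \<longrightarrow>
      \<psi> e $$ (0,0) + (if tail Q e \<in> {c..d} then \<sigma> (tail Q e) $$ (0,0) else 0)
        = (if head Q e \<in> {a..b} then \<sigma> (head Q e) $$ (0,0) else 0) + \<psi>' e $$ (0,0))"
proof -
  have v: "tail Q e \<in> verts Q" "head Q e \<in> verts Q" using e by (auto simp: arc_ends)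
  have c\<psi>: "\<psi> e \<in> carrier_mat (if head Q e \<in> {c..d} then 1 else 0) (if tail Q e \<in> {a..b} then 1 else 0)"
    "\<psi>' e \<in> carrier_mat (if head Q e \<in> {c..d} then 1 else 0) (if tail Q e \<in> {a..b} then 1 else 0)"
    using \<psi> \<psi>' e by (simp_all add: cocycle_def rdim_interval)
  have c\<sigma>: "\<sigma> v \<in> carrier_mat (if v \<in> {c..d} then 1 else 0) (if v \<in> {a..b} then 1 else 0)" if "v \<in> verts Q" for v
    using \<sigma>[OF that] by (simp add: rdim_interval)
  show ?thesis
  proof (cases "tail Q e \<in> {a..b} \<and> head Q e \<in> {c..d}")
    case False
    have "\<psi> e + rmap (I c d) e * \<sigma> (tail Q e) = \<sigma> (head Q e) * rmap (I a b) e + \<psi>' e"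
    proof (rule eq_matI)
      fix x y
      assume "x < dim_row (\<sigma> (head Q e) * rmap (I a b) e + \<psi>' e)" "y < dim_col (\<sigma> (head Q e) * rmap (I a b) e + \<psi>' e)"
      then have "x < (if head Q e \<in> {c..d} then 1 else 0)" "y < (if tail Q e \<in> {a..b} then 1 else (0::nat))"
        using c\<psi>(2) by (simp_all only: index_add_mat carrier_matD)
      with False show "(\<psi> e + rmap (I c d) e * \<sigma> (tail Q e)) $$ (x, y) = (\<sigma> (head Q e) * rmap (I a b) e + \<psi>' e) $$ (x, y)"
        by (simp split: if_splits)
    qed (simp_all only: index_add_mat index_mult_mat carrier_matD[OF c\<psi>(1)] carrier_matD[OF c\<psi>(2)]
      carrier_matD[OF c\<sigma>[OF v(1)]] carrier_matD[OF c\<sigma>[OF v(2)]] rmap_interval dim_row_mat dim_col_mat)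
    then show ?thesis using False by blast
  next
    case True
    have t: "tail Q e \<in> {a..b}" and h: "head Q e \<in> {c..d}" using True by auto
    have l: "rmap (I c d) e * \<sigma> (tail Q e) = mat 1 1 (\<lambda>_. if tail Q e \<in> {c..d} then \<sigma> (tail Q e) $$ (0,0) else 0)"
      using c\<sigma>[OF v(1)] t h by (intro eq_matI) (auto simp: rmap_interval scalar_prod_def)
    have r: "\<sigma> (head Q e) * rmap (I a b) e = mat 1 1 (\<lambda>_. if head Q e \<in> {a..b} then \<sigma> (head Q e) $$ (0,0) else 0)"
      using c\<sigma>[OF v(2)] t h by (intro eq_matI) (auto simp: rmap_interval scalar_prod_def)
    show ?thesis unfolding l r using c\<psi> t h
      by (subst mat_one_by_one_eq_iff) auto
  qed
qed

lemma shifts_intervalI: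
  fixes \<psi> \<psi>' :: "nat \<Rightarrow> 'k::field mat"
  assumes \<psi>: "cocycle Q (I a b) (I c d) \<psi>" and \<psi>': "cocycle Q (I a b) (I c d) \<psi>'"
    and s: "\<And>e. e \<in> arcs Q \<Longrightarrow> tail Q e \<in> {a..b} \<Longrightarrow> head Q e \<in> {c..d} \<Longrightarrow>
      \<psi> e $$ (0,0) + (if tail Q e \<in> {c..d} then s (tail Q e) else 0)
        = (if head Q e \<in> {a..b} then s (head Q e) else 0) + \<psi>' e $$ (0,0)"
  shows "\<exists>\<sigma>. shifts Q (I a b) (I c d) \<psi> \<sigma> \<psi>'"
proof -
  define \<sigma> where "\<sigma> v = mat (rdim (I c d :: (nat, nat, 'k) quiver_rep) v) (rdim (I a b :: (nat, nat, 'k) quiver_rep) v) (\<lambda>_. s v)" for v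
  have \<sigma>: "\<sigma> v \<in> carrier_mat (rdim (I c d :: (nat, nat, 'k) quiver_rep) v) (rdim (I a b :: (nat, nat, 'k) quiver_rep) v)" for v
    by (simp add: \<sigma>_def)
  have \<sigma>s: "\<sigma> v $$ (0,0) = s v" if "v \<in> {a..b}" "v \<in> {c..d}" for v using that by (simp add: \<sigma>_def rdim_interval)
  have "shifts Q (I a b) (I c d) \<psi> \<sigma> \<psi>'"
    unfolding shifts_def
  proof (intro conjI ballI \<sigma>)
    fix e assume e: "e \<in> arcs Q"
    show "\<psi> e + rmap (I c d) e * \<sigma> (tail Q e) = \<sigma> (head Q e) * rmap (I a b) e + \<psi>' e"
      unfolding shifts_interval_arc_iff[OF e \<psi> \<psi>' \<sigma>]
      using s[OF e] \<sigma>s by auto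
  qed
  then show ?thesis by blast
qed

lemma shifts_intervalD:
  fixes \<psi> \<psi>' :: "nat \<Rightarrow> 'k::field mat"
  assumes \<psi>: "cocycle Q (I a b) (I c d) \<psi>" and \<psi>': "cocycle Q (I a b) (I c d) \<psi>'"
    and sh: "shifts Q (I a b) (I c d) \<psi> \<sigma> \<psi>'" and e: "e \<in> arcs Q" "tail Q e \<in> {a..b}" "head Q e \<in> {c..d}"
  shows "\<psi> e $$ (0,0) + (if tail Q e \<in> {c..d} then \<sigma> (tail Q e) $$ (0,0) else 0)
        = (if head Q e \<in> {a..b} then \<sigma> (head Q e) $$ (0,0) else 0) + \<psi>' e $$ (0,0)"
  using sh e shifts_interval_arc_iff[OF e(1) \<psi> \<psi>', of \<sigma>] unfolding shifts_def by simp

text \<open>The upper and lower vertices of the polygon read off from the quiver alone;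
  \<open>Hi_eq\<close> and \<open>Lo_eq\<close> identify them with \<open>over\<close> and
  \<open>under\<close>.\<close>

definition Hi :: "nat set" where "Hi = {e \<in> arcs Q. tail Q e = e}"
definition Lo :: "nat set" where "Lo = {e \<in> arcs Q. tail Q e = Suc e}"

lemma Hi_iff: "e \<in> Hi \<longleftrightarrow> e \<in> arcs Q \<and> tail Q e = e \<and> head Q e = Suc e"
  and Lo_iff: "e \<in> Lo \<longleftrightarrow> e \<in> arcs Q \<and> tail Q e = Suc e \<and> head Q e = e"
proof -
  have "tail Q e = e \<and> head Q e = Suc e \<or> tail Q e = Suc e \<and> head Q e = e" if "e \<in> arcs Q"
    using arc_cases[OF that] by blast
  then show "e \<in> Hi \<longleftrightarrow> e \<in> arcs Q \<and> tail Q e = e \<and> head Q e = Suc e"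
    "e \<in> Lo \<longleftrightarrow> e \<in> arcs Q \<and> tail Q e = Suc e \<and> head Q e = e"
    unfolding Hi_def Lo_def by force+
qed

text \<open>On the overlap of the two intervals a coboundary prescribes the differences of the scalars
  \<open>s\<close>, and each of the two ends can prescribe one further value; only if both do can the system be
  unsolvable.\<close>

lemma Ext1_zero_overlap:
  assumes ij: "i < j" "j \<le> m" and kl: "k < l" "l \<le> m" and ov: "max i k < min j l"
    and nc: "\<not> crosses_down Hi Lo i j k l"
  shows "Ext1_zero Q (I (Suc i) j) (I (Suc k) l :: (nat, nat, 'k::field) quiver_rep)"
proof (rule Ext1_zeroI[OF is_rep_interval is_rep_interval])
  let ?A = "I (Suc i) j :: (nat, nat, 'k) quiver_rep" and ?B = "I (Suc k) l :: (nat, nat, 'k) quiver_rep"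
  fix \<psi> :: "nat \<Rightarrow> 'k mat" assume \<psi>: "cocycle Q ?A ?B \<psi>"
  \<comment> \<open>With this sign every arrow inside the overlap asks for
    \<open>s (Suc e) = s e + w e\<close>, whichever way it points.\<close>
  define w where "w e = (if tail Q e = e then \<psi> e $$ (0,0) else - (\<psi> e $$ (0,0)))" for e
  define p where "p = max i k"
  define q where "q = min j l"
  \<comment> \<open>\<open>L\<close> and \<open>R\<close> say that the left end \<open>p\<close> and
    the right end \<open>q\<close> of the overlap impose a condition, namely
    \<open>s (Suc p) = w p\<close> and \<open>s q = - w q\<close>.\<close>
  define L where "L \<longleftrightarrow> (i < k \<and> k \<in> Hi \<or> k < i \<and> i \<in> Lo)"
  define R where "R \<longleftrightarrow> (l < j \<and> l \<in> Lo \<or> j < l \<and> j \<in> Hi)"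
  have nLR: "\<not> (L \<and> R)" using nc ov by (auto simp: crosses_down_def L_def R_def)
  have pq: "p < q" using ov by (simp add: p_def q_def)
  \<comment> \<open>The starting value obeys the left condition if there is one; otherwise it is
    adjusted so that the accumulated sum meets the right one.\<close>
  define c0 where "c0 = (if L then w p else - w q - (\<Sum>e\<in>{Suc p..<q}. w e))"
  define s where "s v = c0 + (\<Sum>e\<in>{Suc p..<v}. w e)" for v
  have s_step: "s (Suc e) = s e + w e" if "p < e" for e
    using that by (simp add: s_def)
  have s_left: "s (Suc p) = w p" if L using that by (simp add: s_def c0_def)
  have s_right: "s q = - w q" if R using that nLR by (simp add: s_def c0_def)
  show "\<exists>\<sigma>. shifts Q ?A ?B \<psi> \<sigma> (\<lambda>a. 0\<^sub>m (rdim ?B (head Q a)) (rdim ?A (tail Q a)))"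
  proof (rule shifts_intervalI[OF \<psi> cocycle_zero, where s = s])
    fix e assume e: "e \<in> arcs Q" and t: "tail Q e \<in> {Suc i..j}" and h: "head Q e \<in> {Suc k..l}"
    have z: "(0\<^sub>m (rdim ?B (head Q e)) (rdim ?A (tail Q e)) :: 'k mat) $$ (0,0) = 0"
      using t h by (simp add: rdim_interval)
    show "\<psi> e $$ (0,0) + (if tail Q e \<in> {Suc k..l} then s (tail Q e) else 0) =
      (if head Q e \<in> {Suc i..j} then s (head Q e) else 0) + 0\<^sub>m (rdim ?B (head Q e)) (rdim ?A (tail Q e)) $$ (0,0)"
    proof (cases rule: arc_cases[OF e])
      case 1
      then have w: "w e = \<psi> e $$ (0,0)" by (simp add: w_def)
      have ran: "i < e" "e \<le> j" "k \<le> e" "e < l" using t h 1 by auto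
      consider "k < e" "e < j" | "k = e" | "k < e" "e = j" using ran by linarith
      then show ?thesis
      proof cases
        case a: 1
        then have "s (Suc e) = s e + w e" using ran by (intro s_step) (simp add: p_def)
        then show ?thesis using 1 a ran w z by simp
      next
        case a: 2
        have "L" "p = e" using a ran 1 e by (auto simp: L_def Hi_iff p_def)
        then have "s (Suc e) = w e" using s_left by simp
        then show ?thesis using 1 a ran w z ov by auto
      next
        case a: 3
        have "R" "q = e" using a ran 1 e by (auto simp: R_def Hi_iff q_def)
        then have "s e = - w e" using s_right by simp
        then show ?thesis using 1 a ran w z by simp
      qed
    next
      case 2
      then have w: "w e = - (\<psi> e $$ (0,0))" by (simp add: w_def)
      have ran: "i \<le> e" "e < j" "k < e" "e \<le> l" using t h 2 by auto
      consider "i < e" "e < l" | "i = e" | "i < e" "e = l" using ran by linarith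
      then show ?thesis
      proof cases
        case a: 1
        then have "s (Suc e) = s e + w e" using ran by (intro s_step) (simp add: p_def)
        then show ?thesis using 2 a ran w z by simp
      next
        case a: 2
        have "L" "p = e" using a ran 2 e by (auto simp: L_def Lo_iff p_def)
        then have "s (Suc e) = w e" using s_left by simp
        then show ?thesis using 2 a ran w z ov by auto
      next
        case a: 3
        have "R" "q = e" using a ran 2 e by (auto simp: R_def Lo_iff q_def)
        then have "s e = - w e" using s_right by simp
        then show ?thesis using 2 a ran w z by simp
      qed
    qed
  qed
qed

text \<open>Records may differ outside the quiver, so agreement on its vertices and arrows gives
  only an isomorphism, by identity matrices.\<close>

lemma rep_iso_eqI:
  assumes V: "is_rep Q V" and W: "is_rep Q W" and d: "\<And>v. v \<in> verts Q \<Longrightarrow> rdim V v = rdim W v"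
    and r: "\<And>e. e \<in> arcs Q \<Longrightarrow> rmap V e = rmap W e"
  shows "rep_iso Q V W"
proof -
  have "is_hom Q V W (\<lambda>v. 1\<^sub>m (rdim V v))" "is_hom Q W V (\<lambda>v. 1\<^sub>m (rdim V v))"
    using d r is_rep_dims[OF V]
    by (auto simp: is_hom_def mat_one_left mat_one_right arc_ends)
  then show ?thesis unfolding rep_iso_def using d by (intro exI[of _ "\<lambda>v. 1\<^sub>m (rdim V v)"]) auto
qed

text \<open>Without an arrow from the first interval into the second, a cocycle has no entry at all.
  With one, the intervals are adjacent and that arrow is unique; there is a single scalar and no
  coboundary, and the nonzero class has the interval on the union as middle term.\<close>

lemma rigid_pair_disjoint:
  assumes ij: "i < j" "j \<le> m" and kl: "k < l" "l \<le> m" and dj: "min j l \<le> max i k"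
  shows "rigid_pair Q (I (Suc i) j) (I (Suc k) l :: (nat, nat, 'k::field) quiver_rep)"
proof -
  let ?A = "I (Suc i) j :: (nat, nat, 'k) quiver_rep" and ?B = "I (Suc k) l :: (nat, nat, 'k) quiver_rep"
  have disj: "{Suc i..j} \<inter> {Suc k..l} = {}" using dj ij kl by (auto simp: max_def min_def split: if_splits)
  define conn where "conn e \<longleftrightarrow> e \<in> arcs Q \<and> tail Q e \<in> {Suc i..j} \<and> head Q e \<in> {Suc k..l}" for e
  show ?thesis
  proof (cases "\<exists>e. conn e")
    case False
    have "Ext1_zero Q ?A ?B"
    proof (rule Ext1_zeroI[OF is_rep_interval is_rep_interval])
      fix \<psi> :: "nat \<Rightarrow> 'k mat" assume \<psi>: "cocycle Q ?A ?B \<psi>"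
      show "\<exists>\<sigma>. shifts Q ?A ?B \<psi> \<sigma> (\<lambda>a. 0\<^sub>m (rdim ?B (head Q a)) (rdim ?A (tail Q a)))"
        by (rule shifts_intervalI[OF \<psi> cocycle_zero, where s = "\<lambda>_. 0"]) (use False in \<open>auto simp: conn_def\<close>)
    qed
    then show ?thesis by (simp add: rigid_pair_def)
  next
    case True
    then obtain e0 where e0: "conn e0" by blast
    have conn_arc: "j = k \<and> e = k \<and> tail Q e = e \<or> l = i \<and> e = i \<and> tail Q e = Suc e" if c: "conn e" for e
    proof -
      have e: "e \<in> arcs Q" using c by (simp add: conn_def)
      show ?thesis
        by (cases rule: arc_cases[OF e])
          (use c dj ij kl in \<open>auto simp: conn_def max_def min_def split: if_splits\<close>)
    qed
    note adj = conn_arc[OF e0]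
    have uniq: "e = e0" if "conn e" for e
      using conn_arc[OF that] adj ij kl by auto
    define \<psi>0 where "\<psi>0 e = (mat (rdim ?B (head Q e)) (rdim ?A (tail Q e)) (\<lambda>_. 1) :: 'k mat)" for e
    have \<psi>0: "cocycle Q ?A ?B \<psi>0" by (simp add: cocycle_def \<psi>0_def)
    have \<psi>01: "\<psi>0 e $$ (0,0) = 1" if "conn e" for e using that by (simp add: \<psi>0_def conn_def rdim_interval)
    have "Ext1_line_generated_by Q ?A ?B
      (ext_rep ?A ?B \<psi>0, \<lambda>v. inc1 (rdim ?B v) (rdim ?A v), \<lambda>v. prj2 (rdim ?B v) (rdim ?A v))"
    proof (rule Ext1_line_ext_rep[OF is_rep_interval is_rep_interval \<psi>0])
      fix \<sigma> :: "nat \<Rightarrow> 'k mat"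
      show "\<not> shifts Q ?A ?B \<psi>0 \<sigma> (\<lambda>a. 0\<^sub>m (rdim ?B (head Q a)) (rdim ?A (tail Q a)))"
      proof
        assume "shifts Q ?A ?B \<psi>0 \<sigma> (\<lambda>a. 0\<^sub>m (rdim ?B (head Q a)) (rdim ?A (tail Q a)))"
        from shifts_intervalD[OF \<psi>0 cocycle_zero this, of e0]
        show False using e0 \<psi>01[OF e0] disj
          by (auto simp: conn_def rdim_interval disjoint_iff split: if_splits)
      qed
    next
      fix \<psi> :: "nat \<Rightarrow> 'k mat" assume \<psi>: "cocycle Q ?A ?B \<psi>"
      have c: "cocycle Q ?A ?B (\<lambda>a. (\<psi> e0 $$ (0,0)) \<cdot>\<^sub>m \<psi>0 a)" using \<psi>0 by (auto simp: cocycle_def)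
      have "\<exists>\<sigma>. shifts Q ?A ?B \<psi> \<sigma> (\<lambda>a. (\<psi> e0 $$ (0,0)) \<cdot>\<^sub>m \<psi>0 a)"
      proof (rule shifts_intervalI[OF \<psi> c, where s = "\<lambda>_. 0"])
        fix e assume e: "e \<in> arcs Q" "tail Q e \<in> {Suc i..j}" "head Q e \<in> {Suc k..l}"
        then have "e = e0" using uniq by (simp add: conn_def)
        then show "\<psi> e $$ (0,0) + (if tail Q e \<in> {Suc k..l} then 0 else 0)
          = (if head Q e \<in> {Suc i..j} then 0 else 0) + ((\<psi> e0 $$ (0,0)) \<cdot>\<^sub>m \<psi>0 e) $$ (0,0)"
          using e by (simp add: \<psi>0_def rdim_interval)
      qed
      then show "\<exists>c \<sigma>. shifts Q ?A ?B \<psi> \<sigma> (\<lambda>a. c \<cdot>\<^sub>m \<psi>0 a)" by blast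
    qed
    moreover have "indecomposable Q (ext_rep ?A ?B \<psi>0)"
    proof -
      define u where "u = min i k"
      define w where "w = max j l"
      let ?U = "I (Suc u) w :: (nat, nat, 'k) quiver_rep"
      have un: "v \<in> {Suc u..w} \<longleftrightarrow> v \<in> {Suc i..j} \<or> v \<in> {Suc k..l}" for v
        using adj ij kl by (auto simp: u_def w_def)
      \<comment> \<open>Hence the lower left block of the extension has no entries, and every entry
        that is present is 1, as for the interval on the union.\<close>
      have noback: "\<not> (tail Q e \<in> {Suc k..l} \<and> head Q e \<in> {Suc i..j})" if e: "e \<in> arcs Q" for e
        using adj ij kl e by (cases rule: arc_cases[OF e]) auto
      have "rmap (ext_rep ?A ?B \<psi>0) e = rmap ?U e" if e: "e \<in> arcs Q" for e
      proof -
        have v: "rdim ?A v + rdim ?B v = rdim ?U v" for v using un[of v] disj by (auto simp: rdim_interval)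
        have fb: "four_block_mat (rmap ?B e) (\<psi>0 e) (0\<^sub>m (rdim ?A (head Q e)) (rdim ?B (tail Q e))) (rmap ?A e) $$ (x, y) = 1"
          if xy: "x < rdim ?B (head Q e) + rdim ?A (head Q e)" "y < rdim ?B (tail Q e) + rdim ?A (tail Q e)" for x y
          using xy noback[OF e] disj
          by (auto simp: rmap_interval rdim_interval \<psi>0_def four_block_mat_def disjoint_iff split: if_splits)
        have d: "dim_row (rmap ?U e) = rdim ?U (head Q e)" "dim_col (rmap ?U e) = rdim ?U (tail Q e)"
          "dim_row (rmap ?A e) = rdim ?A (head Q e)" "dim_col (rmap ?A e) = rdim ?A (tail Q e)"
          "dim_row (rmap ?B e) = rdim ?B (head Q e)" "dim_col (rmap ?B e) = rdim ?B (tail Q e)"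
          by (rule is_rep_dims(2,3)[OF is_rep_interval e])+
        show ?thesis unfolding rmap_ext_rep[OF is_rep_interval is_rep_interval e]
        proof (rule eq_matI)
          fix x y assume xy: "x < dim_row (rmap ?U e)" "y < dim_col (rmap ?U e)"
          then have "rmap ?U e $$ (x,y) = 1" by (simp add: rmap_interval)
          moreover have "x < rdim ?B (head Q e) + rdim ?A (head Q e)" "y < rdim ?B (tail Q e) + rdim ?A (tail Q e)"
            using xy v[of "head Q e"] v[of "tail Q e"] unfolding d by linarith+
          ultimately show "four_block_mat (rmap ?B e) (\<psi>0 e) (0\<^sub>m (rdim ?A (head Q e)) (rdim ?B (tail Q e))) (rmap ?A e) $$ (x, y)
            = rmap ?U e $$ (x,y)" using fb by simp
        qed (simp_all add: d flip: v)
      qed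
      moreover have "rdim (ext_rep ?A ?B \<psi>0) v = rdim ?U v" for v
        using un[of v] disj by (auto simp: rdim_interval)
      ultimately have "rep_iso Q (ext_rep ?A ?B \<psi>0) ?U"
        by (intro rep_iso_eqI is_rep_ext_rep is_rep_interval)
      moreover have "1 \<le> Suc u" "Suc u \<le> w" "w \<le> m" using ij kl by (auto simp: u_def w_def)
      ultimately show ?thesis
        using indecomposable_cong[OF is_rep_ext_rep[OF is_rep_interval is_rep_interval] is_rep_interval] indecomposable_interval by blast
    qed
    ultimately show ?thesis unfolding rigid_pair_def by blast
  qed
qed

lemma rigid_pair_interval:
  assumes "i < j" "j \<le> m" "k < l" "l \<le> m" "\<not> crosses_down Hi Lo i j k l"
  shows "rigid_pair Q (I (Suc i) j) (I (Suc k) l :: (nat, nat, 'k::field) quiver_rep)"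
  using rigid_pair_disjoint[of i j k l] Ext1_zero_overlap[of i j k l] assms
  by (cases "max i k < min j l") (auto simp: rigid_pair_def)

lemma short_exact_overlap_decomposable:
  assumes se: "short_exact Q (I c d) (I a b :: (nat, nat, 'k::field) quiver_rep) (E, f, g)"
    and v: "v \<in> verts Q" "v \<in> {a..b}" "v \<in> {c..d}"
  shows "\<not> indecomposable Q E"
proof
  assume "indecomposable Q E"
  then obtain x y where "rep_iso Q E (I x y :: (nat, nat, 'k) quiver_rep)"
    using indecomposable_imp_interval by blast
  then have E1: "rdim E v \<le> 1" using rep_iso_rdim[of E _ v] v(1) by (metis rdim_interval_le)
  have d: "rdim (I c d :: (nat, nat, 'k) quiver_rep) v = 1" "rdim (I a b :: (nat, nat, 'k) quiver_rep) v = 1"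
    using v by (simp_all add: rdim_interval)
  have h: "is_hom Q (I c d) E f" "is_hom Q E (I a b :: (nat, nat, 'k) quiver_rep) g"
    and ex: "exact_pair (f v) (g v) 1 (rdim E v) 1"
    using se v(1) d unfolding short_exact_iff by (blast, blast, fastforce)
  have f: "f v \<in> carrier_mat (rdim E v) 1" and g: "g v \<in> carrier_mat 1 (rdim E v)"
    using is_hom_dims(1)[OF h(1) v(1)] is_hom_dims(1)[OF h(2) v(1)] unfolding d by blast+
  obtain s where s: "s \<in> carrier_mat (rdim E v) 1" "g v * s = 1\<^sub>m 1"
    using exact_section[OF f g ex] by blast
  have gf: "g v * f v = 0\<^sub>m 1 1" by (rule exact_comp_zero[OF f g ex])
  \<comment> \<open>Dimension 0 is impossible because \<open>g\<close> has a section. In dimension 1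
    the scalar of \<open>g\<close> is nonzero, so \<open>g * f = 0\<close> makes \<open>f\<close>
    zero, against its injectivity.\<close>
  have "rdim E v = 1"
  proof (rule ccontr)
    assume "rdim E v \<noteq> 1"
    then have "rdim E v = 0" using E1 by simp
    then have "(g v * s) $$ (0,0) = 0" using g s(1) by (simp add: scalar_prod_def)
    then show False using s(2) by simp
  qed
  then have c: "f v \<in> carrier_mat 1 1" "g v \<in> carrier_mat 1 1" "s \<in> carrier_mat 1 1" using f g s by simp_all
  have "g v $$ (0,0) * s $$ (0,0) = 1" "g v $$ (0,0) * f v $$ (0,0) = 0"
    using s(2) gf mat_mult_one_by_one[OF c(2,3)] mat_mult_one_by_one[OF c(2,1)] by simp_all
  then have "f v $$ (0,0) = 0" by auto
  then have "f v = 0\<^sub>m 1 1" using c(1) by (subst mat_one_by_one_eq_iff) auto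
  then have "vec 1 (\<lambda>_. 1) \<in> mat_kernel (f v)"
    unfolding mat_kernel_iff[OF c(1)] by (auto intro!: eq_vecI simp: scalar_prod_def)
  then have "vec 1 (\<lambda>_. 1) = (0\<^sub>v 1 :: 'k vec)" using ex unfolding exact_pair_def by blast
  then show False by (auto dest!: arg_cong[of _ _ "\<lambda>x. vec_index x 0"])
qed

text \<open>The shared vertex excludes an indecomposable middle term, so only vanishing of the
  extensions has to be refuted. A splitting would give scalars that are nonzero at the left end of
  the overlap, constant across it and zero at the right end.\<close>

lemma crosses_down_not_rigid:
  assumes ij: "i < j" "j \<le> m" and kl: "k < l" "l \<le> m" and cr: "crosses_down Hi Lo i j k l"
  shows "\<not> rigid_pair Q (I (Suc i) j) (I (Suc k) l :: (nat, nat, 'k::field) quiver_rep)"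
proof
  let ?A = "I (Suc i) j :: (nat, nat, 'k) quiver_rep" and ?B = "I (Suc k) l :: (nat, nat, 'k) quiver_rep"
  assume "rigid_pair Q ?A ?B"
  moreover have ov: "max i k < min j l" using cr by (simp add: crosses_down_def)
  have "Suc (max i k) \<in> verts Q" "Suc (max i k) \<in> {Suc i..j}" "Suc (max i k) \<in> {Suc k..l}"
    using ov ij kl by (auto simp: verts_Q)
  then have "\<not> (\<exists>E f g. indecomposable Q E \<and> Ext1_line_generated_by Q ?A ?B (E, f, g))"
    using short_exact_overlap_decomposable unfolding Ext1_line_generated_by_def by blast
  ultimately have zero: "Ext1_zero Q ?A ?B" unfolding rigid_pair_def by blast
  define p where "p = max i k"
  define q where "q = min j l"
  have pq: "p < q" using ov by (simp add: p_def q_def)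
  \<comment> \<open>Concentrated at the arrow \<open>p\<close>, where the left condition is imposed,
    so the system is homogeneous elsewhere.\<close>
  define \<psi> where "\<psi> e = (mat (rdim ?B (head Q e)) (rdim ?A (tail Q e)) (\<lambda>_. if e = p then 1 else 0) :: 'k mat)" for e
  have \<psi>: "cocycle Q ?A ?B \<psi>" by (simp add: cocycle_def \<psi>_def)
  have "split_ses Q ?A (ext_rep ?A ?B \<psi>, \<lambda>v. inc1 (rdim ?B v) (rdim ?A v), \<lambda>v. prj2 (rdim ?B v) (rdim ?A v))"
    using zero ext_rep_short_exact[OF is_rep_interval is_rep_interval \<psi>] unfolding Ext1_zero_def by blast
  then obtain \<sigma> where sh: "shifts Q ?A ?B \<psi> \<sigma> (\<lambda>a. 0\<^sub>m (rdim ?B (head Q a)) (rdim ?A (tail Q a)))"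
    using ext_rep_split_imp_shifts[OF is_rep_interval is_rep_interval \<psi>] by blast
  define s where "s v = \<sigma> v $$ (0,0)" for v
  have eq: "(if e = p then 1 else 0) + (if tail Q e \<in> {Suc k..l} then s (tail Q e) else 0)
      = (if head Q e \<in> {Suc i..j} then s (head Q e) else 0)"
    if "e \<in> arcs Q" "tail Q e \<in> {Suc i..j}" "head Q e \<in> {Suc k..l}" for e
  proof -
    have x: "\<psi> e $$ (0,0) = (if e = p then 1 else 0)"
      "(0\<^sub>m (rdim ?B (head Q e)) (rdim ?A (tail Q e)) :: 'k mat) $$ (0,0) = 0"
      using that by (simp_all add: \<psi>_def rdim_interval)
    show ?thesis
      using shifts_intervalD[OF \<psi> cocycle_zero sh that] unfolding s_def x add_0_right .
  qed
  have start: "s (Suc p) \<noteq> 0"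
  proof -
    have "i < k \<and> k \<in> Hi \<or> k < i \<and> i \<in> Lo" using cr by (simp add: crosses_down_def)
    then show ?thesis
    proof
      assume "i < k \<and> k \<in> Hi"
      then show ?thesis using eq[of p] ov by (auto simp: Hi_iff p_def)
    next
      assume "k < i \<and> i \<in> Lo"
      then show ?thesis using eq[of p] ov by (auto simp: Lo_iff p_def)
    qed
  qed
  have step: "s (Suc e) = s e" if e: "p < e" "e < q" for e
  proof -
    have arc: "e \<in> arcs Q" using e ij kl by (auto simp: arcs_Q p_def q_def)
    show ?thesis using eq[OF arc] e by (cases rule: arc_cases[OF arc]) (auto simp: p_def q_def split: if_splits)
  qed
  have const: "s v = s (Suc p)" if "Suc p \<le> v" "v \<le> q" for v
    using that by (induction v rule: dec_induct) (auto simp: step)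
  have "l < j \<and> l \<in> Lo \<or> j < l \<and> j \<in> Hi" using cr by (simp add: crosses_down_def)
  then have "s q = 0"
  proof
    assume "l < j \<and> l \<in> Lo"
    then show ?thesis using eq[of q] pq ov by (auto simp: Lo_iff p_def q_def split: if_splits)
  next
    assume "j < l \<and> j \<in> Hi"
    then show ?thesis using eq[of q] pq ov by (auto simp: Hi_iff p_def q_def split: if_splits)
  qed
  then show False using const[of q] pq start by simp
qed

end

section \<open>Paths and segments in the polygon\<close>

definition consecutive :: "nat set \<Rightarrow> nat \<Rightarrow> nat \<Rightarrow> bool" where
  "consecutive S i j \<longleftrightarrow> i \<in> S \<and> j \<in> S \<and> i < j \<and> (\<forall>k. i < k \<longrightarrow> k < j \<longrightarrow> k \<notin> S)"

text \<open>Removes list positions from the picture: from here on a path is just its set of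
  vertices.\<close>

lemma sorted_list_consecutive:
  assumes "finite S"
  shows "(\<exists>k. Suc k < length (sorted_list_of_set S) \<and> sorted_list_of_set S ! k = i \<and> sorted_list_of_set S ! Suc k = j)
    \<longleftrightarrow> consecutive S i j" (is "?l \<longleftrightarrow> ?r")
proof -
  let ?xs = "sorted_list_of_set S"
  have set: "set ?xs = S" and mono: "\<And>a b. a < b \<Longrightarrow> b < length ?xs \<Longrightarrow> ?xs ! a < ?xs ! b"
    using assms strict_sorted_list_of_set[of S] by (auto simp: sorted_wrt_nth_less)
  show ?thesis
  proof
    assume ?l
    then obtain k where k: "Suc k < length ?xs" "?xs ! k = i" "?xs ! Suc k = j" by blast
    have "x \<notin> S" if x: "i < x" "x < j" for x
    proof
      assume "x \<in> S"
      then obtain c where c: "c < length ?xs" "?xs ! c = x" using set by (metis in_set_conv_nth)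
      have "\<not> c \<le> k" using mono[of c k] c k x by (cases "c = k") auto
      moreover have "\<not> Suc k \<le> c" using mono[of "Suc k" c] c k x by (cases "c = Suc k") auto
      ultimately show False by simp
    qed
    then show ?r using k mono[of k "Suc k"] set unfolding consecutive_def by (metis Suc_lessD lessI nth_mem)
  next
    assume r: ?r
    then obtain a b where a: "a < length ?xs" "?xs ! a = i" and b: "b < length ?xs" "?xs ! b = j"
      using set unfolding consecutive_def by (metis in_set_conv_nth)
    have "a < b"
    proof (rule ccontr)
      assume "\<not> a < b"
      then have "?xs ! b \<le> ?xs ! a" using mono[of b a] a by (cases "a = b") auto
      then show False using r a b by (simp add: consecutive_def)
    qed
    moreover have "\<not> Suc a < b"
    proof
      assume "Suc a < b"
      then have "i < ?xs ! Suc a" "?xs ! Suc a < j" "?xs ! Suc a \<in> S"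
        using mono[of a "Suc a"] mono[of "Suc a" b] a b set nth_mem[of "Suc a" ?xs] by auto
      then show False using r by (simp add: consecutive_def)
    qed
    ultimately have "b = Suc a" by simp
    then show ?l using a b by blast
  qed
qed

text \<open>Reflection in the horizontal line exchanges upper with lower vertices and above with
  below.\<close>

lemma crosses_down_swap: "crosses_down U H i j k l \<longleftrightarrow> crosses_down H U k l i j"
  by (auto simp: crosses_down_def max.commute min.commute)

text \<open>The two disjunctions say that the path with vertex set \<open>P\<close> runs below the segment \<open>\<gamma>(i,j)\<close> at \<open>k\<^sub>1\<close>
  and above it at \<open>k\<^sub>2\<close>.\<close>

lemma path_edge_crosses:
  assumes P: "0 \<in> P" "N \<in> P" and ij: "i < j" "j \<le> N" and disj: "H \<inter> U = {}"
    and PHU: "\<And>w. w \<in> P \<Longrightarrow> 0 < w \<Longrightarrow> w < N \<Longrightarrow> w \<in> H \<or> w \<in> U"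
    and k12: "k1 < k2"
    and k1: "k1 = i \<and> i \<in> H \<and> i \<notin> P \<or> i < k1 \<and> k1 < j \<and> k1 \<in> U \<and> k1 \<in> P"
    and k2: "k2 = j \<and> j \<in> U \<and> j \<notin> P \<or> i < k2 \<and> k2 < j \<and> k2 \<in> H \<and> k2 \<in> P"
  shows "\<exists>u v. consecutive P u v \<and> crosses_down H U u v i j"
proof -
  \<comment> \<open>The crossing edge ends at the first path vertex after \<open>k1\<close> that is
    above the segment or no longer to the left of \<open>j\<close>; \<open>u\<close> is its
    predecessor on the path.\<close>
  let ?good = "\<lambda>w. w \<in> P \<and> k1 < w \<and> (j \<le> w \<or> w \<in> H)"
  define v where "v = (LEAST w. ?good w)"
  have bd: "i \<le> k1" "k2 \<le> j" "k1 < j" using k1 k2 k12 ij by auto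
  have "?good N" using P bd ij by auto
  then have v: "?good v" unfolding v_def by (rule LeastI)
  have least: "\<not> ?good w" if "w < v" for w using that not_less_Least[of w ?good] by (simp add: v_def)
  define u where "u = Max {w \<in> P. w < v}"
  have fin: "finite {w \<in> P. w < v}" by simp
  have "0 \<in> {w \<in> P. w < v}" using P v by auto
  then have u: "u \<in> P" "u < v" and umax: "\<And>w. w \<in> P \<Longrightarrow> w < v \<Longrightarrow> w \<le> u"
    using Max_in[OF fin] Max_ge[OF fin] unfolding u_def by (blast, blast, simp)
  have cons: "consecutive P u v"
    unfolding consecutive_def using u v umax by (metis leD)
  have uj: "u < j"
    using least[OF u(2)] u(1) bd by (cases "k1 < u") auto
  \<comment> \<open>The edge starts below the segment: \<open>u\<close> either comes after
    \<open>k1\<close> without being good, or equals \<open>k1\<close>, or passes below the endpoint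
    \<open>i\<close>.\<close>
  have start: "u < i \<and> i \<in> H \<or> i < u \<and> u \<in> U"
  proof (cases "k1 < u")
    case True
    then have "u \<notin> H" using least[OF u(2)] u(1) by auto
    then show ?thesis using PHU[OF u(1)] True bd uj ij by auto
  next
    case False
    show ?thesis
    proof (cases "k1 \<in> P")
      case True
      then have "u = k1" using umax[OF True] v False by simp
      then show ?thesis using k1 True by auto
    next
      case k: False
      then have "k1 = i" "i \<in> H" using k1 by auto
      moreover have "u \<noteq> k1" using k u by auto
      ultimately show ?thesis using False by auto
    qed
  qed
  have fin: "j < v \<and> j \<in> U \<or> v < j \<and> v \<in> H"
  proof (cases "v < j")
    case True
    then show ?thesis using v by auto
  next
    case False
    \<comment> \<open>An interior \<open>k2\<close> would have been an earlier candidate for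
      \<open>v\<close>.\<close>
    have "k2 = j"
    proof (rule ccontr)
      assume "k2 \<noteq> j"
      then have "?good k2" "k2 < j" using k2 k12 by auto
      then show False using least[of k2] False by auto
    qed
    then have "j \<in> U" "j \<notin> P" using k2 by auto
    then show ?thesis using v False by (metis linorder_neqE_nat)
  qed
  have "max u i < min v j" using u uj v bd ij by auto
  then have "crosses_down H U u v i j" using start fin by (auto simp: crosses_down_def)
  with cons show ?thesis by blast
qed

text \<open>The sets \<open>S 0, \<dots>, S T\<close> are the vertex sets of the successive paths.\<close>

locale path_family =
  fixes N T :: nat and S :: "nat \<Rightarrow> nat set" and H U :: "nat set" and \<pi> :: "nat \<Rightarrow> nat"
  assumes ends: "0 \<in> S r" "N \<in> S r" and SHU: "w \<in> S r \<Longrightarrow> 0 < w \<Longrightarrow> w < N \<Longrightarrow> w \<in> H \<or> w \<in> U"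
    and HU: "H \<inter> U = {}" "H \<union> U = {0<..<N}"
    and S_first: "w \<in> H \<Longrightarrow> w \<notin> S 0" "w \<in> U \<Longrightarrow> w \<in> S 0"
    and S_last: "w \<in> H \<Longrightarrow> w \<in> S T" "w \<in> U \<Longrightarrow> w \<notin> S T"
    and S_step: "w \<noteq> \<pi> (Suc r) \<Longrightarrow> w \<in> S (Suc r) \<longleftrightarrow> w \<in> S r"
    and S_mono_H: "w \<in> H \<Longrightarrow> r \<le> r' \<Longrightarrow> w \<in> S r \<Longrightarrow> w \<in> S r'"
    and S_mono_U: "w \<in> U \<Longrightarrow> r \<le> r' \<Longrightarrow> w \<in> S r' \<Longrightarrow> w \<in> S r"
begin

definition edge :: "nat \<Rightarrow> nat \<Rightarrow> bool" where
  "edge i j \<longleftrightarrow> (\<exists>r\<le>T. consecutive (S r) i j)"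

text \<open>The left ends, where \<open>\<gamma>(k,l)\<close> is above, force its path to come
  strictly later than that of \<open>\<gamma>(i,j)\<close>; the right ends force it to come strictly
  earlier.\<close>

lemma edges_noncrossing:
  assumes "edge i j" "edge k l"
  shows "\<not> crosses_down H U i j k l"
proof
  assume c: "crosses_down H U i j k l"
  obtain r r' where r: "consecutive (S r) i j" and r': "consecutive (S r') k l"
    using assms by (auto simp: edge_def)
  have ov: "max i k < min j l" using c by (simp add: crosses_down_def)
  have "\<not> r' \<le> r"
  proof
    assume le: "r' \<le> r"
    from c consider "i < k" "k \<in> H" | "k < i" "i \<in> U" by (auto simp: crosses_down_def)
    then show False
    proof cases
      case 1
      then have "k \<in> S r" using S_mono_H[OF _ le] r' by (simp add: consecutive_def)
      then show False using r 1 ov by (auto simp: consecutive_def)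
    next
      case 2
      then have "i \<in> S r'" using S_mono_U[OF _ le] r by (simp add: consecutive_def)
      then show False using r' 2 ov by (auto simp: consecutive_def)
    qed
  qed
  moreover have "\<not> r \<le> r'"
  proof
    assume le: "r \<le> r'"
    from c consider "l < j" "l \<in> U" | "j < l" "j \<in> H" by (auto simp: crosses_down_def)
    then show False
    proof cases
      case 1
      then have "l \<in> S r" using S_mono_U[OF _ le] r' by (simp add: consecutive_def)
      then show False using r 1 ov by (auto simp: consecutive_def)
    next
      case 2
      then have "j \<in> S r'" using S_mono_H[OF _ le] r by (simp add: consecutive_def)
      then show False using r' 2 ov by (auto simp: consecutive_def)
    qed
  qed
  ultimately show False by simp
qed

text \<open>The first path is nowhere above the segment and the last nowhere below it. Take the
  first path that is nowhere below; it must be above somewhere, or the segment would be one of its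
  edges. Its predecessor was still below at one vertex, and as only that vertex changes, it was
  already above at another.\<close>

lemma non_edge_crosses:
  assumes ij: "i < j" "j \<le> N" and ne: "\<not> edge i j"
  shows "\<exists>u v. edge u v \<and> (crosses_down H U u v i j \<or> crosses_down H U i j u v)"
proof -
  \<comment> \<open>The \<open>r\<close>-th path runs below the segment at \<open>k\<close>. An
    endpoint counts if it is an upper vertex which the path misses, for then the path passes under
    it.\<close>
  define low where "low r k \<longleftrightarrow> (k = i \<or> k = j) \<and> k \<in> H \<and> k \<notin> S r \<or> i < k \<and> k < j \<and> k \<in> U \<and> k \<in> S r" for r k
  define high where "high r k \<longleftrightarrow> (k = i \<or> k = j) \<and> k \<in> U \<and> k \<notin> S r \<or> i < k \<and> k < j \<and> k \<in> H \<and> k \<in> S r" for r k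
  \<comment> \<open>A path that is neither below nor above the segment at any vertex contains it as
    an edge.\<close>
  have between: "consecutive (S r) i j" if nl: "\<And>k. \<not> low r k" and nh: "\<And>k. \<not> high r k" for r
  proof -
    have HUm: "k \<in> H \<or> k \<in> U" if "0 < k" "k < N" for k
    proof -
      have "k \<in> H \<union> U" unfolding HU(2) using that by simp
      then show ?thesis by blast
    qed
    have "k \<in> S r" if "k = i \<or> k = j" for k
    proof (cases "k = 0 \<or> k = N")
      case True
      then show ?thesis using ends by auto
    next
      case False
      then have "k \<in> H \<or> k \<in> U" using HUm[of k] ij that by auto
      then show ?thesis using nl[of k] nh[of k] that by (auto simp: low_def high_def)
    qed
    moreover have "k \<notin> S r" if "i < k" "k < j" for k
      using HUm[of k] that ij nl[of k] nh[of k] by (auto simp: low_def high_def)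
    ultimately show ?thesis using ij by (auto simp: consecutive_def)
  qed
  have "\<exists>r<T. (\<exists>k. low r k) \<and> (\<exists>k. high r k)"
  proof -
    let ?none = "\<lambda>r. \<forall>k. \<not> low r k"
    define r where "r = (LEAST r. ?none r)"
    have "?none T" using S_last by (auto simp: low_def)
    then have r: "?none r" "r \<le> T" unfolding r_def by (rule LeastI, rule Least_le)
    have hr: "\<exists>k. high r k"
    proof (rule ccontr)
      assume "\<not> (\<exists>k. high r k)"
      then have "consecutive (S r) i j" using between r(1) by blast
      then show False using ne r(2) by (auto simp: edge_def)
    qed
    have "\<not> high 0 k" for k using S_first[of k] by (auto simp: high_def)
    then have "r \<noteq> 0" using hr by metis
    then obtain r' where r': "r = Suc r'" by (cases r) auto
    then have "\<not> ?none r'" using not_less_Least[of r' ?none] by (simp add: r_def)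
    then obtain k1 where k1: "low r' k1" by blast
    \<comment> \<open>\<open>k1\<close> stops being low in this step, so its membership in the path
      changes, and only one vertex changes per step.\<close>
    then have "k1 = \<pi> r" using S_step[of k1 r'] r(1) r' by (auto simp: low_def)
    moreover obtain k2 where k2: "high r k2" using hr by blast
    have "k2 \<noteq> k1" using k1 k2 HU(1) ij by (auto simp: low_def high_def)
    ultimately have "high r' k2" using S_step[of k2 r'] k2 r' by (auto simp: high_def)
    then show ?thesis using k1 r(2) r' by (intro exI[of _ r']) auto
  qed
  then obtain r k1 k2 where r: "r < T" "low r k1" "high r k2" by blast
  have bd: "i \<le> k1" "k1 \<le> j" "i \<le> k2" "k2 \<le> j" "k1 \<noteq> k2"
    using r ij HU(1) by (auto simp: low_def high_def)
  have "\<exists>u v. consecutive (S r) u v \<and> (crosses_down H U u v i j \<or> crosses_down H U i j u v)"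
  proof (cases "k1 < k2")
    case True
    have "\<exists>u v. consecutive (S r) u v \<and> crosses_down H U u v i j"
      by (rule path_edge_crosses[OF ends ij HU(1) SHU True]) (use r True bd in \<open>auto simp: low_def high_def\<close>)
    then show ?thesis by blast
  next
    case False
    then have lt: "k2 < k1" using bd by simp
    \<comment> \<open>Here the path goes from above to below; reflection reduces this to the case
      already treated.\<close>
    have "\<exists>u v. consecutive (S r) u v \<and> crosses_down U H u v i j"
    proof (rule path_edge_crosses[OF ends ij _ _ lt])
      show "U \<inter> H = {}" using HU(1) by blast
      show "w \<in> U \<or> w \<in> H" if "w \<in> S r" "0 < w" "w < N" for w using SHU that by blast
    qed (use r lt bd in \<open>auto simp: low_def high_def\<close>)
    then show ?thesis using crosses_down_swap by blast
  qed
  then show ?thesis using r(1) unfolding edge_def by (meson less_imp_le)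
qed

end

section \<open>The paths of a permutation as such a family\<close>

lemma over_under:
  assumes "dynkin_A (n + 2) Q"
  shows "over n Q \<union> under n Q = {1..n + 1}" "over n Q \<inter> under n Q = {}"
proof -
  have "tail Q i = i \<and> head Q i = i + 1 \<or> tail Q i = i + 1 \<and> head Q i = i" if "i \<in> {1..n + 1}" for i
    using assms that by (auto simp: dynkin_A_def)
  then show "over n Q \<union> under n Q = {1..n + 1}" unfolding over_def under_def by blast
  show "over n Q \<inter> under n Q = {}" by (auto simp: over_def under_def)
qed

lemma lam_inner_iff:
  assumes "dynkin_A (n + 2) Q"
  shows "k \<in> lam_inner n Q \<pi> l \<longleftrightarrow> k \<in> over n Q \<and> k \<in> \<pi> ` {1..l} \<or> k \<in> under n Q \<and> k \<notin> \<pi> ` {1..l}"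
proof (induction l)
  case (Suc l)
  have "\<pi> ` {1..Suc l} = insert (\<pi> (Suc l)) (\<pi> ` {1..l})" by (simp add: atLeastAtMostSuc_conv)
  then show ?case using Suc over_under(2)[OF assms] by auto
qed simp

definition lam_verts :: "nat \<Rightarrow> (nat, nat) pre_digraph \<Rightarrow> (nat \<Rightarrow> nat) \<Rightarrow> nat \<Rightarrow> nat set" where
  "lam_verts n Q \<pi> l = {0, n + 2} \<union> lam_inner n Q \<pi> l"

lemma path_family_lam:
  assumes dyn: "dynkin_A (n + 2) Q" and perm: "\<pi> permutes {1..n + 1}"
  shows "path_family (n + 2) (n + 1) (lam_verts n Q \<pi>) (over n Q) (under n Q) \<pi>"
proof -
  note HU = over_under[OF dyn]
  have range: "w \<in> {1..n + 1}" if "w \<in> over n Q \<or> w \<in> under n Q" for w using HU(1) that by blast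
  have im: "\<pi> ` {1..n + 1} = {1..n + 1}" using perm by (rule permutes_image)
  have iff: "w \<in> lam_verts n Q \<pi> l \<longleftrightarrow> w = 0 \<or> w = n + 2 \<or>
      w \<in> over n Q \<and> w \<in> \<pi> ` {1..l} \<or> w \<in> under n Q \<and> w \<notin> \<pi> ` {1..l}" for w l
    by (simp add: lam_verts_def lam_inner_iff[OF dyn])
  have bd: "w \<noteq> 0" "w \<noteq> n + 2" if "w \<in> over n Q \<or> w \<in> under n Q" for w using range[OF that] by auto
  have imSuc: "\<pi> ` {1..Suc l} = insert (\<pi> (Suc l)) (\<pi> ` {1..l})" for l by (simp add: atLeastAtMostSuc_conv)
  have imono: "\<pi> ` {1..r} \<subseteq> \<pi> ` {1..r'}" if "r \<le> r'" for r r' using that by (intro image_mono) auto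
  show ?thesis
  proof
    fix w r r'
    show "0 \<in> lam_verts n Q \<pi> r" "n + 2 \<in> lam_verts n Q \<pi> r" by (simp_all add: iff)
    show "w \<in> lam_verts n Q \<pi> r \<Longrightarrow> 0 < w \<Longrightarrow> w < n + 2 \<Longrightarrow> w \<in> over n Q \<or> w \<in> under n Q"
      by (auto simp: iff)
    show "over n Q \<inter> under n Q = {}" by (rule HU(2))
    show "over n Q \<union> under n Q = {0<..<n + 2}" using HU(1) by auto
    show "w \<in> over n Q \<Longrightarrow> w \<notin> lam_verts n Q \<pi> 0" "w \<in> under n Q \<Longrightarrow> w \<in> lam_verts n Q \<pi> 0"
      using bd[of w] HU(2) by (auto simp: iff)
    show "w \<in> over n Q \<Longrightarrow> w \<in> lam_verts n Q \<pi> (n + 1)" "w \<in> under n Q \<Longrightarrow> w \<notin> lam_verts n Q \<pi> (n + 1)"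
      using bd[of w] HU(2) range[of w] im by (auto simp: iff)
    show "w \<noteq> \<pi> (Suc r) \<Longrightarrow> (w \<in> lam_verts n Q \<pi> (Suc r)) = (w \<in> lam_verts n Q \<pi> r)"
      unfolding iff imSuc by simp
    show "w \<in> over n Q \<Longrightarrow> r \<le> r' \<Longrightarrow> w \<in> lam_verts n Q \<pi> r \<Longrightarrow> w \<in> lam_verts n Q \<pi> r'"
      using imono[of r r'] HU(2) by (auto simp: iff)
    show "w \<in> under n Q \<Longrightarrow> r \<le> r' \<Longrightarrow> w \<in> lam_verts n Q \<pi> r' \<Longrightarrow> w \<in> lam_verts n Q \<pi> r"
      using imono[of r r'] HU(2) by (auto simp: iff)
  qed
qed

section \<open>Segments as graphs of affine functions\<close>

definition height :: "real \<times> real \<Rightarrow> real \<times> real \<Rightarrow> real \<Rightarrow> real" where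
  "height a b x = snd a + (x - fst a) / (fst b - fst a) * (snd b - snd a)"

lemma height_ends: "fst a < fst b \<Longrightarrow> height a b (fst a) = snd a" "fst a < fst b \<Longrightarrow> height a b (fst b) = snd b"
  by (simp_all add: height_def)

lemma mem_closed_segment_height:
  assumes "fst a < fst b"
  shows "z \<in> closed_segment a b \<longleftrightarrow> fst a \<le> fst z \<and> fst z \<le> fst b \<and> snd z = height a b (fst z)"
proof
  assume "z \<in> closed_segment a b"
  then obtain t where t: "0 \<le> t" "t \<le> 1" "z = (1 - t) *\<^sub>R a + t *\<^sub>R b" by (auto simp: in_segment)
  have f: "fst z - fst a = t * (fst b - fst a)" by (simp add: t(3)) (simp add: algebra_simps)
  have s: "snd z - snd a = t * (snd b - snd a)" by (simp add: t(3)) (simp add: algebra_simps)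
  have "t = (fst z - fst a) / (fst b - fst a)" using f assms by (simp add: field_simps)
  then have "snd z = height a b (fst z)" using s by (simp add: height_def)
  moreover have "0 \<le> t * (fst b - fst a)" "t * (fst b - fst a) \<le> fst b - fst a"
    using t assms by (auto intro: mult_left_le_one_le)
  ultimately show "fst a \<le> fst z \<and> fst z \<le> fst b \<and> snd z = height a b (fst z)" using f by simp
next
  assume z: "fst a \<le> fst z \<and> fst z \<le> fst b \<and> snd z = height a b (fst z)"
  define t where "t = (fst z - fst a) / (fst b - fst a)"
  have "0 \<le> t" "t \<le> 1" using z assms by (auto simp: t_def)
  moreover have "t * (fst b - fst a) = fst z - fst a" using assms by (simp add: t_def)
  then have "fst z = (1 - t) * fst a + t * fst b" by (simp add: algebra_simps)
  moreover have "snd z = (1 - t) * snd a + t * snd b"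
    using z by (simp add: height_def t_def[symmetric] algebra_simps)
  ultimately show "z \<in> closed_segment a b" by (auto simp: in_segment prod_eq_iff intro!: exI[of _ t])
qed

lemma mem_rel_interior_segment_height:
  assumes "fst a < fst b"
  shows "z \<in> rel_interior (closed_segment a b) \<longleftrightarrow> fst a < fst z \<and> fst z < fst b \<and> snd z = height a b (fst z)"
proof -
  have "a \<noteq> b" using assms by auto
  then have 1: "z \<in> rel_interior (closed_segment a b) \<longleftrightarrow> z \<in> closed_segment a b \<and> z \<noteq> a \<and> z \<noteq> b"
    by (simp add: rel_interior_closed_segment open_segment_def)
  have 2: "z = a \<longleftrightarrow> fst z = fst a" "z = b \<longleftrightarrow> fst z = fst b" if "snd z = height a b (fst z)"
    using that height_ends[OF assms] by (auto simp: prod_eq_iff)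
  show ?thesis
  proof (cases "snd z = height a b (fst z)")
    case True
    show ?thesis unfolding 1 mem_closed_segment_height[OF assms] 2(1)[OF True] 2(2)[OF True] less_le by metis
  next
    case False
    then show ?thesis unfolding 1 mem_closed_segment_height[OF assms] by blast
  qed
qed

text \<open>Applied to the difference of the heights of two segments over their common span: whether
  they meet there is decided by the signs at its two ends.\<close>

lemma affine_root_iff:
  fixes x0 x1 c s :: real
  assumes "x0 < x1"
  shows "(\<exists>x. x0 < x \<and> x < x1 \<and> c + s * x = 0) \<longleftrightarrow>
    0 < c + s * x0 \<and> c + s * x1 < 0 \<or> c + s * x0 < 0 \<and> 0 < c + s * x1 \<or> c + s * x0 = 0 \<and> c + s * x1 = 0"
proof (cases "s = 0")
  case True
  then show ?thesis using assms dense[OF assms] by auto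
next
  case False
  define r where "r = - c / s"
  have "c + s * x = s * (x - r)" for x using False by (simp add: r_def algebra_simps)
  then show ?thesis
    using False assms by (auto simp: zero_less_mult_iff mult_less_0_iff)
qed

locale polygon =
  fixes n :: nat and Q :: "(nat, nat) pre_digraph" and p :: "nat \<Rightarrow> real \<times> real"
  assumes dyn: "dynkin_A (n + 2) Q" and poly: "polygon_P n Q p"
begin

lemma fst_less: "i < j \<Longrightarrow> j \<le> n + 2 \<Longrightarrow> fst (p i) < fst (p j)"
  using poly by (simp add: polygon_P_def)

text \<open>If \<open>p\<^sub>k\<close> were not above \<open>\<gamma>(i,j)\<close>, it would lie vertically between that segment and the
  horizontal line through \<open>p\<^sub>0\<close> and \<open>p\<^sub>n\<^sub>+\<^sub>2\<close>, hence in the convex hull of the other corners.\<close>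

lemma vertex_vs_segment:
  assumes ikj: "i < k" "k < j" "j \<le> n + 2"
  shows "k \<in> over n Q \<Longrightarrow> height (p i) (p j) (fst (p k)) < snd (p k)"
    and "k \<in> under n Q \<Longrightarrow> snd (p k) < height (p i) (p j) (fst (p k))"
proof -
  let ?x = "fst (p k)" and ?C = "convex hull (p ` ({..n + 2} - {k}))"
  have seg: "closed_segment (p a) (p b) \<subseteq> ?C" if "a \<le> n + 2" "b \<le> n + 2" "a \<noteq> k" "b \<noteq> k" for a b
    using that by (intro closed_segment_subset convex_convex_hull hull_inc) auto
  have out: "p k \<notin> ?C" using poly ikj by (simp add: polygon_P_def)
  have 1: "(?x, height (p i) (p j) ?x) \<in> ?C"
    using seg[of i j] ikj fst_less[of i k] fst_less[of k j]
      mem_closed_segment_height[of "p i" "p j" "(?x, height (p i) (p j) ?x)"] by auto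
  have y: "snd (p (n + 2)) = snd (p 0)" using poly by (simp add: polygon_P_def)
  have "height (p 0) (p (n + 2)) ?x = snd (p 0)" using y by (simp add: height_def)
  then have 2: "(?x, snd (p 0)) \<in> ?C"
    using seg[of 0 "n + 2"] ikj fst_less[of 0 k] fst_less[of k "n + 2"]
      mem_closed_segment_height[of "p 0" "p (n + 2)" "(?x, snd (p 0))"] by auto
  \<comment> \<open>Both bounds are heights of points of the hull on the vertical line through the
    vertex. The lower inequality is strict so that the quotient \<open>t\<close> is
    meaningful.\<close>
  have mid: "p k \<in> ?C" if y: "y1 \<in> {snd (p 0), height (p i) (p j) ?x}" "y2 \<in> {snd (p 0), height (p i) (p j) ?x}"
    "y1 < snd (p k)" "snd (p k) \<le> y2" for y1 y2
  proof -
    define t where "t = (snd (p k) - y1) / (y2 - y1)"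
    have t: "0 \<le> t" "t \<le> 1" using y by (auto simp: t_def)
    have "t * (y2 - y1) = snd (p k) - y1" using y by (simp add: t_def)
    then have "snd (p k) = (1 - t) * y1 + t * y2" by (simp add: algebra_simps)
    then have "p k = (1 - t) *\<^sub>R (?x, y1) + t *\<^sub>R (?x, y2)" by (simp add: prod_eq_iff algebra_simps)
    moreover have "(?x, y1) \<in> ?C" "(?x, y2) \<in> ?C" using 1 2 y(1,2) by auto
    ultimately show ?thesis
      using t convexD_alt[OF convex_convex_hull] by metis
  qed
  show "height (p i) (p j) ?x < snd (p k)" if "k \<in> over n Q"
    using mid[of "snd (p 0)" "height (p i) (p j) ?x"] out poly that by (force simp: polygon_P_def)
  show "snd (p k) < height (p i) (p j) ?x" if "k \<in> under n Q"
  proof (rule ccontr)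
    assume "\<not> ?thesis"
    then have le: "height (p i) (p j) ?x \<le> snd (p k)" by simp
    have lt: "snd (p k) < snd (p 0)" using poly that by (simp add: polygon_P_def)
    have "p k \<in> ?C"
    \<comment> \<open>Equality is treated apart because \<open>mid\<close> needs a strict lower
      bound.\<close>
    proof (cases "height (p i) (p j) ?x = snd (p k)")
      case True
      then have "p k = (?x, height (p i) (p j) ?x)" by (simp add: prod_eq_iff)
      then show ?thesis using 1 by simp
    next
      case False
      then show ?thesis using mid[of "height (p i) (p j) ?x" "snd (p 0)"] le lt by simp
    qed
    with out show False by simp
  qed
qed

lemma seg_inject:
  assumes "i < j" "j \<le> n + 2" "k < l" "l \<le> n + 2"
  shows "seg p i j = seg p k l \<longleftrightarrow> i = k \<and> j = l"
proof
  have ne: "fst (p a) \<noteq> fst (p b)" if "a \<noteq> b" "a \<le> n + 2" "b \<le> n + 2" for a b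
    using fst_less[of a b] fst_less[of b a] that by (cases "a < b") auto
  assume "seg p i j = seg p k l"
  then have "{p i, p j} = {p k, p l}" by (simp add: seg_def closed_segment_eq)
  then have "p i = p k \<and> p j = p l \<or> p i = p l \<and> p j = p k" by (auto simp: doubleton_eq_iff)
  then show "i = k \<and> j = l"
  proof
    assume "p i = p k \<and> p j = p l"
    then show ?thesis using ne[of i k] ne[of j l] assms by auto
  next
    assume "p i = p l \<and> p j = p k"
    then show ?thesis using fst_less[of i j] fst_less[of k l] assms by auto
  qed
qed simp

text \<open>Over the common span the segments meet iff their order is reversed between its ends, or
  they agree at both. At each end one of the segments has an endpoint, so
  \<open>vertex_vs_segment\<close> decides which is higher by the type of that vertex.\<close>

lemma crossing_iff:
  assumes ij: "i < j" "j \<le> n + 2" and kl: "k < l" "l \<le> n + 2"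
  shows "crossing (seg p i j) (seg p k l) \<longleftrightarrow>
    crosses_down (over n Q) (under n Q) i j k l \<or> crosses_down (over n Q) (under n Q) k l i j"
proof -
  let ?H = "over n Q" and ?U = "under n Q"
  note fij = fst_less[OF ij] and fkl = fst_less[OF kl]
  have mono: "a \<le> b \<Longrightarrow> b \<le> n + 2 \<Longrightarrow> fst (p a) \<le> fst (p b)" for a b
    using fst_less[of a b] by (cases "a = b") auto
  have inter: "rel_interior (seg p i j) \<inter> rel_interior (seg p k l) \<noteq> {} \<longleftrightarrow>
    (\<exists>x. fst (p (max i k)) < x \<and> x < fst (p (min j l)) \<and> height (p k) (p l) x - height (p i) (p j) x = 0)"
  proof -
    have mx: "fst (p (max i k)) < x \<longleftrightarrow> fst (p i) < x \<and> fst (p k) < x" for x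
      using mono[of i k] mono[of k i] ij kl by (auto simp: max_def)
    have mn: "x < fst (p (min j l)) \<longleftrightarrow> x < fst (p j) \<and> x < fst (p l)" for x
      using mono[of j l] mono[of l j] ij kl by (auto simp: min_def)
    have "rel_interior (seg p i j) \<inter> rel_interior (seg p k l) \<noteq> {} \<longleftrightarrow>
      (\<exists>x y. (x, y) \<in> rel_interior (seg p i j) \<and> (x, y) \<in> rel_interior (seg p k l))" by auto
    also have "\<dots> \<longleftrightarrow> (\<exists>x. fst (p (max i k)) < x \<and> x < fst (p (min j l)) \<and> height (p k) (p l) x - height (p i) (p j) x = 0)"
      unfolding seg_def mem_rel_interior_segment_height[OF fij] mem_rel_interior_segment_height[OF fkl] mx mn by auto
    finally show ?thesis .
  qed
  show ?thesis
  proof (cases "max i k < min j l")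
    case False
    then have "fst (p (min j l)) \<le> fst (p (max i k))" using ij kl by (intro mono) auto
    then have "rel_interior (seg p i j) \<inter> rel_interior (seg p k l) = {}" using inter by force
    then show ?thesis using False by (auto simp: crossing_def crosses_down_def max.commute min.commute)
  next
    case True
    let ?x0 = "fst (p (max i k))" and ?x1 = "fst (p (min j l))"
    let ?d = "\<lambda>x. height (p k) (p l) x - height (p i) (p j) x"
    have affine: "\<exists>c s. \<forall>x. height a b x = c + s * x" for a b
      by (intro exI[of _ "snd a - fst a * ((snd b - snd a) / (fst b - fst a))"] exI[of _ "(snd b - snd a) / (fst b - fst a)"])
        (simp add: height_def algebra_simps add_divide_distrib diff_divide_distrib)
    obtain c1 s1 where 1: "\<And>x. height (p i) (p j) x = c1 + s1 * x" using affine by blast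
    obtain c2 s2 where 2: "\<And>x. height (p k) (p l) x = c2 + s2 * x" using affine by blast
    have d: "?d x = (c2 - c1) + (s2 - s1) * x" for x unfolding 1 2 by (simp add: algebra_simps)
    have HU: "v \<in> ?H \<or> v \<in> ?U" if "0 < v" "v < n + 2" for v
    proof -
      have "v \<in> ?H \<union> ?U" unfolding over_under(1)[OF dyn] using that by simp
      then show ?thesis by blast
    qed
    have disj: "\<not> (v \<in> ?H \<and> v \<in> ?U)" for v using over_under(2)[OF dyn] by blast
    \<comment> \<open>\<open>?L\<close> and \<open>?R\<close> say that \<open>\<gamma>(k,l)\<close>
      is above at the left end and below at the right end of the span; \<open>?L'\<close> and
      \<open>?R'\<close> are the opposite situations.\<close>
    let ?L = "i < k \<and> k \<in> ?H \<or> k < i \<and> i \<in> ?U" and ?L' = "k < i \<and> i \<in> ?H \<or> i < k \<and> k \<in> ?U"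
    let ?R = "l < j \<and> l \<in> ?U \<or> j < l \<and> j \<in> ?H" and ?R' = "j < l \<and> j \<in> ?U \<or> l < j \<and> l \<in> ?H"
    have x0: "(0 < ?d ?x0 \<longleftrightarrow> ?L) \<and> (?d ?x0 < 0 \<longleftrightarrow> ?L') \<and> (?d ?x0 = 0 \<longleftrightarrow> i = k)"
    proof (cases i k rule: linorder_cases)
      case less
      then have m: "max i k = k" "k < j" using True by auto
      show ?thesis unfolding m(1) height_ends(1)[OF fkl]
        using vertex_vs_segment[OF less m(2) ij(2)] HU[of k] disj[of k] less m(2) ij by auto
    next
      case equal
      then show ?thesis using height_ends(1)[OF fkl] height_ends(1)[OF fij] by simp
    next
      case greater
      then have m: "max i k = i" "i < l" using True by auto
      show ?thesis unfolding m(1) height_ends(1)[OF fij]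
        using vertex_vs_segment[OF greater m(2) kl(2)] HU[of i] disj[of i] greater m(2) kl by auto
    qed
    have x1: "(?d ?x1 < 0 \<longleftrightarrow> ?R) \<and> (0 < ?d ?x1 \<longleftrightarrow> ?R') \<and> (?d ?x1 = 0 \<longleftrightarrow> j = l)"
    proof (cases j l rule: linorder_cases)
      case less
      then have m: "min j l = j" "k < j" using True by auto
      show ?thesis unfolding m(1) height_ends(2)[OF fij]
        using vertex_vs_segment[OF m(2) less kl(2)] HU[of j] disj[of j] less m(2) kl by auto
    next
      case equal
      then show ?thesis using height_ends(2)[OF fkl] height_ends(2)[OF fij] by simp
    next
      case greater
      then have m: "min j l = l" "i < l" using True by auto
      show ?thesis unfolding m(1) height_ends(2)[OF fkl]
        using vertex_vs_segment[OF m(2) greater ij(2)] HU[of l] disj[of l] greater m(2) ij by auto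
    qed
    have lt: "?x0 < ?x1" using True ij kl by (intro fst_less) auto
    have "rel_interior (seg p i j) \<inter> rel_interior (seg p k l) \<noteq> {} \<longleftrightarrow>
      0 < ?d ?x0 \<and> ?d ?x1 < 0 \<or> ?d ?x0 < 0 \<and> 0 < ?d ?x1 \<or> ?d ?x0 = 0 \<and> ?d ?x1 = 0"
      unfolding inter d by (rule affine_root_iff[OF lt])
    also have "\<dots> \<longleftrightarrow> ?L \<and> ?R \<or> ?L' \<and> ?R' \<or> i = k \<and> j = l" using x0 x1 by (simp only:)
    finally have r: "rel_interior (seg p i j) \<inter> rel_interior (seg p k l) \<noteq> {} \<longleftrightarrow> ?L \<and> ?R \<or> ?L' \<and> ?R' \<or> i = k \<and> j = l" .
    have cd: "crosses_down ?H ?U i j k l \<longleftrightarrow> ?L \<and> ?R" "crosses_down ?H ?U k l i j \<longleftrightarrow> ?L' \<and> ?R'"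
      using True unfolding crosses_down_def by (simp_all only: max.commute[of k i] min.commute[of l j] simp_thms)
    show ?thesis unfolding crossing_def seg_inject[OF ij kl] r cd by (cases "i = k") simp_all
  qed
qed

end

section \<open>Interval summands of the path representations\<close>

lemma rdim_lam_rep: "rdim (lam_rep n Q \<pi> l) v = 1"
  by (induction l) simp_all

text \<open>Both recursions treat the entry \<open>\<pi> (Suc l)\<close> alike: adding a vertex to
  the path kills an arrow, removing one restores it. This links paths with representations.\<close>

lemma rmap_lam_rep:
  "rmap (lam_rep n Q \<pi> l) a = (if a \<in> lam_inner n Q \<pi> l then 0\<^sub>m 1 1 else 1\<^sub>m 1)"
  by (induction l) auto

lemma is_rep_lam_rep: "is_rep Q (lam_rep n Q \<pi> l)"
  by (auto simp: is_rep_def rdim_lam_rep rmap_lam_rep)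

lemma eta_eq:
  "eta n Q p \<pi> = {seg p i j | i j. \<exists>l\<le>n + 1. consecutive (lam_verts n Q \<pi> l) i j}"
proof -
  have fin: "finite (lam_verts n Q \<pi> l)" for l
  proof -
    have "finite (lam_inner n Q \<pi> l)" by (induction l) (auto simp: under_def)
    then show ?thesis by (simp add: lam_verts_def)
  qed
  have "path_segments p (lam_path n Q \<pi> l) = {seg p i j | i j. consecutive (lam_verts n Q \<pi> l) i j}" for l
    unfolding path_segments_def lam_path_def lam_verts_def[symmetric] sorted_list_consecutive[OF fin, symmetric]
    by blast
  then show ?thesis unfolding eta_def by auto
qed

context polygon
begin

sublocale dynkin "n + 2" Q
  by unfold_locales (rule dyn)

lemma Hi_eq: "Hi = over n Q" and Lo_eq: "Lo = under n Q"
proof -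
  have "e \<in> Hi \<longleftrightarrow> e \<in> over n Q" "e \<in> Lo \<longleftrightarrow> e \<in> under n Q" for e
    unfolding Hi_iff Lo_iff over_def under_def by (auto simp: arcs_Q)
  then show "Hi = over n Q" "Lo = under n Q" by blast+
qed

text \<open>The representation falls apart into intervals at its zero arrows. Arrow \<open>e\<close>
  joins \<open>e\<close> and \<open>e + 1\<close>, so an interval beginning at \<open>a\<close> is
  cut off by the path vertex \<open>a - 1\<close> and one ending at \<open>b\<close> by the path
  vertex \<open>b\<close>.\<close>

lemma retract_lam_rep_iff:
  assumes ab: "1 \<le> a" "a \<le> b" "b \<le> n + 2"
  shows "retract Q (I a b) (lam_rep n Q \<pi> l :: (nat, nat, 'k::field) quiver_rep) \<longleftrightarrow>
    consecutive (lam_verts n Q \<pi> l) (a - 1) b"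
proof
  let ?V = "lam_rep n Q \<pi> l :: (nat, nat, 'k) quiver_rep" and ?S = "lam_inner n Q \<pi> l"
  note V = is_rep_lam_rep[of Q n \<pi> l, where 'a = 'k]
  have Sr: "v \<in> lam_verts n Q \<pi> l \<longleftrightarrow> v = 0 \<or> v = n + 2 \<or> v \<in> ?S" for v by (simp add: lam_verts_def)
  {
    assume "retract Q (I a b) ?V"
    then obtain f g where fg: "is_hom Q (I a b) ?V f" "is_hom Q ?V (I a b) g"
      "\<And>v. v \<in> verts Q \<Longrightarrow> g v * f v = 1\<^sub>m (rdim (I a b :: (nat, nat, 'k) quiver_rep) v)"
      unfolding retract_def by blast
    have c: "f v \<in> carrier_mat 1 1" "g v \<in> carrier_mat 1 1" "f v \<noteq> 0\<^sub>m 1 1" "g v \<noteq> 0\<^sub>m 1 1" if v: "v \<in> {a..b}" for v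
    proof -
      have vQ: "v \<in> verts Q" using v ab by (simp add: verts_Q)
      show c: "f v \<in> carrier_mat 1 1" "g v \<in> carrier_mat 1 1"
        using is_hom_dims(1)[OF fg(1) vQ] is_hom_dims(1)[OF fg(2) vQ] v by (simp_all add: rdim_interval rdim_lam_rep)
      have "g v $$ (0,0) * f v $$ (0,0) = 1"
        using mat_mult_one_by_one[OF c(2,1)] fg(3)[OF vQ] v by (simp add: rdim_interval)
      then show "f v \<noteq> 0\<^sub>m 1 1" "g v \<noteq> 0\<^sub>m 1 1" by auto
    qed
    \<comment> \<open>An identity arrow across the boundary of the interval would force
      \<open>f\<close> or \<open>g\<close> to vanish at its end inside.\<close>
    have zero: "rmap ?V e = 0\<^sub>m 1 1" if e: "e \<in> arcs Q" and ht: "(head Q e \<in> {a..b}) \<noteq> (tail Q e \<in> {a..b})" for e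
    proof (rule ccontr)
      assume "rmap ?V e \<noteq> 0\<^sub>m 1 1"
      then have r: "rmap ?V e = 1\<^sub>m 1" by (auto simp: rmap_lam_rep split: if_splits)
      show False
      proof (cases "head Q e \<in> {a..b}")
        case True
        then have "tail Q e \<notin> {a..b}" using ht by blast
        then have "g (head Q e) * rmap ?V e = 0\<^sub>m 1 1"
          using hom_to_intervalD[OF fg(2) V e True] by (simp only: if_False rdim_lam_rep)
        then show False using c(2,4)[OF True] unfolding r by (simp add: mat_one_right)
      next
        case False
        then have t: "tail Q e \<in> {a..b}" using ht by blast
        have "rmap ?V e * f (tail Q e) = 0\<^sub>m 1 1"
          using hom_from_intervalD[OF fg(1) V e t] False by (simp only: if_False rdim_lam_rep)
        then show False using c(1,3)[OF t] unfolding r by (simp add: mat_one_left)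
      qed
    qed
    \<comment> \<open>A zero arrow inside the interval would force \<open>f\<close> to vanish at its
      head.\<close>
    have "k \<notin> ?S" if k: "a - 1 < k" "k < b" for k
    proof
      assume "k \<in> ?S"
      then have r: "rmap ?V k = 0\<^sub>m 1 1" by (simp add: rmap_lam_rep)
      have e: "k \<in> arcs Q" using k ab by (simp add: arcs_Q)
      have ht: "tail Q k \<in> {a..b}" "head Q k \<in> {a..b}"
        using k by (cases rule: arc_cases[OF e]; simp)+
      have "f (head Q k) = 0\<^sub>m 1 1"
        using hom_from_intervalD[OF fg(1) V e ht(1)] ht(2) c(1)[OF ht(1)] unfolding r by (simp add: mat_zero_left)
      then show False using c(3)[OF ht(2)] by simp
    qed
    then have mid: "k \<notin> lam_verts n Q \<pi> l" if "a - 1 < k" "k < b" for k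
      using that ab by (auto simp: Sr)
    have "a - 1 \<in> lam_verts n Q \<pi> l"
    \<comment> \<open>For \<open>a = 1\<close> there is no arrow to the left; the path vertex is
      then 0, which lies on every path.\<close>
    proof (cases "a = 1")
      case False
      then have "1 \<le> a - 1" "a - 1 < n + 2" using ab by linarith+
      then have e: "a - 1 \<in> arcs Q" unfolding arcs_Q by simp
      have "rmap ?V (a - 1) = 0\<^sub>m 1 1"
        using False ab by (intro zero[OF e]) (cases rule: arc_cases[OF e]; auto)
      then show ?thesis using ab by (auto simp: Sr rmap_lam_rep split: if_splits dest!: arg_cong[of _ _ "\<lambda>M. M $$ (0,0)"])
    qed (simp add: Sr)
    moreover have "b \<in> lam_verts n Q \<pi> l"
    proof (cases "b = n + 2")
      case False
      then have e: "b \<in> arcs Q" using ab by (simp add: arcs_Q)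
      have "rmap ?V b = 0\<^sub>m 1 1"
        using ab by (intro zero[OF e]) (cases rule: arc_cases[OF e]; auto)
      then show ?thesis by (auto simp: Sr rmap_lam_rep split: if_splits dest!: arg_cong[of _ _ "\<lambda>M. M $$ (0,0)"])
    qed (simp add: Sr)
    ultimately show "consecutive (lam_verts n Q \<pi> l) (a - 1) b"
      using mid ab unfolding consecutive_def by auto
  }
  assume cons: "consecutive (lam_verts n Q \<pi> l) (a - 1) b"
  have one: "rmap ?V e = 1\<^sub>m 1" if "e \<in> arcs Q" "tail Q e \<in> {a..b}" "head Q e \<in> {a..b}" for e
  proof -
    have "a - 1 < e" "e < b" using that ab by (cases rule: arc_cases[OF that(1)]; simp)+
    then have "e \<notin> lam_verts n Q \<pi> l" using cons by (auto simp: consecutive_def)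
    then show ?thesis by (simp add: rmap_lam_rep Sr)
  qed
  have zero: "rmap ?V e = 0\<^sub>m 1 1" if e: "e \<in> arcs Q" and ht: "(head Q e \<in> {a..b}) \<noteq> (tail Q e \<in> {a..b})" for e
  proof -
    have "e = a - 1 \<or> e = b" using ht ab by (cases rule: arc_cases[OF e]) auto
    then have "e \<in> lam_verts n Q \<pi> l" using cons by (auto simp: consecutive_def)
    then show ?thesis using e by (simp add: rmap_lam_rep Sr arcs_Q)
  qed
  have f: "is_hom Q (I a b) ?V (\<lambda>v. if v \<in> {a..b} then 1\<^sub>m 1 else 0\<^sub>m (rdim ?V v) 0)"
    by (rule hom_from_intervalI[OF V]) (auto simp: rdim_lam_rep one zero mat_zero_left)
  have g: "is_hom Q ?V (I a b) (\<lambda>v. if v \<in> {a..b} then 1\<^sub>m 1 else 0\<^sub>m 0 (rdim ?V v))"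
    by (rule hom_to_intervalI[OF V]) (auto simp: rdim_lam_rep one zero mat_zero_right)
  have "a \<in> {a..b}" using ab by simp
  then show "retract Q (I a b) ?V"
    by (intro retract_intervalI[OF f g V ab(1,3) \<open>a \<in> {a..b}\<close>])
      (auto simp: mat_one_left dest!: arg_cong[of _ _ "\<lambda>M. M $$ (0,0)"])
qed

end

section \<open>Triangulation, maximality, summands and uniqueness from the crossing relation\<close>

theorem proposition8p7:
  fixes n :: nat
    and Q :: "(nat, nat) pre_digraph"
    and p :: "nat \<Rightarrow> real \<times> real"
    and \<pi> :: "nat \<Rightarrow> nat"
    and R :: "(nat, nat, 'k::alg_closed_field) quiver_rep"
  assumes "dynkin_A (n + 2) Q"
    and "polygon_P n Q p"
    and "\<pi> permutes {1..n + 1}"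
    and "R = eta_rep n Q p \<pi>"
  shows "triangulation n p (eta n Q p \<pi>) \<and>
    maximal_almost_rigid Q R \<and>
    (\<forall>M. indec_summand Q M R \<longleftrightarrow> (\<exists>l\<le>n + 1. indec_summand Q M (lam_rep n Q \<pi> l))) \<and>
    (\<forall>T. maximal_almost_rigid Q T \<and>
         (\<forall>M. indec_summand Q M T \<longleftrightarrow> (\<exists>l\<le>n + 1. indec_summand Q M (lam_rep n Q \<pi> l)))
         \<longrightarrow> rep_iso Q T R)"
proof -
  interpret polygon n Q p by unfold_locales (rule assms)+
  interpret P: path_family "n + 2" "n + 1" "lam_verts n Q \<pi>" "over n Q" "under n Q" \<pi>
    by (rule path_family_lam[OF assms(1,3)])
  have bound: "w \<le> n + 2" if "w \<in> lam_verts n Q \<pi> l" for w l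
  proof -
    have "w = 0 \<or> w = n + 2 \<or> w \<in> over n Q \<union> under n Q"
      using that by (auto simp: lam_verts_def lam_inner_iff[OF dyn])
    then show ?thesis unfolding over_under(1)[OF dyn] by auto
  qed
  have edge_bound: "i < j" "j \<le> n + 2" if "P.edge i j" for i j
    using that bound unfolding P.edge_def consecutive_def by blast+
  have eta: "eta n Q p \<pi> = {seg p i j | i j. P.edge i j}"
    unfolding eta_eq P.edge_def ..
  have seg_eta: "seg p i j \<in> eta n Q p \<pi> \<longleftrightarrow> P.edge i j" if "i < j" "j \<le> n + 2" for i j
    unfolding eta using seg_inject[OF that] edge_bound by blast
  have tri: "triangulation n p (eta n Q p \<pi>)"
    unfolding triangulation_def
  proof (intro conjI allI impI)
    show "noncrossing_family n p (eta n Q p \<pi>)"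
      unfolding noncrossing_family_def
    proof (intro conjI ballI)
      show "eta n Q p \<pi> \<subseteq> segments n p" unfolding eta segments_def using edge_bound by blast
      fix s t assume "s \<in> eta n Q p \<pi>" "t \<in> eta n Q p \<pi>"
      then obtain i j k l where e: "P.edge i j" "P.edge k l" and st: "s = seg p i j" "t = seg p k l"
        unfolding eta by blast
      show "\<not> crossing s t"
        unfolding st crossing_iff[OF edge_bound[OF e(1)] edge_bound[OF e(2)]]
        using P.edges_noncrossing e by blast
    qed
    \<comment> \<open>Maximality: a further segment would cross an edge of some path, and that edge
      already belongs to the family.\<close>
    fix T' assume T': "noncrossing_family n p T' \<and> eta n Q p \<pi> \<subseteq> T'"
    have "t \<in> eta n Q p \<pi>" if t: "t \<in> T'" for t
    proof (rule ccontr)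
      assume nt: "t \<notin> eta n Q p \<pi>"
      obtain i j where ij: "t = seg p i j" "i < j" "j \<le> n + 2"
        using T' t unfolding noncrossing_family_def segments_def by blast
      then have "\<not> P.edge i j" using nt seg_eta by blast
      then obtain u v where uv: "P.edge u v"
        "crosses_down (over n Q) (under n Q) u v i j \<or> crosses_down (over n Q) (under n Q) i j u v"
        using P.non_edge_crosses[OF ij(2,3)] by blast
      then have "crossing t (seg p u v)"
        unfolding ij(1) crossing_iff[OF ij(2,3) edge_bound[OF uv(1)]] by blast
      moreover have "seg p u v \<in> T'" using T' uv(1) eta by blast
      ultimately show False using T' t unfolding noncrossing_family_def by blast
    qed
    then show "T' = eta n Q p \<pi>" using T' by blast
  qed
  \<comment> \<open>Listed in the order of \<open>tri_to_rep\<close>, so that \<open>R\<close> is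
    literally this sum; the first label is shifted by one, as in the map \<open>F\<close>.\<close>
  define L where "L = [(Suc i, j). i \<leftarrow> [0..<n + 3], j \<leftarrow> [i + 1..<n + 3], seg p i j \<in> eta n Q p \<pi>]"
  have R: "R = interval_sum L"
    unfolding assms(4) eta_rep_def tri_to_rep_def interval_sum_def L_def
    by (simp add: map_concat comp_def if_distrib cong: if_cong)
  have L: "(a, b) \<in> set L \<longleftrightarrow> 1 \<le> a \<and> P.edge (a - 1) b" for a b
  proof -
    have "(a, b) \<in> set L \<longleftrightarrow> (\<exists>i. a = Suc i \<and> i < b \<and> b \<le> n + 2 \<and> seg p i b \<in> eta n Q p \<pi>)"
      by (auto simp: L_def)
    also have "\<dots> \<longleftrightarrow> (\<exists>i. a = Suc i \<and> P.edge i b)" using seg_eta edge_bound by blast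
    also have "\<dots> \<longleftrightarrow> 1 \<le> a \<and> P.edge (a - 1) b" by (cases a) auto
    finally show ?thesis .
  qed
  have Lb: "1 \<le> a \<and> a \<le> b \<and> b \<le> n + 2" if "(a, b) \<in> set L" for a b
    using that edge_bound[of "a - 1" b] unfolding L by auto
  have dL: "distinct L"
  proof -
    have "distinct [(Suc i, j). i \<leftarrow> xs, j \<leftarrow> f i, c i j]" if "distinct xs" "\<And>i. distinct (f i)"
      for xs f and c :: "nat \<Rightarrow> nat \<Rightarrow> bool"
    proof -
      have "distinct [(Suc i, j). j \<leftarrow> ys, c i j]" if "distinct ys" for i ys
        using that by (induction ys) auto
      then show ?thesis using that by (induction xs) auto
    qed
    then show ?thesis unfolding L_def by simp
  qed
  have repR: "is_rep Q R" unfolding R by (rule is_rep_interval_sum)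
  have retR: "retract Q (I a b) R \<longleftrightarrow> P.edge (a - 1) b" if ab: "1 \<le> a" "a \<le> b" "b \<le> n + 2" for a b
    unfolding R using retract_interval_sum_iff[OF ab Lb, of L] L ab by simp
  have norep: "\<not> double_retract Q (I a b) R" if ab: "1 \<le> a" "a \<le> b" "b \<le> n + 2" for a b
    unfolding R by (rule not_double_retract_interval_sum[OF ab Lb dL])
  have rigidR: "almost_rigid Q R"
    unfolding almost_rigid_def rigid_pair_def[symmetric]
  proof (intro conjI)
    show "\<forall>A B. indecomposable Q A \<and> is_rep Q B \<longrightarrow> \<not> rep_iso Q R (rep_plus A (rep_plus A B))"
      using no_repeated_summand_iff[OF repR] norep by blast
    show "\<forall>A B. indec_summand Q A R \<and> indec_summand Q B R \<longrightarrow> rigid_pair Q A B"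
    proof (intro allI impI)
      fix A B assume "indec_summand Q A R \<and> indec_summand Q B R"
      then obtain a b c d where rep: "is_rep Q A" "is_rep Q B"
        and ab: "1 \<le> a" "a \<le> b" "b \<le> n + 2" "rep_iso Q A (I a b)" "retract Q (I a b) R"
        and cd: "1 \<le> c" "c \<le> d" "d \<le> n + 2" "rep_iso Q B (I c d)" "retract Q (I c d) R"
        using indec_summand_iff[OF repR] by blast
      have e: "P.edge (a - 1) b" "P.edge (c - 1) d" using retR ab cd by blast+
      have "rigid_pair Q (I (Suc (a - 1)) b) (I (Suc (c - 1)) d :: (nat, nat, 'k) quiver_rep)"
        using rigid_pair_interval[OF edge_bound[OF e(1)] edge_bound[OF e(2)]] P.edges_noncrossing[OF e]
        unfolding Hi_eq Lo_eq by blast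
      then have "rigid_pair Q (I a b) (I c d :: (nat, nat, 'k) quiver_rep)" using ab(1) cd(1) by simp
      then show "rigid_pair Q A B"
        by (rule rigid_pair_cong[OF rep is_rep_interval is_rep_interval ab(4) cd(4)])
    qed
  qed (rule repR)
  have maxR: "maximal_almost_rigid Q R"
    unfolding maximal_almost_rigid_def
  proof (intro conjI allI impI notI)
    fix M :: "(nat, nat, 'k) quiver_rep"
    assume M: "is_rep Q M \<and> \<not> rep_is_zero Q M" and ar: "almost_rigid Q (rep_plus R M)"
    note RM = is_rep_plus[OF repR, of M]
    have rRM: "is_rep Q (rep_plus R M)" using RM M by blast
    \<comment> \<open>One interval inside \<open>M\<close> suffices: it either repeats a summand of
      \<open>R\<close>, or its segment is not an edge, crosses one, and spoils rigidity in one of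
      the two orders.\<close>
    obtain a b where ab: "1 \<le> a" "a \<le> b" "b \<le> n + 2" "retract Q (I a b) M"
      using nonzero_has_interval_retract M by blast
    show False
    proof (cases "P.edge (a - 1) b")
      case True
      then have "double_retract Q (I a b) (rep_plus R M)"
        using double_retract_plus[OF is_rep_interval repR] M retR[OF ab(1-3)] ab(4) by blast
      then show False
        using no_repeated_summand_iff[OF rRM] ar ab unfolding almost_rigid_def by blast
    next
      case False
      have lt: "a - 1 < b" using ab by auto
      obtain u v where uv: "P.edge u v"
        and cr: "crosses_down (over n Q) (under n Q) u v (a - 1) b \<or> crosses_down (over n Q) (under n Q) (a - 1) b u v"
        using P.non_edge_crosses[OF lt ab(3) False] by blast
      note b' = edge_bound[OF uv]
      have Suc: "1 \<le> Suc u" "Suc u \<le> v" "v \<le> n + 2" using b' by auto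
      have 1: "indec_summand Q (I a b) (rep_plus R M)"
        using indec_summand_interval_iff[OF ab(1-3) rRM] retract_trans[OF is_rep_interval _ rRM ab(4)]
          retract_plus_right[OF repR] M by blast
      have "retract Q (I (Suc u) v) R" using retR[OF Suc] uv by simp
      then have 2: "indec_summand Q (I (Suc u) v) (rep_plus R M)"
        using indec_summand_interval_iff[OF Suc rRM] retract_trans[OF is_rep_interval repR rRM]
          retract_plus_left[OF repR] M by blast
      have pair: "rigid_pair Q A B" if "indec_summand Q A (rep_plus R M)" "indec_summand Q B (rep_plus R M)" for A B
        using ar that unfolding almost_rigid_def rigid_pair_def[symmetric] by blast
      have a: "Suc (a - 1) = a" using ab(1) by simp
      from cr show False
      proof
        assume "crosses_down (over n Q) (under n Q) u v (a - 1) b"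
        then have "\<not> rigid_pair Q (I (Suc u) v) (I a b :: (nat, nat, 'k) quiver_rep)"
          using crosses_down_not_rigid[OF b' lt ab(3)] unfolding Hi_eq Lo_eq a by blast
        then show False using pair[OF 2 1] by blast
      next
        assume "crosses_down (over n Q) (under n Q) (a - 1) b u v"
        then have "\<not> rigid_pair Q (I a b) (I (Suc u) v :: (nat, nat, 'k) quiver_rep)"
          using crosses_down_not_rigid[OF lt ab(3) b'] unfolding Hi_eq Lo_eq a by blast
        then show False using pair[OF 1 2] by blast
      qed
    qed
  qed (rule rigidR)
  have ret_lam: "(\<exists>l\<le>n + 1. retract Q (I a b) (lam_rep n Q \<pi> l :: (nat, nat, 'k) quiver_rep)) \<longleftrightarrow> P.edge (a - 1) b"
    if ab: "1 \<le> a" "a \<le> b" "b \<le> n + 2" for a b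
    unfolding retract_lam_rep_iff[OF ab] P.edge_def ..
  have summands: "indec_summand Q M R \<longleftrightarrow> (\<exists>l\<le>n + 1. indec_summand Q M (lam_rep n Q \<pi> l))" for M
    unfolding indec_summand_iff[OF repR] indec_summand_iff[OF is_rep_lam_rep]
    using retR ret_lam by blast
  \<comment> \<open>\<open>T\<close> has the same interval retracts as \<open>R\<close>, and by
    almost rigidity none of them occurs twice; this determines it.\<close>
  have "rep_iso Q T R"
    if T: "maximal_almost_rigid Q T"
      "\<forall>M. indec_summand Q M T \<longleftrightarrow> (\<exists>l\<le>n + 1. indec_summand Q M (lam_rep n Q \<pi> l))" for T
  proof -
    have ar: "almost_rigid Q T" using T(1) by (simp add: maximal_almost_rigid_def)
    then have repT: "is_rep Q T" by (simp add: almost_rigid_def)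
    show ?thesis
      unfolding R
    proof (rule rep_iso_interval_sum[OF repT dL Lb])
      fix a b assume ab: "1 \<le> a" "a \<le> b" "b \<le> n + 2"
      have "retract Q (I a b) T \<longleftrightarrow> indec_summand Q (I a b) T" by (rule indec_summand_interval_iff[OF ab repT, symmetric])
      also have "\<dots> \<longleftrightarrow> indec_summand Q (I a b) R" using T(2) summands by blast
      also have "\<dots> \<longleftrightarrow> retract Q (I a b) R" by (rule indec_summand_interval_iff[OF ab repR])
      also have "\<dots> \<longleftrightarrow> (a, b) \<in> set L" using retR[OF ab] L ab by simp
      finally show "retract Q (I a b) T \<longleftrightarrow> (a, b) \<in> set L" .
      show "\<not> double_retract Q (I a b) T"
        using no_repeated_summand_iff[OF repT] ar ab unfolding almost_rigid_def by blast
    qed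
  qed
  with tri maxR summands show ?thesis by blast
qed

end
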